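(* Let $N\ge 1$ be odd and let $\gamma:\mathbb{R}\to\mathbb{C}$ be a smooth $2\pi N$-periodic function such that the $N$ values $\{\gamma(\theta+2\pi k')\}_{0\le k'<N}$ are distinct for every $\theta$. Suppose that there exists $k\in\{0,\dots,N-1\}$ such that $$\gamma(\theta+2\pi(k+\tfrac12))=-\gamma(\theta)\quad\text{for all }\theta .$$ Then there exists a properly immersed Lagrangian disk $L$ in $(\mathbb{C}^2,\omega)$ that is mapped to itself by multiplication by $-1$ on $\mathbb{C}^2$ and that intersects every 3-sphere about the origin of sufficiently large radius transversely in an $N$-stranded braid that, after rescaling the sphere to the unit sphere, is braid isotopic to the braid in $S^3$ defined by $\gamma$.
   Context: Let $(z_1,z_2)$ be the standard complex coordinates on $\mathbb{C}^2$ and $\omega=\frac{i}{2}(dz_1\wedge d\bar z_1+dz_2\wedge d\bar z_2)$. Introduce the rotated complex coordinates $a_1=2^{-1/2}(z_1-\bar z_2)$, $a_2=2^{-1/2}(z_2+\bar z_1)$; in these coordinates the metric is still the standard one and $\omega=\frac{i}{2}(da_1\wedge da_2-d\bar a_1\wedge d\bar a_2)$. A surface is Lagrangian if $\omega$ pulls back to $0$ on it. All manifolds and maps are smooth. Let $S^1\subset\mathbb{C}$ be the unit circle. An $N$-stranded braid in $S^1\times\mathbb{C}$ means a closed braid: a compact embedded 1-dimensional submanifold whose projection to $S^1$ is an $N$-fold covering map. The braid defined by $\gamma$ in $S^1\times\mathbb{C}$ is the image of $\theta\mapsto(e^{i\theta},\gamma(\theta))$. A braid in $S^3$ is the image of a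 braid in $S^1\times\mathbb{C}$ under the embedding $(\zeta,z)\mapsto(\zeta,z)/(1+|z|^2)^{1/2}$, where $S^3$ is the unit sphere of $\mathbb{C}^2$ with coordinates $(a_1,a_2)$. Two braids are braid isotopic if they are isotopic through a 1-parameter family of braids. *)

theory Defs
  imports "HOL-Analysis.Analysis"
begin

section \<open>Smooth maps on subsets of Euclidean spaces\<close>

text \<open>Meaningful for open \<open>S\<close>: all iterated directional derivatives up to order \<open>k\<close> exist
  and are continuous, each intermediate one being Frechet differentiable.\<close>

primrec Ck_on :: "nat \<Rightarrow> 'a::euclidean_space set \<Rightarrow> ('a \<Rightarrow> 'b::euclidean_space) \<Rightarrow> bool" where
  "Ck_on 0 S f \<longleftrightarrow> continuous_on S f"
| "Ck_on (Suc k) S f \<longleftrightarrow>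
     (\<forall>x\<in>S. f differentiable (at x)) \<and> (\<forall>v. Ck_on k S (\<lambda>x. frechet_derivative f (at x) v))"

text \<open>Smoothness on an arbitrary subset means local extendability to a smooth map on an open set
  of the ambient space. On submanifolds (with boundary) and on open sets this is the usual
  notion.\<close>

definition smooth_on :: "'a::euclidean_space set \<Rightarrow> ('a \<Rightarrow> 'b::euclidean_space) \<Rightarrow> bool" where
  "smooth_on A f \<longleftrightarrow>
     (\<forall>x\<in>A. \<exists>U g. open U \<and> x \<in> U \<and> (\<forall>k. Ck_on k U g) \<and> (\<forall>y\<in>A \<inter> U. g y = f y))"

definition diffeomorphism_betw ::
    "('a::euclidean_space \<Rightarrow> 'b::euclidean_space) \<Rightarrow> 'a set \<Rightarrow> 'b set \<Rightarrow> bool" where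
  "diffeomorphism_betw f A B \<longleftrightarrow> bij_betw f A B \<and> smooth_on A f \<and> smooth_on B (inv_into A f)"

text \<open>Embedded 1-dimensional submanifold (without boundary) of a Euclidean space.\<close>

definition embedded_1_submanifold :: "'a::euclidean_space set \<Rightarrow> bool" where
  "embedded_1_submanifold K \<longleftrightarrow>
     (\<forall>x\<in>K. \<exists>U I c. openin (top_of_set K) U \<and> x \<in> U \<and> open (I::real set) \<and>
        diffeomorphism_betw c I U)"

text \<open>Covering map in the smooth category: a covering that is a local diffeomorphism. This excludes
  submanifolds with tangents killed by \<open>p\<close>, for which \<open>p\<close> can still be a topological covering.\<close>

definition smooth_covering ::
    "nat \<Rightarrow> 'a::euclidean_space set \<Rightarrow> ('a \<Rightarrow> 'b::euclidean_space) \<Rightarrow> 'b set \<Rightarrow> bool" where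
  "smooth_covering N K p S \<longleftrightarrow>
     covering_space K p S \<and>
     (\<forall>x\<in>K. \<exists>U. openin (top_of_set K) U \<and> x \<in> U \<and> openin (top_of_set S) (p ` U) \<and>
        diffeomorphism_betw p U (p ` U)) \<and>
     (\<forall>y\<in>S. finite {x\<in>K. p x = y} \<and> card {x\<in>K. p x = y} = N)"


section \<open>Closed braids\<close>

definition is_braid :: "nat \<Rightarrow> (complex \<times> complex) set \<Rightarrow> bool" where
  "is_braid N B \<longleftrightarrow>
     B \<subseteq> sphere 0 1 \<times> UNIV \<and> compact B \<and> embedded_1_submanifold B \<and>
     smooth_covering N B fst (sphere 0 1)"

definition braid_of :: "(real \<Rightarrow> complex) \<Rightarrow> (complex \<times> complex) set" where
  "braid_of \<gamma> = range (\<lambda>\<theta>. (cis \<theta>, \<gamma> \<theta>))"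

definition to_S3 :: "complex \<times> complex \<Rightarrow> complex \<times> complex" where
  "to_S3 = (\<lambda>(\<zeta>, z). (1 / sqrt (1 + (cmod z)\<^sup>2)) *\<^sub>R (\<zeta>, z))"

definition is_S3_braid :: "nat \<Rightarrow> (complex \<times> complex) set \<Rightarrow> bool" where
  "is_S3_braid N K \<longleftrightarrow> (\<exists>B. is_braid N B \<and> K = to_S3 ` B)"

text \<open>Smooth isotopy of \<open>K\<close> to \<open>K'\<close> through sets satisfying \<open>P\<close>, parametrised by \<open>K\<close>
  itself: \<open>\<Phi> t\<close> embeds \<open>K\<close> as the member of the family at time \<open>t\<close>.\<close>

definition isotopic_through ::
    "('a::euclidean_space set \<Rightarrow> bool) \<Rightarrow> 'a set \<Rightarrow> 'a set \<Rightarrow> bool" where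
  "isotopic_through P K K' \<longleftrightarrow>
     (\<exists>\<Phi> :: real \<Rightarrow> 'a \<Rightarrow> 'a.
        smooth_on ({0..1} \<times> K) (\<lambda>(t, x). \<Phi> t x) \<and>
        (\<forall>t\<in>{0..1}. diffeomorphism_betw (\<Phi> t) K (\<Phi> t ` K) \<and> P (\<Phi> t ` K)) \<and>
        (\<forall>x\<in>K. \<Phi> 0 x = x) \<and> \<Phi> 1 ` K = K')"

definition S3_braid_isotopic ::
    "nat \<Rightarrow> (complex \<times> complex) set \<Rightarrow> (complex \<times> complex) set \<Rightarrow> bool" where
  "S3_braid_isotopic N = isotopic_through (is_S3_braid N)"


section \<open>Immersed Lagrangian disks\<close>

text \<open>Points and tangent vectors of \<open>\<complex>\<^sup>2\<close> are written in the coordinates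
  \<open>(z\<^sub>1, z\<^sub>2)\<close>; \<open>rotated_coords\<close> gives \<open>(a\<^sub>1, a\<^sub>2)\<close>.\<close>

definition rotated_coords :: "complex \<times> complex \<Rightarrow> complex \<times> complex" where
  "rotated_coords = (\<lambda>(z1, z2). ((z1 - cnj z2) / sqrt 2, (z2 + cnj z1) / sqrt 2))"

text \<open>The wedge product is normalised by \<open>(\<alpha> \<and> \<beta>)(u, v) = \<alpha> u * \<beta> v - \<alpha> v * \<beta> u\<close>.
  The values are real; they are kept in \<open>complex\<close> to match the formula.\<close>

definition symplectic_form :: "complex \<times> complex \<Rightarrow> complex \<times> complex \<Rightarrow> complex" where
  "symplectic_form u v = \<i> / 2 *
     ((fst u * cnj (fst v) - fst v * cnj (fst u)) + (snd u * cnj (snd v) - snd v * cnj (snd u)))"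

definition immersion_on :: "'a::euclidean_space set \<Rightarrow> ('a \<Rightarrow> 'b::euclidean_space) \<Rightarrow> bool" where
  "immersion_on D f \<longleftrightarrow> smooth_on D f \<and> (\<forall>x\<in>D. inj (frechet_derivative f (at x)))"

definition lagrangian_on :: "complex set \<Rightarrow> (complex \<Rightarrow> complex \<times> complex) \<Rightarrow> bool" where
  "lagrangian_on D f \<longleftrightarrow>
     (\<forall>x\<in>D. \<forall>u v. symplectic_form (frechet_derivative f (at x) u) (frechet_derivative f (at x) v) = 0)"

abbreviation disk :: "complex set" where
  "disk \<equiv> ball 0 1"

definition properly_immersed_lagrangian_disk :: "(complex \<Rightarrow> complex \<times> complex) \<Rightarrow> bool" where
  "properly_immersed_lagrangian_disk f \<longleftrightarrow>
     immersion_on disk f \<and> proper_map (top_of_set disk) euclidean f \<and> lagrangian_on disk f"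

text \<open>Invariance of the immersed surface, i.e. of the immersion up to reparametrisation; in
  particular the image \<open>f ` disk\<close> is mapped to itself.\<close>

definition minus_invariant_disk :: "(complex \<Rightarrow> complex \<times> complex) \<Rightarrow> bool" where
  "minus_invariant_disk f \<longleftrightarrow>
     (\<exists>\<phi>. diffeomorphism_betw \<phi> disk disk \<and> (\<forall>x\<in>disk. f (\<phi> x) = - f x))"

text \<open>The tangent space of \<open>sphere 0 R\<close> at \<open>f x\<close> is the orthogonal complement of \<open>f x\<close>.\<close>

definition transverse_to_sphere ::
    "'a::euclidean_space set \<Rightarrow> ('a \<Rightarrow> 'b::euclidean_space) \<Rightarrow> real \<Rightarrow> bool" where
  "transverse_to_sphere D f R \<longleftrightarrow>
     (\<forall>x\<in>D. f x \<in> sphere 0 R \<longrightarrow>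
        {frechet_derivative f (at x) u + w |u w. f x \<bullet> w = 0} = UNIV)"

text \<open>The intersection with the sphere of radius \<open>R\<close>, in the coordinates \<open>(a\<^sub>1, a\<^sub>2)\<close> and
  rescaled to the unit sphere.\<close>

definition rescaled_link :: "(complex \<Rightarrow> complex \<times> complex) \<Rightarrow> real \<Rightarrow> (complex \<times> complex) set" where
  "rescaled_link f R = (\<lambda>p. (1 / R) *\<^sub>R rotated_coords p) ` (f ` disk \<inter> sphere 0 R)"

text \<open>Injectivity on the preimage says that the intersection of the immersed disk with the sphere,
  which a priori is an immersed curve, is the embedded one, not a multiple cover of it.\<close>

definition meets_sphere_in_braid ::
    "nat \<Rightarrow> (complex \<Rightarrow> complex \<times> complex) \<Rightarrow> real \<Rightarrow> bool" where
  "meets_sphere_in_braid N f R \<longleftrightarrow>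
     transverse_to_sphere disk f R \<and> inj_on f {x\<in>disk. f x \<in> sphere 0 R} \<and>
     is_S3_braid N (rescaled_link f R)"

end

theory Submission
  imports Defs
begin

text \<open>Since \<open>\<omega> = - Im (da\<^sub>1 \<and> da\<^sub>2)\<close>, writing \<open>a\<^sub>1 = e\<^bsup>\<zeta>\<^esup>\<close> with \<open>\<zeta> = t + \<i> \<theta>\<close> every real function
  \<open>S(t, \<theta>)\<close> generates a Lagrangian surface \<open>a\<^sub>2 = e\<^bsup>-\<zeta>\<^esup> (S\<^sub>\<theta> + \<i> S\<^sub>t)\<close>. On the \<open>N\<close>-fold cover
  \<open>w\<^sup>N = a\<^sub>1\<close> the choice \<open>S = Im (e\<^bsup>(1 + 1/N) \<zeta>\<^esup>) / (1 + 1/N)\<close> gives the holomorphic disk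
  \<open>(w\<^sup>N, w)\<close>, which closes up the surface at the origin. It is cut off and replaced near infinity by
  \<open>S = A(\<theta>) - e\<^bsup>-t\<^esup> B(\<theta>)\<close>, so that in the rotating frame \<open>e\<^bsup>\<i>\<theta>\<^esup>\<close> the link at infinity has the two
  real components \<open>A'\<close> and \<open>B\<close>, at different scales and up to small errors. The symmetry of \<open>\<gamma>\<close> forces
  \<open>2 k + 1 = N\<close>, hence \<open>h(\<theta>) = e\<^bsup>\<i>\<theta>\<^esup> \<gamma>(\<theta>)\<close> has period \<open>\<pi> N\<close>, and one takes \<open>B = Im h\<close> and \<open>A' = Re h - m\<close> with
  \<open>m\<close> the mean of \<open>Re h\<close>. Rescaling the components separately and translating by \<open>m\<close> are braid
  isotopies, and the errors are harmless because the sheets of \<open>\<gamma>\<close> are uniformly separated.\<close>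

section \<open>Calculus of smooth maps\<close>

text \<open>A summand of \<open>S\<close> that contributes \<open>B\<close> to
  \<open>S\<^sub>t\<close> also contributes a multiple of \<open>B'\<close> to
  \<open>S\<^sub>\<theta>\<close>. This coupling is the obstacle to prescribing both components of
  the link. The decaying factor \<open>exp (- t)\<close> makes the multiple of \<open>B'\<close>
  negligible beside \<open>A'\<close>, at the price of two scales: on the sphere of radius
  \<open>R\<close>, where \<open>exp t\<close> is close to \<open>R\<close>, the normalised
  components have orders \<open>1 / R\<^sup>2\<close> and \<open>1 / R\<^sup>3\<close>. The cutoff
  costs nothing: the Lagrangian condition only says that the mixed partials of \<open>S\<close>
  agree, which every sum of products \<open>p(t) q(\<theta>)\<close> satisfies, and
  \<open>a\<^sub>1 = exp \<zeta>\<close> alone makes the surface immersed away from the origin.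
  Multiplication by -1 is realised as \<open>w \<mapsto> - w\<close>, that is
  \<open>\<zeta> \<mapsto> \<zeta> + \<i> \<pi> N\<close>. As \<open>N\<close> is odd, this negates
  \<open>exp \<zeta>\<close>, so \<open>S\<^sub>\<theta> + \<i> S\<^sub>t\<close> must have period
  \<open>\<pi> N\<close> in \<open>\<theta>\<close>, half the period of the closed braid; the
  symmetry of \<open>\<gamma>\<close> provides it. The mean \<open>m\<close> is removed because the
  derivative of a periodic \<open>A\<close> has mean 0.\<close>

lemma Ck_on_subset: "Ck_on k S f \<Longrightarrow> T \<subseteq> S \<Longrightarrow> Ck_on k T f"
  by (induction k arbitrary: f) (auto intro: continuous_on_subset)

lemma Ck_on_SucD:
  assumes "Ck_on (Suc k) S f" "x \<in> S"
  shows "(f has_derivative frechet_derivative f (at x)) (at x)"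
  using assms by (simp add: frechet_derivative_works[symmetric])

lemma Ck_on_cong:
  assumes "open S" "Ck_on k S f" "\<And>x. x \<in> S \<Longrightarrow> f x = g x"
  shows "Ck_on k S g"
  using assms(2,3)
proof (induction k arbitrary: f g)
  case 0
  then show ?case by (simp cong: continuous_on_cong)
next
  case (Suc k)
  have d: "(g has_derivative frechet_derivative f (at x)) (at x)" if "x \<in> S" for x
    by (rule has_derivative_transform_within_open[OF Ck_on_SucD[OF Suc.prems(1) that] assms(1) that])
      (rule Suc.prems(2))
  have eq: "frechet_derivative f (at x) v = frechet_derivative g (at x) v" if "x \<in> S" for x v
    using frechet_derivative_at[OF d[OF that]] by simp
  have "Ck_on k S (\<lambda>x. frechet_derivative g (at x) v)" for v
    by (rule Suc.IH[of "\<lambda>x. frechet_derivative f (at x) v"]) (use Suc.prems eq in auto)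
  then show ?case using d by (auto simp: differentiable_def)
qed

text \<open>Derivatives at interior points are unique, so any explicit derivative may stand in for
  \<open>frechet_derivative\<close> in the recursion.\<close>

lemma Ck_on_SucI:
  assumes "open S" "\<And>x. x \<in> S \<Longrightarrow> (f has_derivative f' x) (at x)"
    and "\<And>v. Ck_on k S (\<lambda>x. f' x v)"
  shows "Ck_on (Suc k) S f"
proof -
  have "Ck_on k S (\<lambda>x. frechet_derivative f (at x) v)" for v
    by (rule Ck_on_cong[OF assms(1) assms(3)[of v]])
      (use frechet_derivative_at[OF assms(2)] in metis)
  then show ?thesis using assms(2) by (auto simp: differentiable_def)
qed

lemma Ck_on_Suc_imp: "Ck_on (Suc k) S f \<Longrightarrow> Ck_on k S f"
proof (induction k arbitrary: f)
  case 0
  then show ?case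
    by (auto intro!: continuous_at_imp_continuous_on differentiable_imp_continuous_within)
next
  case (Suc k)
  then show ?case by (metis Ck_on.simps(2))
qed

lemma Ck_on_local:
  assumes "\<And>x. x \<in> S \<Longrightarrow> \<exists>U. open U \<and> x \<in> U \<and> Ck_on k U f"
  shows "Ck_on k S f"
  using assms
proof (induction k arbitrary: f)
  case 0
  have "continuous (at x) f" if "x \<in> S" for x
    using 0[OF that] by (auto simp: continuous_on_eq_continuous_at)
  then show ?case by (simp add: continuous_at_imp_continuous_on)
next
  case (Suc k)
  have "Ck_on k S (\<lambda>x. frechet_derivative f (at x) v)" for v
    by (rule Suc.IH) (use Suc.prems in fastforce)
  moreover have "f differentiable (at x)" if "x \<in> S" for x
    using Suc.prems[OF that] by auto
  ultimately show ?case by simp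
qed

lemma Ck_on_const: "open S \<Longrightarrow> Ck_on k S (\<lambda>x. c)"
  by (induction k arbitrary: c) auto

lemma Ck_on_linear:
  assumes "bounded_linear L" "open S"
  shows "Ck_on k S L"
proof (cases k)
  case 0
  then show ?thesis using assms by (simp add: linear_continuous_on)
next
  case (Suc m)
  have "Ck_on (Suc m) S L"
    by (rule Ck_on_SucI[OF assms(2), where f'="\<lambda>x. L"])
      (auto intro: Ck_on_const assms bounded_linear_imp_has_derivative)
  then show ?thesis using Suc by simp
qed

lemma Ck_on_add:
  assumes "open S" "Ck_on k S f" "Ck_on k S g"
  shows "Ck_on k S (\<lambda>x. f x + g x)"
  using assms(2,3)
proof (induction k arbitrary: f g)
  case 0
  then show ?case by (auto intro: continuous_on_add)
next
  case (Suc k)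
  show ?case
    by (rule Ck_on_SucI[OF assms(1) has_derivative_add[OF Ck_on_SucD[OF Suc.prems(1)] Ck_on_SucD[OF Suc.prems(2)]]])
      (use Suc in auto)
qed

lemma Ck_on_bilinear:
  assumes "bounded_bilinear bop" "open S" "Ck_on k S f" "Ck_on k S g"
  shows "Ck_on k S (\<lambda>x. bop (f x) (g x))"
  using assms(3,4)
proof (induction k arbitrary: f g)
  case 0
  then show ?case by (auto intro: bounded_bilinear.continuous_on[OF assms(1)])
next
  case (Suc k)
  show ?case
  proof (rule Ck_on_SucI[OF assms(2)])
    fix x assume "x \<in> S"
    then show "((\<lambda>x. bop (f x) (g x)) has_derivative (\<lambda>v. bop (f x) (frechet_derivative g (at x) v)
        + bop (frechet_derivative f (at x) v) (g x))) (at x)"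
      by (intro bounded_bilinear.FDERIV[OF assms(1)] Ck_on_SucD[OF Suc.prems(1)] Ck_on_SucD[OF Suc.prems(2)])
  next
    fix v
    show "Ck_on k S (\<lambda>x. bop (f x) (frechet_derivative g (at x) v)
        + bop (frechet_derivative f (at x) v) (g x))"
      using Suc.prems
      by (intro Ck_on_add assms(2) Suc.IH Ck_on_Suc_imp[OF Suc.prems(1)] Ck_on_Suc_imp[OF Suc.prems(2)]) auto
  qed
qed

lemma Ck_on_sum:
  assumes "open S" "finite I" "\<And>i. i \<in> I \<Longrightarrow> Ck_on k S (f i)"
  shows "Ck_on k S (\<lambda>x. \<Sum>i\<in>I. f i x)"
  using assms(2,3) by (induction I rule: finite_induct) (auto intro!: Ck_on_add Ck_on_const assms(1))

text \<open>The chain rule applies the outer derivative to a direction that moves with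
  \<open>x\<close>, whereas \<open>Ck_on\<close> speaks of fixed directions only. Expanding the
  moving direction in \<open>Basis\<close> leaves products of a coefficient and a derivative in a
  fixed direction, which the induction hypothesis and the bilinear rule cover.\<close>

lemma Ck_on_compose:
  assumes "open S" "open T" "Ck_on k S f" "Ck_on k T g" "f ` S \<subseteq> T"
  shows "Ck_on k S (\<lambda>x. g (f x))"
  using assms(3-5)
proof (induction k arbitrary: f g)
  case 0
  then show ?case by (auto intro: continuous_on_compose2)
next
  case (Suc k)
  define f' where "f' x = frechet_derivative f (at x)" for x
  define g' where "g' x = frechet_derivative g (at x)" for x
  have f': "(f has_derivative f' x) (at x)" if "x \<in> S" for x
    using Ck_on_SucD[OF Suc.prems(1) that] by (simp add: f'_def)
  have g': "(g has_derivative g' (f x)) (at (f x))" if "x \<in> S" for x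
    using Ck_on_SucD[OF Suc.prems(2), of "f x"] that Suc.prems(3) by (auto simp: g'_def)
  have d: "((\<lambda>x. g (f x)) has_derivative (\<lambda>v. g' (f x) (f' x v))) (at x)" if "x \<in> S" for x
    using diff_chain_at[OF f'[OF that] g'[OF that]] by (simp add: o_def)
  show ?case
  proof (rule Ck_on_SucI[OF assms(1) d])
    fix v
    have ck: "Ck_on k S (\<lambda>x. \<Sum>b\<in>Basis. (f' x v \<bullet> b) *\<^sub>R g' (f x) b)"
    proof (rule Ck_on_sum[OF assms(1)])
      fix b :: 'b assume "b \<in> Basis"
      have "Ck_on k S (\<lambda>x. f' x v \<bullet> b)"
        by (rule Ck_on_bilinear[OF bounded_bilinear_inner assms(1)])
          (use Suc.prems in \<open>auto simp: f'_def assms(1) intro: Ck_on_const\<close>)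
      moreover have "Ck_on k S (\<lambda>x. g' (f x) b)"
        by (rule Suc.IH) (use Suc.prems(2,3) Ck_on_Suc_imp[OF Suc.prems(1)] in \<open>auto simp: g'_def\<close>)
      ultimately show "Ck_on k S (\<lambda>x. (f' x v \<bullet> b) *\<^sub>R g' (f x) b)"
        by (intro Ck_on_bilinear[OF bounded_bilinear_scaleR assms(1)])
    qed simp
    show "Ck_on k S (\<lambda>x. g' (f x) (f' x v))"
    proof (rule Ck_on_cong[OF assms(1) ck])
      fix x assume x: "x \<in> S"
      have lin: "linear (g' (f x))" using g'[OF x] has_derivative_linear by blast
      have "g' (f x) (f' x v) = g' (f x) (\<Sum>b\<in>Basis. (f' x v \<bullet> b) *\<^sub>R b)"
        by (simp add: euclidean_representation)
      also have "\<dots> = (\<Sum>b\<in>Basis. (f' x v \<bullet> b) *\<^sub>R g' (f x) b)"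
        by (simp add: linear_sum[OF lin] linear_scale[OF lin])
      finally show "(\<Sum>b\<in>Basis. (f' x v \<bullet> b) *\<^sub>R g' (f x) b) = g' (f x) (f' x v)" by simp
    qed
  qed
qed

section \<open>Smooth functions on open sets\<close>

definition Cinf_on :: "'a::euclidean_space set \<Rightarrow> ('a \<Rightarrow> 'b::euclidean_space) \<Rightarrow> bool" where
  "Cinf_on S f \<longleftrightarrow> open S \<and> (\<forall>k. Ck_on k S f)"

lemma Cinf_onI: "open S \<Longrightarrow> (\<And>k. Ck_on k S f) \<Longrightarrow> Cinf_on S f"
  by (simp add: Cinf_on_def)

lemma Cinf_on_open: "Cinf_on S f \<Longrightarrow> open S"
  by (simp add: Cinf_on_def)

lemma Cinf_on_continuous: "Cinf_on S f \<Longrightarrow> continuous_on S f"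
  by (metis Cinf_on_def Ck_on.simps(1))

lemma Cinf_on_has_derivative:
  "Cinf_on S f \<Longrightarrow> x \<in> S \<Longrightarrow> (f has_derivative frechet_derivative f (at x)) (at x)"
  by (metis Cinf_on_def Ck_on_SucD)

lemma Cinf_on_derivative:
  "Cinf_on S f \<Longrightarrow> Cinf_on S (\<lambda>x. frechet_derivative f (at x) v)"
  by (metis Cinf_on_def Ck_on.simps(2))

lemma Cinf_on_subset: "Cinf_on S f \<Longrightarrow> T \<subseteq> S \<Longrightarrow> open T \<Longrightarrow> Cinf_on T f"
  by (auto simp: Cinf_on_def intro: Ck_on_subset)

lemma Cinf_on_cong: "Cinf_on S f \<Longrightarrow> (\<And>x. x \<in> S \<Longrightarrow> f x = g x) \<Longrightarrow> Cinf_on S g"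
  unfolding Cinf_on_def using Ck_on_cong by blast

lemma Cinf_on_local:
  assumes "\<And>x. x \<in> S \<Longrightarrow> \<exists>U. x \<in> U \<and> U \<subseteq> S \<and> Cinf_on U f"
  shows "Cinf_on S f"
proof (rule Cinf_onI)
  show "open S"
    by (subst open_subopen) (use assms Cinf_on_open in metis)
  show "Ck_on k S f" for k
    by (rule Ck_on_local) (use assms in \<open>fastforce simp: Cinf_on_def\<close>)
qed

lemma Cinf_on_const: "open S \<Longrightarrow> Cinf_on S (\<lambda>x. c)"
  by (simp add: Cinf_on_def Ck_on_const)

lemma Cinf_on_linear: "bounded_linear L \<Longrightarrow> open S \<Longrightarrow> Cinf_on S L"
  by (simp add: Cinf_on_def Ck_on_linear)

lemma Cinf_on_add: "Cinf_on S f \<Longrightarrow> Cinf_on S g \<Longrightarrow> Cinf_on S (\<lambda>x. f x + g x)"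
  by (simp add: Cinf_on_def Ck_on_add)

lemma Cinf_on_bilinear:
  "bounded_bilinear bop \<Longrightarrow> Cinf_on S f \<Longrightarrow> Cinf_on S g \<Longrightarrow> Cinf_on S (\<lambda>x. bop (f x) (g x))"
  by (simp add: Cinf_on_def Ck_on_bilinear)

lemma Cinf_on_compose:
  assumes "Cinf_on T g" "Cinf_on S f" "\<And>x. x \<in> S \<Longrightarrow> f x \<in> T"
  shows "Cinf_on S (\<lambda>x. g (f x))"
  using assms Ck_on_compose[of S T _ f g] by (auto simp: Cinf_on_def image_subset_iff)

lemma Cinf_on_linear_compose:
  "bounded_linear L \<Longrightarrow> Cinf_on S f \<Longrightarrow> Cinf_on S (\<lambda>x. L (f x))"
  by (rule Cinf_on_compose[OF Cinf_on_linear[OF _ open_UNIV]]) auto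

lemma Cinf_on_ident: "open S \<Longrightarrow> Cinf_on S (\<lambda>x. x)"
  by (rule Cinf_on_linear[OF bounded_linear_ident])

lemma Cinf_on_minus: "Cinf_on S f \<Longrightarrow> Cinf_on S (\<lambda>x. - f x)"
  by (rule Cinf_on_linear_compose[OF bounded_linear_minus[OF bounded_linear_ident]])

lemma Cinf_on_diff: "Cinf_on S f \<Longrightarrow> Cinf_on S g \<Longrightarrow> Cinf_on S (\<lambda>x. f x - g x)"
  using Cinf_on_add[of S f "\<lambda>x. - g x"] by (simp add: Cinf_on_minus)

lemma Cinf_on_mult:
  fixes f g :: "_ \<Rightarrow> 'b::{euclidean_space,real_normed_algebra}"
  shows "Cinf_on S f \<Longrightarrow> Cinf_on S g \<Longrightarrow> Cinf_on S (\<lambda>x. f x * g x)"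
  by (rule Cinf_on_bilinear[OF bounded_bilinear_mult])

lemma Cinf_on_scaleR:
  "Cinf_on S f \<Longrightarrow> Cinf_on S g \<Longrightarrow> Cinf_on S (\<lambda>x. f x *\<^sub>R g x)"
  by (rule Cinf_on_bilinear[OF bounded_bilinear_scaleR])

lemma Cinf_on_inner: "Cinf_on S f \<Longrightarrow> Cinf_on S g \<Longrightarrow> Cinf_on S (\<lambda>x. f x \<bullet> g x)"
  by (rule Cinf_on_bilinear[OF bounded_bilinear_inner])

lemma Cinf_on_power:
  fixes f :: "_ \<Rightarrow> 'b::{euclidean_space,real_normed_algebra_1}"
  shows "Cinf_on S f \<Longrightarrow> Cinf_on S (\<lambda>x. f x ^ n)"
  by (induction n) (auto intro: Cinf_on_mult Cinf_on_const Cinf_on_open)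

lemma Cinf_on_fst: "Cinf_on S f \<Longrightarrow> Cinf_on S (\<lambda>x. fst (f x))"
  by (rule Cinf_on_linear_compose[OF bounded_linear_fst])

lemma Cinf_on_snd: "Cinf_on S f \<Longrightarrow> Cinf_on S (\<lambda>x. snd (f x))"
  by (rule Cinf_on_linear_compose[OF bounded_linear_snd])

lemma Cinf_on_Re: "Cinf_on S f \<Longrightarrow> Cinf_on S (\<lambda>x. Re (f x))"
  by (rule Cinf_on_linear_compose[OF bounded_linear_Re])

lemma Cinf_on_Im: "Cinf_on S f \<Longrightarrow> Cinf_on S (\<lambda>x. Im (f x))"
  by (rule Cinf_on_linear_compose[OF bounded_linear_Im])

lemma Cinf_on_cnj: "Cinf_on S f \<Longrightarrow> Cinf_on S (\<lambda>x. cnj (f x))"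
  by (rule Cinf_on_linear_compose[OF bounded_linear_cnj])

lemma Cinf_on_complex_of_real: "Cinf_on S f \<Longrightarrow> Cinf_on S (\<lambda>x. complex_of_real (f x))"
  by (rule Cinf_on_linear_compose[OF bounded_linear_of_real])

lemma Cinf_on_Pair:
  assumes "Cinf_on S f" "Cinf_on S g"
  shows "Cinf_on S (\<lambda>x. (f x, g x))"
proof -
  have "bounded_linear (\<lambda>a. (a, 0 :: 'c))" "bounded_linear (\<lambda>b. (0 :: 'b, b))"
    by (auto intro!: bounded_linear_Pair bounded_linear_ident bounded_linear_zero)
  then have "Cinf_on S (\<lambda>x. (f x, 0) + (0, g x))"
    using assms by (intro Cinf_on_add Cinf_on_linear_compose[where L = "\<lambda>a. (a, 0)"]
        Cinf_on_linear_compose[where L = "\<lambda>b. (0, b)"])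
  then show ?thesis by simp
qed

lemma Cinf_on_Complex:
  assumes "Cinf_on S f" "Cinf_on S g"
  shows "Cinf_on S (\<lambda>x. Complex (f x) (g x))"
proof -
  have "Cinf_on S (\<lambda>x. complex_of_real (f x) + \<i> * complex_of_real (g x))"
    using assms by (intro Cinf_on_add Cinf_on_mult Cinf_on_const Cinf_on_complex_of_real Cinf_on_open)
  then show ?thesis by (simp add: Complex_eq)
qed

lemmas Cinf_on_intros = Cinf_on_const Cinf_on_ident Cinf_on_add Cinf_on_minus Cinf_on_diff
  Cinf_on_mult Cinf_on_scaleR Cinf_on_inner Cinf_on_power Cinf_on_fst Cinf_on_snd Cinf_on_Re
  Cinf_on_Im Cinf_on_cnj Cinf_on_complex_of_real Cinf_on_Pair Cinf_on_Complex

section \<open>Smoothness of elementary functions\<close>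

lemma Ck_on_Suc_field:
  fixes f :: "'a::{euclidean_space,real_normed_field} \<Rightarrow> 'a"
  assumes "open S" "\<And>x. x \<in> S \<Longrightarrow> (f has_field_derivative f' x) (at x)" "Ck_on k S f'"
  shows "Ck_on (Suc k) S f"
  by (rule Ck_on_SucI[OF assms(1), where f'="\<lambda>x v. f' x * v"])
    (use assms in \<open>auto simp: has_field_derivative_def intro!: Ck_on_bilinear[OF bounded_bilinear_mult] Ck_on_const\<close>)

lemma Ck_on_Suc_vector:
  fixes f :: "real \<Rightarrow> 'a::euclidean_space"
  assumes "open S" "\<And>x. x \<in> S \<Longrightarrow> (f has_vector_derivative f' x) (at x)" "Ck_on k S f'"
  shows "Ck_on (Suc k) S f"
  by (rule Ck_on_SucI[OF assms(1), where f'="\<lambda>x v. v *\<^sub>R f' x"])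
    (use assms in \<open>auto simp: has_vector_derivative_def intro!: Ck_on_bilinear[OF bounded_bilinear_scaleR] Ck_on_const\<close>)

lemma Cinf_on_vector_antiderivative:
  fixes f :: "real \<Rightarrow> 'a::euclidean_space"
  assumes "\<And>x. x \<in> S \<Longrightarrow> (f has_vector_derivative f' x) (at x)" "Cinf_on S f'"
  shows "Cinf_on S f"
proof (rule Cinf_onI)
  fix k
  show "Ck_on k S f"
    using Ck_on_Suc_vector[of S f f' k] assms Ck_on_Suc_imp by (auto simp: Cinf_on_def)
qed (rule Cinf_on_open[OF assms(2)])

lemma Cinf_on_vector_derivative:
  fixes f :: "real \<Rightarrow> 'a::euclidean_space"
  assumes "Cinf_on S f"
  shows "Cinf_on S (\<lambda>x. vector_derivative f (at x))"
    and "x \<in> S \<Longrightarrow> (f has_vector_derivative vector_derivative f (at x)) (at x)"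
proof -
  have d: "f differentiable (at x)" if "x \<in> S" for x
    using Cinf_on_has_derivative[OF assms that] by (auto simp: differentiable_def)
  show "Cinf_on S (\<lambda>x. vector_derivative f (at x))"
    by (rule Cinf_on_cong[OF Cinf_on_derivative[OF assms, of 1]])
      (simp add: d frechet_derivative_eq_vector_derivative)
  show "x \<in> S \<Longrightarrow> (f has_vector_derivative vector_derivative f (at x)) (at x)"
    using d vector_derivative_works by blast
qed

lemma Cinf_on_exp:
  fixes S :: "'a::{euclidean_space,real_normed_field,banach} set"
  assumes "open S" shows "Cinf_on S (exp :: 'a \<Rightarrow> 'a)"
proof (rule Cinf_onI[OF assms])
  show "Ck_on k S (exp :: 'a \<Rightarrow> 'a)" for k
  proof (induction k)
    case (Suc k)
    show ?case by (rule Ck_on_Suc_field[OF assms DERIV_exp Suc])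
  qed (auto intro!: continuous_intros)
qed

lemma Cinf_on_inverse:
  "Cinf_on (- {0}) (inverse :: 'a \<Rightarrow> 'a::{euclidean_space,real_normed_field})"
proof (rule Cinf_onI)
  show "Ck_on k (- {0}) (inverse :: 'a \<Rightarrow> 'a)" for k
  proof (induction k)
    case (Suc k)
    show ?case
    proof (rule Ck_on_Suc_field)
      show "(inverse has_field_derivative - 1 * (inverse x * inverse x)) (at x)" if "x \<in> -{0}" for x :: 'a
        using that DERIV_inverse[of x UNIV] by (simp add: power2_eq_square)
      show "Ck_on k (- {0}) (\<lambda>x::'a. - 1 * (inverse x * inverse x))"
        by (intro Ck_on_bilinear[OF bounded_bilinear_mult] Suc Ck_on_const) auto
    qed auto
  qed (auto intro!: continuous_intros)
qed auto

lemma Cinf_on_Ln: "Cinf_on (- \<real>\<^sub>\<le>\<^sub>0) Ln"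
proof (rule Cinf_onI)
  have o: "open (- \<real>\<^sub>\<le>\<^sub>0 :: complex set)" by (simp add: open_Compl)
  have s: "(- \<real>\<^sub>\<le>\<^sub>0 :: complex set) \<subseteq> - {0}" by auto
  show "Ck_on k (- \<real>\<^sub>\<le>\<^sub>0) Ln" for k
  proof (cases k)
    case 0
    then show ?thesis by (auto intro!: continuous_intros)
  next
    case (Suc m)
    have "Ck_on (Suc m) (- \<real>\<^sub>\<le>\<^sub>0) Ln"
      by (rule Ck_on_Suc_field[where f' = inverse])
        (use o Cinf_on_subset[OF Cinf_on_inverse s o] in \<open>auto simp: Cinf_on_def has_field_derivative_Ln\<close>)
    then show ?thesis using Suc by simp
  qed
qed (simp add: open_Compl)

lemma Cinf_on_sqrt: "Cinf_on {0<..} sqrt"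
proof (rule Cinf_onI)
  show "Ck_on k {0<..} sqrt" for k
  proof (induction k)
    case (Suc k)
    have "Ck_on k {0<..} (\<lambda>x. inverse (sqrt x) / 2)"
      unfolding divide_inverse
      by (intro Ck_on_bilinear[OF bounded_bilinear_mult] Ck_on_const
          Ck_on_compose[of "{0<..}" "-{0}" k sqrt inverse] Suc)
        (use Cinf_on_inverse[where ?'a = real] in \<open>auto simp: Cinf_on_def\<close>)
    then show ?case
      by (intro Ck_on_Suc_field[where f' = "\<lambda>x. inverse (sqrt x) / 2"]) (auto intro: DERIV_real_sqrt)
  qed (auto intro!: continuous_intros)
qed auto

lemma Cinf_on_divide:
  fixes f g :: "_ \<Rightarrow> 'b::{euclidean_space,real_normed_field}"
  assumes "Cinf_on S f" "Cinf_on S g" "\<And>x. x \<in> S \<Longrightarrow> g x \<noteq> 0"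
  shows "Cinf_on S (\<lambda>x. f x / g x)"
  unfolding divide_inverse
  by (intro Cinf_on_mult assms Cinf_on_compose[OF Cinf_on_inverse]) (use assms in auto)

lemma Cinf_on_exp_compose:
  fixes f :: "_ \<Rightarrow> 'b::{euclidean_space,real_normed_field,banach}"
  shows "Cinf_on S f \<Longrightarrow> Cinf_on S (\<lambda>x. exp (f x))"
  by (rule Cinf_on_compose[OF Cinf_on_exp[OF open_UNIV]]) auto

lemma Cinf_on_cis: "Cinf_on S f \<Longrightarrow> Cinf_on S (\<lambda>x. cis (f x))"
  unfolding cis_conv_exp by (intro Cinf_on_exp_compose Cinf_on_intros) (auto intro: Cinf_on_open)

lemma Cinf_on_sin: "Cinf_on S f \<Longrightarrow> Cinf_on S (\<lambda>x. sin (f x :: real))"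
  using Cinf_on_Im[OF Cinf_on_cis[of S f]] by simp

section \<open>Smooth maps on arbitrary subsets\<close>

lemma smooth_on_if_Cinf: "Cinf_on U f \<Longrightarrow> A \<subseteq> U \<Longrightarrow> smooth_on A f"
  unfolding smooth_on_def Cinf_on_def by blast

lemma smooth_onI_local:
  assumes "\<And>x. x \<in> A \<Longrightarrow> \<exists>U g. x \<in> U \<and> Cinf_on U g \<and> (\<forall>y\<in>A \<inter> U. g y = f y)"
  shows "smooth_on A f"
  using assms unfolding smooth_on_def Cinf_on_def by metis

lemma smooth_onE_local:
  assumes "smooth_on A f" "x \<in> A"
  obtains U g where "x \<in> U" "Cinf_on U g" "\<And>y. y \<in> A \<Longrightarrow> y \<in> U \<Longrightarrow> g y = f y"
  using assms unfolding smooth_on_def Cinf_on_def by (metis IntI)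

lemma smooth_on_open_iff: "open S \<Longrightarrow> smooth_on S f \<longleftrightarrow> Cinf_on S f"
proof
  assume S: "open S" "smooth_on S f"
  show "Cinf_on S f"
  proof (rule Cinf_on_local)
    fix x assume "x \<in> S"
    then obtain U g where U: "x \<in> U" "Cinf_on U g" "\<And>y. y \<in> S \<Longrightarrow> y \<in> U \<Longrightarrow> g y = f y"
      using S smooth_onE_local by metis
    have "Cinf_on (U \<inter> S) f"
      by (rule Cinf_on_cong[OF Cinf_on_subset[OF U(2)]]) (use U(3) S Cinf_on_open[OF U(2)] in auto)
    then show "\<exists>U. x \<in> U \<and> U \<subseteq> S \<and> Cinf_on U f"
      using U(1) \<open>x \<in> S\<close> by (intro exI[of _ "U \<inter> S"]) simp
  qed
qed (auto intro: smooth_on_if_Cinf)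

lemma smooth_on_cong: "smooth_on A f \<Longrightarrow> (\<And>x. x \<in> A \<Longrightarrow> f x = g x) \<Longrightarrow> smooth_on A g"
  unfolding smooth_on_def by force

lemma smooth_on_compose:
  assumes "smooth_on B g" "smooth_on A f" "\<And>x. x \<in> A \<Longrightarrow> f x \<in> B"
  shows "smooth_on A (\<lambda>x. g (f x))"
proof (rule smooth_onI_local)
  fix x assume x: "x \<in> A"
  obtain U F where U: "x \<in> U" "Cinf_on U F" "\<And>y. y \<in> A \<Longrightarrow> y \<in> U \<Longrightarrow> F y = f y"
    using smooth_onE_local[OF assms(2) x] by metis
  obtain V G where V: "f x \<in> V" "Cinf_on V G" "\<And>y. y \<in> B \<Longrightarrow> y \<in> V \<Longrightarrow> G y = g y"
    using smooth_onE_local[OF assms(1) assms(3)[OF x]] by metis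
  define W where "W = F -` V \<inter> U"
  have W: "open W" unfolding W_def
    using U V by (meson Cinf_on_continuous Cinf_on_open continuous_on_open_vimage)
  have "Cinf_on W (\<lambda>x. G (F x))"
    by (rule Cinf_on_compose[OF V(2) Cinf_on_subset[OF U(2)]]) (use W in \<open>auto simp: W_def\<close>)
  moreover have "x \<in> W" "\<forall>y\<in>A \<inter> W. G (F y) = g (f y)"
    using U V x assms(3) by (auto simp: W_def)
  ultimately show "\<exists>U ga. x \<in> U \<and> Cinf_on U ga \<and> (\<forall>y\<in>A \<inter> U. ga y = g (f y))"
    by blast
qed

lemma smooth_on_Pair:
  assumes "smooth_on A f" "smooth_on A g"
  shows "smooth_on A (\<lambda>x. (f x, g x))"
proof (rule smooth_onI_local)
  fix x assume x: "x \<in> A"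
  obtain U F where U: "x \<in> U" "Cinf_on U F" "\<And>y. y \<in> A \<Longrightarrow> y \<in> U \<Longrightarrow> F y = f y"
    using smooth_onE_local[OF assms(1) x] by metis
  obtain V G where V: "x \<in> V" "Cinf_on V G" "\<And>y. y \<in> A \<Longrightarrow> y \<in> V \<Longrightarrow> G y = g y"
    using smooth_onE_local[OF assms(2) x] by metis
  have "open (U \<inter> V)" by (intro open_Int Cinf_on_open[OF U(2)] Cinf_on_open[OF V(2)])
  then have "Cinf_on (U \<inter> V) (\<lambda>x. (F x, G x))"
    by (intro Cinf_on_Pair Cinf_on_subset[OF U(2)] Cinf_on_subset[OF V(2)]) auto
  then show "\<exists>W h. x \<in> W \<and> Cinf_on W h \<and> (\<forall>y\<in>A \<inter> W. h y = (f y, g y))"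
    using U V by (intro exI[of _ "U \<inter> V"] exI[of _ "\<lambda>x. (F x, G x)"]) auto
qed

subsection \<open>A smooth cutoff\<close>

text \<open>Differentiation sends the \<open>m\<close>-th function of this family to a combination of the
  \<open>(m + 1)\<close>-st and the \<open>(m + 2)\<close>-nd, which gives smoothness of all of them at once.\<close>

definition flat_fun :: "nat \<Rightarrow> real \<Rightarrow> real" where
  "flat_fun m x = (if x \<le> 0 then 0 else inverse x ^ m * exp (- inverse x))"

lemma flat_fun_tendsto_0: "((\<lambda>h. flat_fun m h) \<longlongrightarrow> 0) (at 0)"
proof -
  have "((\<lambda>y. y ^ m / exp y) \<longlongrightarrow> (0::real)) at_top"
    by (rule tendsto_power_div_exp_0)
  then have "((\<lambda>h. inverse h ^ m / exp (inverse h)) \<longlongrightarrow> (0::real)) (at_right 0)"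
    by (rule filterlim_compose) (rule filterlim_inverse_at_top_right)
  then have "((\<lambda>h. flat_fun m h) \<longlongrightarrow> 0) (at_right 0)"
    by (rule Lim_transform_eventually)
      (auto simp: eventually_at_filter flat_fun_def exp_minus divide_inverse)
  moreover have "((\<lambda>h. flat_fun m h) \<longlongrightarrow> 0) (at_left 0)"
    by (rule tendsto_eventually) (auto simp: eventually_at_filter flat_fun_def)
  ultimately show ?thesis by (simp add: filterlim_split_at)
qed

lemma flat_fun_derivative:
  "(flat_fun m has_field_derivative (flat_fun (m + 2) x - m * flat_fun (m + 1) x)) (at x)"
proof -
  consider "x < 0" | "x = 0" | "x > 0" by linarith
  then show ?thesis
  proof cases
    case 1
    have "((\<lambda>_. 0) has_field_derivative 0) (at x)" by simp
    then have "(flat_fun m has_field_derivative 0) (at x)"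
      by (rule has_field_derivative_transform_within_open[where S = "{..<0}"])
        (use 1 in \<open>auto simp: flat_fun_def\<close>)
    then show ?thesis using 1 by (simp add: flat_fun_def)
  next
    case 2
    \<comment> \<open>Dividing by \<open>h\<close> raises the index by one, so the difference
      quotient at 0 is \<open>flat_fun (Suc m)\<close>.\<close>
    have "((\<lambda>h. flat_fun m h / h) \<longlongrightarrow> 0) (at 0)"
      using flat_fun_tendsto_0[of "Suc m"]
      by (rule Lim_transform_eventually)
        (auto simp: eventually_at_filter flat_fun_def divide_inverse)
    then have "((\<lambda>h. (flat_fun m (0 + h) - flat_fun m 0) / h) \<longlongrightarrow> 0) (at 0)"
      by (simp add: flat_fun_def)
    then show ?thesis using 2 by (simp add: DERIV_def flat_fun_def)
  next
    case 3
    have "((\<lambda>x. inverse x ^ m * exp (- inverse x)) has_field_derivative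
        (flat_fun (m + 2) x - m * flat_fun (m + 1) x)) (at x)"
    proof -
      have "((\<lambda>x. inverse x ^ m * exp (- inverse x)) has_field_derivative
        (inverse x ^ m * (exp (- inverse x) * (inverse x * inverse x)) +
         (real m * inverse x ^ (m - Suc 0) * (- (inverse x * inverse x))) * exp (- inverse x))) (at x)"
        using 3 by (auto intro!: derivative_eq_intros)
      also have "real m * inverse x ^ (m - Suc 0) * (- (inverse x * inverse x))
          = - (m * inverse x ^ (m + 1))"
        by (cases m) (auto simp: algebra_simps)
      finally show ?thesis
        using 3 by (simp add: flat_fun_def algebra_simps)
    qed
    then show ?thesis
      by (rule has_field_derivative_transform_within_open[where S = "{0<..}"])
        (use 3 in \<open>auto simp: flat_fun_def\<close>)
  qed
qed

lemma Cinf_on_flat_fun: "Cinf_on UNIV (flat_fun m)"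
proof (rule Cinf_onI)
  show "Ck_on k UNIV (flat_fun m)" for k
  proof (induction k arbitrary: m)
    case 0
    have "continuous (at x) (flat_fun m)" for x
      using flat_fun_derivative DERIV_isCont by blast
    then show ?case by (simp add: continuous_on_eq_continuous_at)
  next
    case (Suc k)
    have "Ck_on k UNIV (\<lambda>x. flat_fun (m + 2) x + (- real m) * flat_fun (m + 1) x)"
      by (intro Ck_on_add Ck_on_bilinear[OF bounded_bilinear_mult] Ck_on_const Suc) auto
    then show ?case
      by (intro Ck_on_Suc_field[OF _ flat_fun_derivative]) simp_all
  qed
qed simp

definition cutoff :: "real \<Rightarrow> real" where
  "cutoff t = flat_fun 0 (1 - t) / (flat_fun 0 (1 - t) + flat_fun 0 t)"

text \<open>\<open>t\<close> and \<open>1 - t\<close> are never both nonpositive.\<close>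

lemma flat_fun_sum_pos: "flat_fun 0 (1 - t) + flat_fun 0 t > 0"
  by (auto simp: flat_fun_def intro: add_pos_pos)

lemma Cinf_on_cutoff: "Cinf_on UNIV cutoff"
proof -
  have "Cinf_on UNIV (\<lambda>t. flat_fun 0 (1 - t) / (flat_fun 0 (1 - t) + flat_fun 0 t))"
    by (intro Cinf_on_divide Cinf_on_add Cinf_on_flat_fun
        Cinf_on_compose[OF Cinf_on_flat_fun] Cinf_on_intros)
      (use flat_fun_sum_pos in \<open>auto simp: less_le\<close>)
  then show ?thesis by (simp add: cutoff_def[abs_def])
qed

lemma cutoff_eq_1: "t \<le> 0 \<Longrightarrow> cutoff t = 1"
  by (auto simp: cutoff_def flat_fun_def)

lemma cutoff_eq_0: "t \<ge> 1 \<Longrightarrow> cutoff t = 0"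
  by (auto simp: cutoff_def flat_fun_def)

subsection \<open>Implicit functions of one variable\<close>

text \<open>The solution \<open>\<sigma>\<close> is given and only its regularity is at stake. Since
  the derivative in the first variable is positive on the whole half line from \<open>t0\<close> on,
  monotonicity takes the place of the inverse function theorem.\<close>

context
  fixes F :: "real \<times> real \<Rightarrow> real" and \<sigma> :: "real \<Rightarrow> real" and t0 c :: real
  assumes smooth: "Cinf_on UNIV F"
    and pos: "\<And>t x. t \<ge> t0 \<Longrightarrow> frechet_derivative F (at (t, x)) (1, 0) > 0"
    and \<sigma>: "\<And>x. \<sigma> x > t0" "\<And>x. F (\<sigma> x, x) = c"
begin

private definition "F1 p = frechet_derivative F (at p) (1, 0)"
private definition "F2 p = frechet_derivative F (at p) (0, 1)"

private lemma F1: "((\<lambda>t. F (t, x)) has_field_derivative F1 (t, x)) (at t)"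
proof -
  have "((\<lambda>t. F (t, x)) has_derivative (\<lambda>h. frechet_derivative F (at (t, x)) (h, 0))) (at t)"
    by (rule has_derivative_compose[OF _ Cinf_on_has_derivative[OF smooth], of "\<lambda>t. (t, x)", simplified])
      (auto intro!: derivative_eq_intros)
  moreover have "frechet_derivative F (at (t, x)) (h, 0) = F1 (t, x) * h" for h
  proof -
    have l: "linear (frechet_derivative F (at (t, x)))"
      using Cinf_on_has_derivative[OF smooth] has_derivative_linear by blast
    show ?thesis using linear_scale[OF l, of h "(1, 0)"] by (simp add: F1_def)
  qed
  ultimately show ?thesis by (simp add: has_field_derivative_def)
qed

private lemma F2: "((\<lambda>x. F (t, x)) has_field_derivative F2 (t, x)) (at x)"
proof -
  have "((\<lambda>x. F (t, x)) has_derivative (\<lambda>h. frechet_derivative F (at (t, x)) (0, h))) (at x)"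
    by (rule has_derivative_compose[OF _ Cinf_on_has_derivative[OF smooth], of "\<lambda>x. (t, x)", simplified])
      (auto intro!: derivative_eq_intros)
  moreover have "frechet_derivative F (at (t, x)) (0, h) = F2 (t, x) * h" for h
  proof -
    have l: "linear (frechet_derivative F (at (t, x)))"
      using Cinf_on_has_derivative[OF smooth] has_derivative_linear by blast
    show ?thesis using linear_scale[OF l, of h "(0, 1)"] by (simp add: F2_def)
  qed
  ultimately show ?thesis by (simp add: has_field_derivative_def)
qed

private lemma mono: "t0 \<le> s \<Longrightarrow> s < t \<Longrightarrow> F (s, x) < F (t, x)"
  by (rule DERIV_pos_imp_increasing[where f = "\<lambda>t. F (t, x)"])
    (use F1 pos in \<open>force simp: F1_def\<close>)+

private lemma F_cont: "isCont F p"
  using Cinf_on_continuous[OF smooth] by (cases p) (simp add: continuous_on_eq_continuous_at)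

private lemma F1_Cinf: "Cinf_on UNIV F1" and F2_Cinf: "Cinf_on UNIV F2"
  by (auto simp: F1_def[abs_def] F2_def[abs_def] intro: Cinf_on_derivative smooth)

private lemma F_slice_tendsto: "((\<lambda>x. F (t, x)) \<longlongrightarrow> F (t, x0)) (at x0)"
  by (rule isCont_tendsto_compose[OF F_cont]) (auto intro!: tendsto_intros)

text \<open>By monotonicity, \<open>\<sigma> x\<close> lies above or below a height \<open>b\<close>
  according to the sign of \<open>c - F (b, x)\<close>, and a strict sign persists under small
  changes of \<open>x\<close>.\<close>

private lemma implicit_tendsto: "(\<sigma> \<longlongrightarrow> \<sigma> x0) (at x0)"
proof (rule order_tendstoI)
  fix a assume "a < \<sigma> x0"
  \<comment> \<open>Monotonicity holds only from \<open>t0\<close> on; raising \<open>a\<close> to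
    \<open>t0\<close> is harmless because \<open>\<sigma>\<close> exceeds \<open>t0\<close>.\<close>
  define b where "b = max a t0"
  have "F (b, x0) < F (\<sigma> x0, x0)"
    using \<open>a < \<sigma> x0\<close> \<sigma>(1)[of x0] by (intro mono) (auto simp: b_def)
  then have "\<forall>\<^sub>F x in at x0. F (b, x) < c"
    by (intro order_tendstoD(2)[OF F_slice_tendsto]) (simp add: \<sigma>)
  then show "\<forall>\<^sub>F x in at x0. a < \<sigma> x"
  proof (rule eventually_mono)
    fix x assume "F (b, x) < c"
    then have "\<not> \<sigma> x \<le> b"
      using mono[of "\<sigma> x" b x] \<sigma>(1)[of x] \<sigma>(2)[of x] by (cases "\<sigma> x = b") auto
    then show "a < \<sigma> x" by (simp add: b_def)
  qed
next
  fix b assume b: "\<sigma> x0 < b"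
  have "F (\<sigma> x0, x0) < F (b, x0)"
    using b \<sigma>(1)[of x0] by (intro mono) auto
  then have "\<forall>\<^sub>F x in at x0. F (b, x) > c"
    by (intro order_tendstoD(1)[OF F_slice_tendsto]) (simp add: \<sigma>)
  then show "\<forall>\<^sub>F x in at x0. \<sigma> x < b"
  proof (rule eventually_mono)
    fix x assume "F (b, x) > c"
    then show "\<sigma> x < b"
      using mono[of b "\<sigma> x" x] b \<sigma>(1)[of x0] \<sigma>(2)[of x] by (cases "\<sigma> x" b rule: linorder_cases) auto
  qed
qed

text \<open>The mean value theorem in the first variable turns
  \<open>F (\<sigma> x, x) = F (\<sigma> x0, x0)\<close> into an exact formula for the difference
  quotient of \<open>\<sigma>\<close>, with \<open>F1\<close> evaluated at a height squeezed between
  \<open>\<sigma> x0\<close> and \<open>\<sigma> x\<close>.\<close>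

private lemma implicit_derivative:
  "(\<sigma> has_field_derivative - F2 (\<sigma> x0, x0) / F1 (\<sigma> x0, x0)) (at x0)"
proof -
  have "\<exists>s. min (\<sigma> x0) (\<sigma> x) \<le> s \<and> s \<le> max (\<sigma> x0) (\<sigma> x)
      \<and> F (\<sigma> x, x) - F (\<sigma> x0, x) = (\<sigma> x - \<sigma> x0) * F1 (s, x)" for x
  proof (cases "\<sigma> x0" "\<sigma> x" rule: linorder_cases)
    case less
    obtain s where "\<sigma> x0 < s" "s < \<sigma> x" "F (\<sigma> x, x) - F (\<sigma> x0, x) = (\<sigma> x - \<sigma> x0) * F1 (s, x)"
      using MVT2[OF less, of "\<lambda>t. F (t, x)" "\<lambda>t. F1 (t, x)"] F1 by blast
    then show ?thesis using less by (intro exI[of _ s]) auto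
  next
    case greater
    obtain s where "\<sigma> x < s" "s < \<sigma> x0" "F (\<sigma> x0, x) - F (\<sigma> x, x) = (\<sigma> x0 - \<sigma> x) * F1 (s, x)"
      using MVT2[OF greater, of "\<lambda>t. F (t, x)" "\<lambda>t. F1 (t, x)"] F1 by blast
    then show ?thesis using greater by (intro exI[of _ s]) (auto simp: algebra_simps)
  qed auto
  then obtain s where s: "min (\<sigma> x0) (\<sigma> x) \<le> s x" "s x \<le> max (\<sigma> x0) (\<sigma> x)"
      "F (\<sigma> x, x) - F (\<sigma> x0, x) = (\<sigma> x - \<sigma> x0) * F1 (s x, x)" for x
    by metis
  have slim: "(s \<longlongrightarrow> \<sigma> x0) (at x0)"
  proof (rule tendsto_sandwich)
    show "((\<lambda>x. min (\<sigma> x0) (\<sigma> x)) \<longlongrightarrow> \<sigma> x0) (at x0)"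
      using tendsto_min[OF tendsto_const implicit_tendsto, of "\<sigma> x0" x0] by simp
    show "((\<lambda>x. max (\<sigma> x0) (\<sigma> x)) \<longlongrightarrow> \<sigma> x0) (at x0)"
      using tendsto_max[OF tendsto_const implicit_tendsto, of "\<sigma> x0" x0] by simp
  qed (use s in auto)
  have F1p: "F1 (t, x) > 0" if "t \<ge> t0" for t x
    using pos[OF that] by (simp add: F1_def)
  have sge: "s x \<ge> t0" for x using s(1)[of x] \<sigma>(1)[of x] \<sigma>(1)[of x0] by linarith
  have F1lim: "((\<lambda>x. F1 (s x, x)) \<longlongrightarrow> F1 (\<sigma> x0, x0)) (at x0)"
  proof (rule isCont_tendsto_compose[where g = F1 and f = "\<lambda>x. (s x, x)"])
    show "isCont F1 (\<sigma> x0, x0)"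
      using Cinf_on_continuous[OF F1_Cinf] by (simp add: continuous_on_eq_continuous_at)
  qed (intro tendsto_intros slim)
  have F2lim: "((\<lambda>x. (F (\<sigma> x0, x) - F (\<sigma> x0, x0)) / (x - x0)) \<longlongrightarrow> F2 (\<sigma> x0, x0)) (at x0)"
    using F2[of "\<sigma> x0" x0] by (simp add: has_field_derivative_iff)
  have "((\<lambda>x. - ((F (\<sigma> x0, x) - F (\<sigma> x0, x0)) / (x - x0)) / F1 (s x, x))
      \<longlongrightarrow> - F2 (\<sigma> x0, x0) / F1 (\<sigma> x0, x0)) (at x0)"
    using F1p[of "\<sigma> x0" x0] \<sigma>(1)[of x0]
    by (intro tendsto_divide tendsto_minus F1lim F2lim) auto
  moreover have "- ((F (\<sigma> x0, x) - F (\<sigma> x0, x0)) / (x - x0)) / F1 (s x, x)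
      = (\<sigma> x - \<sigma> x0) / (x - x0)" for x
  proof -
    have "- (F (\<sigma> x0, x) - F (\<sigma> x0, x0)) = (\<sigma> x - \<sigma> x0) * F1 (s x, x)"
      using s(3)[of x] \<sigma>(2)[of x] \<sigma>(2)[of x0] by linarith
    moreover have "F1 (s x, x) \<noteq> 0" using F1p[OF sge[of x], of x] by simp
    ultimately show ?thesis by (simp add: divide_simps)
  qed
  ultimately show ?thesis by (simp add: has_field_derivative_iff)
qed

text \<open>Bootstrapping: the derivative of \<open>\<sigma>\<close> is a smooth expression in
  \<open>\<sigma>\<close> itself, so order \<open>k\<close> of \<open>\<sigma>\<close> yields order
  \<open>k + 1\<close>.\<close>

lemma Cinf_on_implicit: "Cinf_on UNIV \<sigma>"
proof (rule Cinf_onI)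
  have F1p: "F1 (\<sigma> x, x) > 0" for x
    using pos[of "\<sigma> x" x] \<sigma>(1)[of x] by (simp add: F1_def)
  have pair: "Ck_on k UNIV (\<lambda>x. (\<sigma> x, x))" if "Ck_on k UNIV \<sigma>" for k
  proof -
    have "Ck_on k UNIV (\<lambda>x. \<sigma> x *\<^sub>R (1::real, 0::real) + x *\<^sub>R (0, 1))"
      by (intro Ck_on_add Ck_on_bilinear[OF bounded_bilinear_scaleR] Ck_on_const that
          Ck_on_linear[OF bounded_linear_ident]) auto
    then show ?thesis by simp
  qed
  show "Ck_on k UNIV \<sigma>" for k
  proof (induction k)
    case 0
    have "isCont \<sigma> x" for x using implicit_tendsto by (simp add: isCont_def)
    then show ?case by (simp add: continuous_on_eq_continuous_at)
  next
    case (Suc k)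
    have "Ck_on k UNIV (\<lambda>x. - 1 * F2 (\<sigma> x, x) * inverse (F1 (\<sigma> x, x)))"
    proof (intro Ck_on_bilinear[OF bounded_bilinear_mult] Ck_on_const)
      show "Ck_on k UNIV (\<lambda>x. F2 (\<sigma> x, x))"
        by (rule Ck_on_compose[OF open_UNIV open_UNIV pair[OF Suc]])
          (use F2_Cinf in \<open>auto simp: Cinf_on_def\<close>)
      have "Ck_on k UNIV (\<lambda>x. F1 (\<sigma> x, x))"
        by (rule Ck_on_compose[OF open_UNIV open_UNIV pair[OF Suc]])
          (use F1_Cinf in \<open>auto simp: Cinf_on_def\<close>)
      then show "Ck_on k UNIV (\<lambda>x. inverse (F1 (\<sigma> x, x)))"
        by (rule Ck_on_compose[of _ "- {0}", rotated 2])
          (use Cinf_on_inverse[where ?'a = real] F1p in \<open>auto simp: Cinf_on_def less_le\<close>)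
    qed auto
    then show ?case
      by (intro Ck_on_Suc_field[OF _ implicit_derivative]) (auto simp: divide_inverse)
  qed
qed simp

end

section \<open>Closed braids given by periodic functions\<close>

text \<open>The branch of the argument near \<open>a\<close>: rotating by \<open>- a\<close> first
  keeps the cut of \<open>Ln\<close> on the opposite side of the circle.\<close>

definition angle_near :: "real \<Rightarrow> complex \<Rightarrow> real" where
  "angle_near a \<zeta> = a + Im (Ln (\<zeta> * cis (- a)))"

lemma angle_near_cis: "\<bar>x - a\<bar> < pi / 2 \<Longrightarrow> angle_near a (cis x) = x"
proof -
  assume "\<bar>x - a\<bar> < pi / 2"
  then have "x - a \<in> {- pi<..pi}"
    using pi_gt_zero by (simp only: greaterThanAtMost_iff) linarith
  then show ?thesis by (simp add: angle_near_def cis_mult Ln_cis)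
qed

lemma cis_angle_near: "cmod \<zeta> = 1 \<Longrightarrow> cis (angle_near a \<zeta>) = \<zeta>"
proof -
  assume 1: "cmod \<zeta> = 1"
  define w where "w = \<zeta> * cis (- a)"
  have w: "w \<noteq> 0" "cmod w = 1" using 1 by (auto simp: w_def norm_mult)
  have "cis (Im (Ln w)) = exp (Ln w)"
    using w by (simp add: exp_eq_polar)
  then have "cis (Im (Ln w)) = w" using w by simp
  then have "cis (angle_near a \<zeta>) = cis a * (\<zeta> * cis (- a))"
    by (simp add: angle_near_def w_def flip: cis_mult)
  also have "\<dots> = \<zeta> * (cis a * cis (- a))" by (simp only: mult_ac)
  also have "\<dots> = \<zeta>" by (simp add: cis_mult)
  finally show ?thesis .
qed

lemma sphere_eq_cis: "\<zeta> \<in> sphere 0 1 \<Longrightarrow> \<exists>a. \<zeta> = cis a"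
  by (rule exI[of _ "angle_near 0 \<zeta>"]) (simp add: cis_angle_near)

lemma angle_near_bound: "Re (\<zeta> * cis (- a)) > 0 \<Longrightarrow> \<bar>angle_near a \<zeta> - a\<bar> < pi / 2"
  by (simp only: angle_near_def add_diff_cancel_left' Re_Ln_pos_lt_imp)

lemma open_half_plane: "open {\<zeta>. Re (\<zeta> * cis (- a)) > 0}"
  by (intro open_Collect_less continuous_intros)

lemma Cinf_on_angle_near: "Cinf_on {\<zeta>. Re (\<zeta> * cis (- a)) > 0} (angle_near a)"
  unfolding angle_near_def[abs_def]
proof (intro Cinf_on_intros Cinf_on_compose[OF Cinf_on_Ln] open_half_plane)
  fix \<zeta> assume "\<zeta> \<in> {\<zeta>. Re (\<zeta> * cis (- a)) > 0}"
  then show "\<zeta> * cis (- a) \<in> - \<real>\<^sub>\<le>\<^sub>0"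
    by (auto simp: complex_nonpos_Reals_iff)
qed

lemma cis_eq_iff: "cis x = cis y \<longleftrightarrow> (\<exists>m::int. x = y + 2 * pi * m)"
  using sin_cos_eq_iff[of x y] by (auto simp: complex_eq_iff)

lemma diffeomorphism_betwI:
  assumes "smooth_on A f" "smooth_on B g" "\<And>x. x \<in> A \<Longrightarrow> f x \<in> B" "\<And>y. y \<in> B \<Longrightarrow> g y \<in> A"
    and "\<And>x. x \<in> A \<Longrightarrow> g (f x) = x" "\<And>y. y \<in> B \<Longrightarrow> f (g y) = y"
  shows "diffeomorphism_betw f A B"
proof -
  have bij: "bij_betw f A B" by (rule bij_betw_byWitness[where f' = g]) (use assms in auto)
  have "g y = inv_into A f y" if "y \<in> B" for y
    using that assms bij by (metis bij_betw_imp_inj_on inv_into_f_f)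
  then have "smooth_on B (inv_into A f)" using smooth_on_cong[OF assms(2)] by simp
  then show ?thesis using bij assms(1) by (simp add: diffeomorphism_betw_def)
qed

lemma periodic_of_int:
  fixes f :: "'a::ring_1 \<Rightarrow> 'b"
  assumes "\<And>x. f (x + c) = f x"
  shows "f (x + of_int m * c) = f x"
proof (induction m arbitrary: x rule: int_induct[where k = 0])
  case (step1 i)
  show ?case using step1(2)[of "x + c"] assms[of x] by (simp add: algebra_simps)
next
  case (step2 i)
  show ?case using step2(2)[of "x - c"] assms[of "x - c"] by (simp add: algebra_simps)
qed simp

lemma periodic_range:
  fixes f :: "real \<Rightarrow> 'b"
  assumes "\<And>x. f (x + c) = f x" "c > 0"
  shows "f x \<in> f ` {0..c}"
proof -
  define m where "m = \<lfloor>x / c\<rfloor>"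
  have "of_int m \<le> x / c" "x / c < of_int m + 1" unfolding m_def by linarith+
  then have "of_int m * c \<le> x" "x < (of_int m + 1) * c"
    using assms(2) by (simp_all only: pos_le_divide_eq pos_divide_less_eq)
  then have "x + of_int (- m) * c \<in> {0..c}" by (auto simp: algebra_simps)
  moreover have "f x = f (x + of_int (- m) * c)"
    using periodic_of_int[of f c x "- m"] assms(1) by simp
  ultimately show ?thesis by blast
qed

locale braid_curve =
  fixes N :: nat and z :: "real \<Rightarrow> complex"
  assumes N: "N \<ge> 1"
    and smooth: "Cinf_on UNIV z"
    and periodic: "z (\<theta> + 2 * pi * real N) = z \<theta>"
    and separated: "inj_on (\<lambda>k. z (\<theta> + 2 * pi * real k)) {0..<N}"
begin

definition curve :: "real \<Rightarrow> complex \<times> complex" where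
  "curve \<theta> = (cis \<theta>, z \<theta>)"

lemma braid_of_eq: "braid_of z = range curve"
  by (simp add: braid_of_def curve_def[abs_def])

lemma fst_curve: "fst (curve \<theta>) = cis \<theta>"
  by (simp add: curve_def)

lemma smooth_curve: "Cinf_on UNIV curve"
  unfolding curve_def[abs_def] by (intro Cinf_on_Pair Cinf_on_cis Cinf_on_ident smooth) simp

lemma periodic_int: "z (\<theta> + 2 * pi * real N * of_int m) = z \<theta>"
  using periodic_of_int[of z "2 * pi * real N" \<theta> m] periodic by (simp add: mult.commute)

text \<open>The offset \<open>x\<close> is kept apart from the number of turns so that the same rule
  also serves for angles merely close to \<open>\<theta>\<close>.\<close>

lemma sheet_reduce:
  obtains r where "r < N" "z (\<theta> + 2 * pi * of_int j + x) = z (\<theta> + 2 * pi * real r + x)"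
    "int r = j mod int N"
proof
  define r where "r = nat (j mod int N)"
  show r: "r < N" using N by (simp add: r_def nat_less_iff)
  show i: "int r = j mod int N" using N by (simp add: r_def)
  have "real_of_int j = real r + real N * of_int (j div int N)"
    by (metis i mult_div_mod_eq of_int_add of_int_mult of_int_of_nat_eq add.commute)
  then have "\<theta> + 2 * pi * of_int j + x = (\<theta> + 2 * pi * real r + x) + 2 * pi * real N * of_int (j div int N)"
    by (simp add: algebra_simps)
  then show "z (\<theta> + 2 * pi * of_int j + x) = z (\<theta> + 2 * pi * real r + x)"
    by (simp only: periodic_int)
qed

text \<open>Equal angles differ by \<open>j\<close> turns, and separation of the sheets forces
  \<open>N\<close> to divide \<open>j\<close>. Thus the closed braid is the line modulo
  \<open>2 * pi * N\<close>, with the same identifications for every braid curve with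
  \<open>N\<close> strands.\<close>

lemma curve_eq_iff: "curve x = curve y \<longleftrightarrow> (\<exists>m::int. x = y + 2 * pi * real N * of_int m)"
proof
  assume eq: "curve x = curve y"
  then obtain j :: int where j: "x = y + 2 * pi * of_int j"
    using cis_eq_iff by (auto simp: curve_def)
  obtain r where r: "r < N" "z (y + 2 * pi * of_int j + 0) = z (y + 2 * pi * real r + 0)"
      "int r = j mod int N" by (rule sheet_reduce)
  have "z (y + 2 * pi * real r) = z (y + 2 * pi * real 0)"
    using r(2) eq j by (simp add: curve_def)
  then have "r = 0" using inj_onD[OF separated[of y], of r 0] r N by simp
  then have "int N dvd j" using r(3) by (simp add: dvd_eq_mod_eq_0)
  then obtain m where "j = int N * m" ..
  then show "\<exists>m::int. x = y + 2 * pi * real N * of_int m" using j by (intro exI[of _ m]) simp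
next
  assume "\<exists>m::int. x = y + 2 * pi * real N * of_int m"
  then obtain m :: int where m: "x = y + 2 * pi * real N * of_int m" ..
  then have "cis x = cis y" by (subst cis_eq_iff) (auto intro!: exI[of _ "int N * m"])
  then show "curve x = curve y" by (simp add: curve_def m periodic_int)
qed

text \<open>Separation is assumed at each angle singly. Continuity of \<open>z\<close> extends it to
  nearby angles, and as there are finitely many sheets one radius serves all of them.\<close>

lemma other_sheets_far:
  obtains e where "e > 0"
    "\<And>r x. r \<in> {1..<N} \<Longrightarrow> \<bar>x\<bar> < e \<Longrightarrow> dist (z (\<theta> + 2 * pi * real r + x)) (z \<theta>) \<ge> e"
proof -
  have 1: "\<exists>e>0. \<forall>x. \<bar>x\<bar> < e \<longrightarrow> dist (z (\<theta> + 2 * pi * real r + x)) (z \<theta>) \<ge> e"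
    if "r \<in> {1..<N}" for r
  proof -
    define d where "d = dist (z (\<theta> + 2 * pi * real r)) (z \<theta>)"
    have d: "d > 0" using inj_onD[OF separated[of \<theta>], of r 0] that by (auto simp: d_def)
    have "isCont z (\<theta> + 2 * pi * real r)"
      using Cinf_on_continuous[OF smooth] by (simp add: continuous_on_eq_continuous_at)
    then obtain s where s: "s > 0"
        "\<And>x. dist x (\<theta> + 2 * pi * real r) < s \<Longrightarrow> dist (z x) (z (\<theta> + 2 * pi * real r)) < d / 2"
      using d unfolding continuous_at_eps_delta by (metis half_gt_zero)
    show ?thesis
    proof (intro exI[of _ "min s (d / 2)"] conjI allI impI)
      fix x :: real assume x: "\<bar>x\<bar> < min s (d / 2)"
      then have "dist (z (\<theta> + 2 * pi * real r + x)) (z (\<theta> + 2 * pi * real r)) < d / 2"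
        by (intro s(2)) (simp add: dist_real_def)
      then show "min s (d / 2) \<le> dist (z (\<theta> + 2 * pi * real r + x)) (z \<theta>)"
        using dist_triangle2[of "z (\<theta> + 2 * pi * real r)" "z \<theta>" "z (\<theta> + 2 * pi * real r + x)"]
        by (simp add: d_def dist_commute)
    qed (use s d in auto)
  qed
  have "\<exists>e>0. \<forall>r\<in>A. \<forall>x. \<bar>x\<bar> < e \<longrightarrow> dist (z (\<theta> + 2 * pi * real r + x)) (z \<theta>) \<ge> e"
    if "finite A" "A \<subseteq> {1..<N}" for A
    using that
  proof (induction A rule: finite_induct)
    case (insert a A)
    obtain e1 where "e1 > 0" "\<forall>r\<in>A. \<forall>x. \<bar>x\<bar> < e1 \<longrightarrow> dist (z (\<theta> + 2 * pi * real r + x)) (z \<theta>) \<ge> e1"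
      using insert by auto
    moreover obtain e2 where "e2 > 0" "\<forall>x. \<bar>x\<bar> < e2 \<longrightarrow> dist (z (\<theta> + 2 * pi * real a + x)) (z \<theta>) \<ge> e2"
      using 1[of a] insert by auto
    ultimately show ?case by (intro exI[of _ "min e1 e2"]) fastforce
  qed (auto intro: exI[of _ 1])
  from this[of "{1..<N}"] that show ?thesis by auto
qed

text \<open>Smoothness on the braid is defined by ambient extension, so the local parameter has to
  live on an open subset of the ambient space. The angle of the first coordinate supplies it. The
  bound on the second coordinate cuts away the other sheets, which have the same angles.\<close>

lemma local_inverse:
  assumes "\<eta> > 0"
  obtains U \<tau> where "curve \<theta> \<in> U" "Cinf_on U \<tau>" "\<And>x. x \<in> U \<Longrightarrow> \<bar>\<tau> x - \<theta>\<bar> < \<eta>"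
    "\<And>x. curve x \<in> U \<Longrightarrow> curve (\<tau> (curve x)) = curve x"
proof -
  obtain e where e: "e > 0"
    "\<And>r x. r \<in> {1..<N} \<Longrightarrow> \<bar>x\<bar> < e \<Longrightarrow> dist (z (\<theta> + 2 * pi * real r + x)) (z \<theta>) \<ge> e"
    using other_sheets_far[of \<theta>] by blast
  define V where "V = {x :: complex \<times> complex. Re (fst x * cis (- \<theta>)) > 0}"
  define \<tau> where "\<tau> x = angle_near \<theta> (fst x)" for x :: "complex \<times> complex"
  have oV: "open V" unfolding V_def by (intro open_Collect_less continuous_intros)
  have V: "Cinf_on V \<tau>"
    unfolding \<tau>_def[abs_def]
    by (rule Cinf_on_compose[OF Cinf_on_angle_near[of \<theta>] Cinf_on_fst[OF Cinf_on_ident[OF oV]]])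
      (simp add: V_def)
  define m where "m = min \<eta> e"
  define U where "U = (V \<inter> \<tau> -` ball \<theta> m) \<inter> snd -` ball (z \<theta>) e"
  have "open (V \<inter> \<tau> -` ball \<theta> m)"
    by (rule continuous_open_preimage[OF Cinf_on_continuous[OF V] oV]) simp
  then have oU: "open U" unfolding U_def by (rule open_Int[OF _ open_vimage_snd[OF open_ball]])
  show ?thesis
  proof
    show "curve \<theta> \<in> U"
      using assms e(1) by (auto simp: U_def V_def curve_def \<tau>_def cis_mult angle_near_cis m_def)
    show "Cinf_on U \<tau>" by (rule Cinf_on_subset[OF V _ oU]) (auto simp: U_def)
    show "\<bar>\<tau> x - \<theta>\<bar> < \<eta>" if "x \<in> U" for x
      using that by (auto simp: U_def m_def dist_real_def)
  next
    fix x assume x: "curve x \<in> U"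
    define t where "t = \<tau> (curve x)"
    have "cis t = cis x" by (simp add: t_def \<tau>_def curve_def cis_angle_near)
    then obtain j :: int where j: "x = t + 2 * pi * of_int j" by (metis cis_eq_iff)
    have t: "\<bar>t - \<theta>\<bar> < e" using x by (auto simp: U_def t_def m_def dist_real_def)
    obtain r where r: "r < N" "z (\<theta> + 2 * pi * of_int j + (t - \<theta>)) = z (\<theta> + 2 * pi * real r + (t - \<theta>))"
      "int r = j mod int N" by (rule sheet_reduce)
    have "dist (z x) (z \<theta>) < e" using x by (auto simp: U_def curve_def dist_commute)
    moreover have "x = \<theta> + 2 * pi * of_int j + (t - \<theta>)" using j by simp
    ultimately have "dist (z (\<theta> + 2 * pi * real r + (t - \<theta>))) (z \<theta>) < e" using r(2) by simp
    with e(2)[of r "t - \<theta>"] t r(1) have "r = 0" by (cases "r = 0") auto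
    then have "int N dvd j" using r(3) by (simp add: dvd_eq_mod_eq_0)
    then obtain m where "j = int N * m" ..
    then have "curve x = curve t" by (subst curve_eq_iff) (auto simp: j intro!: exI[of _ m])
    then show "curve (\<tau> (curve x)) = curve x" by (simp add: t_def)
  qed
qed

lemma curve_open_map:
  assumes "open I"
  shows "openin (top_of_set (range curve)) (curve ` I)"
proof (subst openin_subopen, intro ballI)
  fix y assume "y \<in> curve ` I"
  then obtain \<theta> where I: "y = curve \<theta>" "\<theta> \<in> I" by auto
  then obtain \<eta> where \<eta>: "\<eta> > 0" "ball \<theta> \<eta> \<subseteq> I"
    using assms open_contains_ball by blast
  obtain U \<tau> where U: "curve \<theta> \<in> U" "Cinf_on U \<tau>" "\<And>x. x \<in> U \<Longrightarrow> \<bar>\<tau> x - \<theta>\<bar> < \<eta>"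
    "\<And>x. curve x \<in> U \<Longrightarrow> curve (\<tau> (curve x)) = curve x"
    using local_inverse[OF \<eta>(1)] by blast
  have "curve x \<in> curve ` I" if "curve x \<in> U" for x
  proof -
    have "\<tau> (curve x) \<in> I" using U(3)[OF that] \<eta>(2) by (auto simp: dist_real_def abs_minus_commute)
    then show ?thesis using U(4)[OF that] by (metis imageI)
  qed
  then show "\<exists>T. openin (top_of_set (range curve)) T \<and> y \<in> T \<and> T \<subseteq> curve ` I"
    using I(1) U(1) Cinf_on_open[OF U(2)]
    by (intro exI[of _ "range curve \<inter> U"]) (auto simp: openin_open_Int)
qed

text \<open>A map out of the braid is smooth if it is smooth in the parameter of the curve. The
  factor \<open>P\<close> carries the time of an isotopy, so that joint smoothness in time and
  position is covered.\<close>

lemma smooth_on_braid: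
  fixes G :: "'p::euclidean_space \<times> real \<Rightarrow> 'b::euclidean_space"
  assumes G: "Cinf_on UNIV G" and g: "\<And>p \<theta>. p \<in> P \<Longrightarrow> g (p, curve \<theta>) = G (p, \<theta>)"
  shows "smooth_on (P \<times> range curve) g"
proof (rule smooth_onI_local)
  fix x assume "x \<in> P \<times> range curve"
  then obtain p \<theta> where x: "x = (p, curve \<theta>)" "p \<in> P" by auto
  obtain U \<tau> where U: "curve \<theta> \<in> U" "Cinf_on U \<tau>"
    "\<And>x. curve x \<in> U \<Longrightarrow> curve (\<tau> (curve x)) = curve x"
    using local_inverse[OF zero_less_one] by metis
  define W where "W = (UNIV :: 'p set) \<times> U"
  have oW: "open W" using Cinf_on_open[OF U(2)] by (simp add: W_def open_Times)
  have "Cinf_on W (\<lambda>y. G (fst y, \<tau> (snd y)))"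
    by (intro Cinf_on_compose[OF G] Cinf_on_Pair Cinf_on_fst Cinf_on_ident oW
        Cinf_on_compose[OF U(2)] Cinf_on_snd) (auto simp: W_def)
  moreover have "\<forall>y\<in>(P \<times> range curve) \<inter> W. G (fst y, \<tau> (snd y)) = g y"
  proof
    fix y assume "y \<in> (P \<times> range curve) \<inter> W"
    then obtain q s where y: "y = (q, curve s)" "q \<in> P" "curve s \<in> U" by (auto simp: W_def)
    have "g y = g (q, curve (\<tau> (curve s)))" by (simp add: y U(3))
    also have "\<dots> = G (q, \<tau> (curve s))" by (rule g[OF y(2)])
    finally show "G (fst y, \<tau> (snd y)) = g y" by (simp add: y)
  qed
  ultimately show "\<exists>U ga. x \<in> U \<and> Cinf_on U ga \<and> (\<forall>y\<in>P \<times> range curve \<inter> U. ga y = g y)"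
    using U(1) x by (intro exI[of _ W] exI[of _ "\<lambda>y. G (fst y, \<tau> (snd y))"]) (auto simp: W_def)
qed

text \<open>An arc reaching less than a quarter turn to either side of \<open>a\<close> projects
  bijectively to the open half circle around \<open>cis a\<close>, where \<open>angle_near a\<close>
  inverts the projection.\<close>

definition sheet :: "real \<Rightarrow> (complex \<times> complex) set" where
  "sheet a = curve ` ball a (pi / 2)"

definition half_circle :: "real \<Rightarrow> complex set" where
  "half_circle a = sphere 0 1 \<inter> {\<zeta>. Re (\<zeta> * cis (- a)) > 0}"

lemma sheet_subset: "sheet a \<subseteq> range curve"
  by (auto simp: sheet_def)

lemma openin_sheet: "openin (top_of_set (range curve)) (sheet a)"
  by (simp add: sheet_def curve_open_map)

lemma curve_in_sheet: "curve a \<in> sheet a"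
  by (auto simp: sheet_def)

lemma openin_half_circle: "openin (top_of_set (sphere 0 1)) (half_circle a)"
  unfolding half_circle_def by (rule openin_open_Int[OF open_half_plane])

lemma smooth_angle_near: "smooth_on (half_circle a) (angle_near a)"
  by (rule smooth_on_if_Cinf[OF Cinf_on_angle_near]) (auto simp: half_circle_def)

lemma fst_in_half_circle: "y \<in> sheet a \<Longrightarrow> fst y \<in> half_circle a"
proof -
  assume "y \<in> sheet a"
  then obtain x where x: "y = curve x" "\<bar>x - a\<bar> < pi / 2"
    by (auto simp: sheet_def dist_real_def abs_minus_commute)
  then have "cos (x - a) > 0" by (intro cos_gt_zero_pi) linarith+
  then have "Re (cis x * cis (- a)) > 0" by (simp add: cis_mult del: times_complex.sel)
  then show ?thesis by (simp add: half_circle_def x(1) fst_curve)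
qed

lemma angle_near_in_ball: "\<zeta> \<in> half_circle a \<Longrightarrow> angle_near a \<zeta> \<in> ball a (pi / 2)"
  using angle_near_bound[of \<zeta> a] by (auto simp: half_circle_def dist_real_def abs_minus_commute)

lemma curve_angle_near_fst: "y \<in> sheet a \<Longrightarrow> curve (angle_near a (fst y)) = y"
  by (auto simp: sheet_def fst_curve angle_near_cis dist_real_def abs_minus_commute)

lemma fst_curve_angle_near: "\<zeta> \<in> half_circle a \<Longrightarrow> fst (curve (angle_near a \<zeta>)) = \<zeta>"
  by (auto simp: half_circle_def fst_curve cis_angle_near)

lemma fst_image_sheet: "fst ` sheet a = half_circle a"
proof
  show "half_circle a \<subseteq> fst ` sheet a"
    using fst_curve_angle_near angle_near_in_ball unfolding sheet_def by (metis imageI subsetI)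
qed (use fst_in_half_circle in auto)

lemma smooth_curve_angle_near: "smooth_on (half_circle a) (\<lambda>\<zeta>. curve (angle_near a \<zeta>))"
  by (rule smooth_on_compose[OF smooth_on_if_Cinf[OF smooth_curve, of UNIV] smooth_angle_near]) simp_all

lemma smooth_on_fst: "smooth_on A (fst :: complex \<times> complex \<Rightarrow> complex)"
  by (rule smooth_on_if_Cinf[OF Cinf_on_linear[OF bounded_linear_fst open_UNIV]]) simp

lemma diffeomorphism_sheet: "diffeomorphism_betw fst (sheet a) (half_circle a)"
  by (rule diffeomorphism_betwI[OF smooth_on_fst smooth_curve_angle_near])
    (use fst_in_half_circle curve_angle_near_fst fst_curve_angle_near angle_near_in_ball in \<open>auto simp: sheet_def\<close>)

lemma homeomorphism_sheet: "homeomorphism (sheet a) (half_circle a) fst (\<lambda>\<zeta>. curve (angle_near a \<zeta>))"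
proof (rule homeomorphismI)
  have "Cinf_on {\<zeta>. Re (\<zeta> * cis (- a)) > 0} (\<lambda>\<zeta>. curve (angle_near a \<zeta>))"
    by (rule Cinf_on_compose[OF smooth_curve Cinf_on_angle_near]) simp
  from Cinf_on_continuous[OF this]
  show "continuous_on (half_circle a) (\<lambda>\<zeta>. curve (angle_near a \<zeta>))"
    by (rule continuous_on_subset) (auto simp: half_circle_def)
qed (use fst_in_half_circle curve_angle_near_fst fst_curve_angle_near angle_near_in_ball
    in \<open>auto simp: sheet_def intro!: continuous_intros\<close>)

lemma diffeomorphism_curve: "diffeomorphism_betw curve (ball a (pi / 2)) (sheet a)"
proof (rule diffeomorphism_betwI)
  show "smooth_on (ball a (pi / 2)) curve" by (rule smooth_on_if_Cinf[OF smooth_curve]) simp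
  show "smooth_on (sheet a) (\<lambda>y. angle_near a (fst y))"
    by (rule smooth_on_compose[OF smooth_angle_near smooth_on_fst fst_in_half_circle])
qed (use curve_angle_near_fst fst_in_half_circle angle_near_in_ball in
    \<open>auto simp: sheet_def fst_curve angle_near_cis dist_real_def abs_minus_commute\<close>)

lemma half_circle_shift: "half_circle (a + 2 * pi * real j) = half_circle a"
proof -
  have "cis (- a - 2 * pi * real j) = cis (- a)"
    by (subst cis_eq_iff) (auto intro!: exI[of _ "- int j"])
  then show ?thesis by (simp add: half_circle_def)
qed

lemma fst_image_curve: "fst ` range curve = sphere 0 1"
proof
  show "sphere 0 1 \<subseteq> fst ` range curve"
  proof
    fix \<zeta> :: complex assume "\<zeta> \<in> sphere 0 1"
    then have "fst (curve (angle_near 0 \<zeta>)) = \<zeta>" by (simp add: fst_curve cis_angle_near)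
    then show "\<zeta> \<in> fst ` range curve" by (metis imageI rangeI)
  qed
qed (auto simp: fst_curve)

lemma covering_space_fst: "covering_space (range curve) fst (sphere 0 1)"
proof
  fix \<zeta> :: complex assume "\<zeta> \<in> sphere 0 1"
  then obtain a where a: "\<zeta> = cis a" using sphere_eq_cis by blast
  define v where "v = (\<lambda>j. sheet (a + 2 * pi * real j)) ` {0..<N}"
  have disj: "disjnt (sheet (a + 2 * pi * real i)) (sheet (a + 2 * pi * real j))"
    if "i < N" "j < N" "i \<noteq> j" for i j
  proof (rule ccontr)
    assume "\<not> ?thesis"
    then obtain p where "p \<in> sheet (a + 2 * pi * real i)" "p \<in> sheet (a + 2 * pi * real j)"
      by (auto simp: disjnt_iff)
    then obtain x y where xy: "x \<in> ball (a + 2 * pi * real i) (pi / 2)"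
      "y \<in> ball (a + 2 * pi * real j) (pi / 2)" "curve x = curve y"
      unfolding sheet_def by (elim imageE) simp
    then obtain m :: int where m: "x = y + 2 * pi * real N * of_int m" using curve_eq_iff by auto
    have "\<bar>x - (a + 2 * pi * real i)\<bar> < pi / 2" "\<bar>y - (a + 2 * pi * real j)\<bar> < pi / 2"
      using xy by (auto simp: dist_real_def abs_minus_commute)
    \<comment> \<open>Each angle is within \<open>pi / 2\<close> of its centre, so the centres
      differ by less than \<open>pi\<close> up to the common period; the number of turns between
      them is an integer below 1 in absolute value.\<close>
    then have "\<bar>2 * pi * (real j + real N * of_int m - real i)\<bar> < pi"
      using m by (simp add: algebra_simps abs_if split: if_splits)
    then have "\<bar>real j + real N * of_int m - real i\<bar> < 1"
      by (simp add: abs_mult)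
    then have "\<bar>real_of_int (int j + int N * m - int i)\<bar> < 1" by simp
    then have e: "int i = int j + int N * m" by linarith
    then have "int i mod int N = int j mod int N" by simp
    then show False using that by simp
  qed
  show "\<exists>T. \<zeta> \<in> T \<and> openin (top_of_set (sphere 0 1)) T \<and>
          (\<exists>v. \<Union> v = range curve \<inter> fst -` T \<and> (\<forall>u\<in>v. openin (top_of_set (range curve)) u) \<and>
              pairwise disjnt v \<and> (\<forall>u\<in>v. \<exists>q. homeomorphism u T fst q))"
  proof (intro exI[of _ "half_circle a"] exI[of _ v] conjI)
    show "\<zeta> \<in> half_circle a" by (simp add: a half_circle_def cis_mult)
    show "\<Union> v = range curve \<inter> fst -` half_circle a"
    proof
      show "\<Union> v \<subseteq> range curve \<inter> fst -` half_circle a"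
        using fst_in_half_circle half_circle_shift sheet_subset by (fastforce simp: v_def)
    next
      show "range curve \<inter> fst -` half_circle a \<subseteq> \<Union> v"
      proof
        fix y assume "y \<in> range curve \<inter> fst -` half_circle a"
        then obtain x where x: "y = curve x" "cis x \<in> half_circle a" by (auto simp: fst_curve)
        define t where "t = angle_near a (cis x)"
        have t: "t \<in> ball a (pi / 2)" "cis x = cis t"
          using x by (auto simp: t_def angle_near_in_ball cis_angle_near simp del: mem_ball)
        then obtain j :: int where j: "x = t + 2 * pi * of_int j" using cis_eq_iff by blast
        obtain r where r: "r < N" "z (t + 2 * pi * of_int j + 0) = z (t + 2 * pi * real r + 0)"
          by (rule sheet_reduce)
        have "cis (t + 2 * pi * real r) = cis x"
          by (subst cis_eq_iff) (auto simp: j algebra_simps intro!: exI[of _ "int r - j"])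
        then have "y = curve (t + 2 * pi * real r)"
          using r(2) by (simp add: x curve_def j)
        moreover have "t + 2 * pi * real r \<in> ball (a + 2 * pi * real r) (pi / 2)"
          using t(1) by (simp add: dist_real_def)
        ultimately have "y \<in> sheet (a + 2 * pi * real r)" by (simp add: sheet_def del: mem_ball)
        then show "y \<in> \<Union> v" using r(1) by (auto simp: v_def)
      qed
    qed
    show "\<forall>u\<in>v. openin (top_of_set (range curve)) u" by (auto simp: v_def openin_sheet)
    show "pairwise disjnt v"
      unfolding v_def pairwise_image by (intro pairwiseI impI) (metis atLeastLessThan_iff disj)
    show "\<forall>u\<in>v. \<exists>q. homeomorphism u (half_circle a) fst q"
    proof
      fix u assume "u \<in> v"
      then obtain j where "u = sheet (a + 2 * pi * real j)" by (auto simp: v_def)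
      then show "\<exists>q. homeomorphism u (half_circle a) fst q"
        using homeomorphism_sheet[of "a + 2 * pi * real j"] by (auto simp: half_circle_shift)
    qed
    show "openin (top_of_set (sphere 0 1)) (half_circle a)" by (rule openin_half_circle)
  qed
qed (auto intro!: continuous_intros simp: fst_image_curve)

lemma card_fibre:
  assumes "\<zeta> \<in> sphere 0 1"
  shows "finite {x \<in> range curve. fst x = \<zeta>}" "card {x \<in> range curve. fst x = \<zeta>} = N"
proof -
  obtain a where a: "\<zeta> = cis a" using assms sphere_eq_cis by blast
  have "{x \<in> range curve. fst x = \<zeta>} = (\<lambda>k. curve (a + 2 * pi * real k)) ` {0..<N}" (is "?L = ?R")
  proof
    show "?L \<subseteq> ?R"
    proof
      fix y assume "y \<in> ?L"
      then obtain x where x: "y = curve x" "cis x = cis a" by (auto simp: fst_curve a)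
      then obtain j :: int where j: "x = a + 2 * pi * of_int j" using cis_eq_iff by blast
      obtain r where r: "r < N" "z (a + 2 * pi * of_int j + 0) = z (a + 2 * pi * real r + 0)"
        by (rule sheet_reduce)
      have "cis (a + 2 * pi * real r) = cis x"
        by (subst cis_eq_iff) (auto simp: j algebra_simps intro!: exI[of _ "int r - j"])
      then show "y \<in> ?R" using r by (intro image_eqI[of _ _ r]) (simp_all add: x curve_def j)
    qed
    have "cis (a + 2 * pi * real k) = cis a" for k
      by (subst cis_eq_iff) (auto intro!: exI[of _ "int k"])
    then show "?R \<subseteq> ?L" by (auto simp: fst_curve a)
  qed
  moreover have "inj_on (\<lambda>k. curve (a + 2 * pi * real k)) {0..<N}"
    using separated[of a] by (auto simp: inj_on_def curve_def)
  ultimately show "finite {x \<in> range curve. fst x = \<zeta>}" "card {x \<in> range curve. fst x = \<zeta>} = N"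
    by (simp_all add: card_image)
qed

lemma compact_braid: "compact (range curve)"
proof -
  have "curve (x + 2 * pi * real N) = curve x" for x
    by (subst curve_eq_iff) (auto intro!: exI[of _ 1])
  then have "curve x \<in> curve ` {0..2 * pi * real N}" for x
    by (rule periodic_range) (use N in simp)
  then have "range curve = curve ` {0..2 * pi * real N}" by auto
  moreover have "compact (curve ` {0..2 * pi * real N})"
    by (intro compact_continuous_image continuous_on_subset[OF Cinf_on_continuous[OF smooth_curve]]) auto
  ultimately show ?thesis by simp
qed

lemma is_braid: "is_braid N (braid_of z)"
  unfolding is_braid_def braid_of_eq embedded_1_submanifold_def smooth_covering_def
proof (intro conjI ballI)
  show "range curve \<subseteq> sphere 0 1 \<times> UNIV" by (auto simp: curve_def)
  show "compact (range curve)" by (rule compact_braid)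
  show "covering_space (range curve) fst (sphere 0 1)" by (rule covering_space_fst)
next
  fix x assume "x \<in> range curve"
  then obtain a where a: "x = curve a" by auto
  show "\<exists>U I c. openin (top_of_set (range curve)) U \<and> x \<in> U \<and> open (I::real set) \<and> diffeomorphism_betw c I U"
    using openin_sheet curve_in_sheet diffeomorphism_curve a by (metis open_ball)
  show "\<exists>U. openin (top_of_set (range curve)) U \<and> x \<in> U \<and>
      openin (top_of_set (sphere 0 1)) (fst ` U) \<and> diffeomorphism_betw fst U (fst ` U)"
    using openin_sheet curve_in_sheet diffeomorphism_sheet openin_half_circle a fst_image_sheet by metis
next
  fix y :: complex assume "y \<in> sphere 0 1"
  then show "finite {x \<in> range curve. fst x = y}" "card {x \<in> range curve. fst x = y} = N"
    by (rule card_fibre)+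
qed

end

section \<open>Isotopies of braids in the 3-sphere\<close>

definition from_S3 :: "complex \<times> complex \<Rightarrow> complex \<times> complex" where
  "from_S3 x = (1 / cmod (fst x)) *\<^sub>R x"

lemma from_S3_to_S3: "cmod (fst x) = 1 \<Longrightarrow> from_S3 (to_S3 x) = x"
proof (cases x)
  case (Pair \<zeta> z)
  assume 1: "cmod (fst x) = 1"
  have "1 + (cmod z)\<^sup>2 > 0" by (simp add: add_pos_nonneg)
  then have "sqrt (1 + (cmod z)\<^sup>2) > 0" by simp
  then show ?thesis using 1 by (simp add: Pair from_S3_def to_S3_def)
qed

lemma fst_to_S3_nonzero: "cmod (fst x) = 1 \<Longrightarrow> fst (to_S3 x) \<noteq> 0"
proof (cases x)
  case (Pair \<zeta> z)
  assume 1: "cmod (fst x) = 1"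
  have "1 + (cmod z)\<^sup>2 > 0" by (simp add: add_pos_nonneg)
  then show ?thesis using 1 by (auto simp: Pair to_S3_def)
qed

lemma Cinf_on_to_S3: "Cinf_on UNIV to_S3"
proof -
  have p: "1 + snd x \<bullet> snd x > 0" for x :: "complex \<times> complex" by (simp add: add_pos_nonneg)
  \<comment> \<open>The inner product replaces the squared norm because the norm itself is not
    smooth at 0.\<close>
  have "Cinf_on UNIV (\<lambda>x::complex\<times>complex. (1 / sqrt (1 + snd x \<bullet> snd x)) *\<^sub>R x)"
    by (intro Cinf_on_intros Cinf_on_divide Cinf_on_compose[OF Cinf_on_sqrt])
      (use p in \<open>auto simp: less_imp_neq[symmetric]\<close>)
  then show ?thesis
    by (rule Cinf_on_cong) (auto simp: to_S3_def dot_square_norm)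
qed

lemma Cinf_on_from_S3: "Cinf_on {x. fst x \<noteq> 0} from_S3"
proof -
  have o: "open {x :: complex \<times> complex. fst x \<noteq> 0}"
    by (intro open_Collect_neq continuous_intros)
  have "Cinf_on {x. fst x \<noteq> 0} (\<lambda>x::complex\<times>complex. (1 / sqrt (fst x \<bullet> fst x)) *\<^sub>R x)"
    by (intro Cinf_on_intros Cinf_on_divide Cinf_on_compose[OF Cinf_on_sqrt] o) auto
  then show ?thesis
    by (rule Cinf_on_cong) (auto simp: from_S3_def norm_eq_sqrt_inner)
qed

text \<open>By \<open>curve_eq_iff\<close> all curves of the family identify the same parameters.
  Hence sending the point with parameter \<open>\<theta>\<close> at one time to the point with
  parameter \<open>\<theta>\<close> at another is well defined and bijective, and smoothness can be
  checked in the parameter.\<close>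

lemma S3_braid_isotopicI:
  fixes G :: "real \<times> real \<Rightarrow> complex"
  assumes G: "Cinf_on UNIV G"
    and b: "\<And>t. t \<in> {0..1} \<Longrightarrow> braid_curve N (\<lambda>\<theta>. G (t, \<theta>))"
  shows "S3_braid_isotopic N (to_S3 ` braid_of (\<lambda>\<theta>. G (0, \<theta>))) (to_S3 ` braid_of (\<lambda>\<theta>. G (1, \<theta>)))"
proof -
  define c where "c t \<theta> = (cis \<theta>, G (t, \<theta>))" for t \<theta>
  have curve: "braid_curve.curve (\<lambda>\<theta>. G (t, \<theta>)) = c t" if "t \<in> {0..1}" for t
    using braid_curve.curve_def[OF b[OF that]] by (auto simp: c_def)
  have Bo: "braid_of (\<lambda>\<theta>. G (t, \<theta>)) = range (c t)" for t
    by (simp add: braid_of_def c_def[abs_def])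
  have c_eq_iff: "c t x = c t y \<longleftrightarrow> (\<exists>m::int. x = y + 2 * pi * real N * of_int m)" if "t \<in> {0..1}" for t x y
    using braid_curve.curve_eq_iff[OF b[OF that]] curve[OF that] by simp
  have c_transfer: "c s x = c s y" if "c t x = c t y" "s \<in> {0..1}" "t \<in> {0..1}" for s t x y
    using that c_eq_iff by simp
  \<comment> \<open>The chosen parameter is determined only up to the period, which
    \<open>c_transfer\<close> shows to be immaterial.\<close>
  define W where "W t s x = c s (SOME \<theta>. c t \<theta> = x)" for t s x
  have W: "W t s (c t \<theta>) = c s \<theta>" if "s \<in> {0..1}" "t \<in> {0..1}" for s t \<theta>
    unfolding W_def by (rule c_transfer[OF someI[of "\<lambda>x. c t x = c t \<theta>"]]) (use that in auto)
  have fst_c: "cmod (fst (c t \<theta>)) = 1" for t \<theta> by (simp add: c_def)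
  define \<Phi> where "\<Phi> t x = to_S3 (W 0 t (from_S3 x))" for t x
  have \<Phi>: "\<Phi> t (to_S3 (c 0 \<theta>)) = to_S3 (c t \<theta>)" if "t \<in> {0..1}" for t \<theta>
    using that by (simp add: \<Phi>_def from_S3_to_S3 fst_c W)
  have smooth_from: "smooth_on (to_S3 ` range (c t)) from_S3" for t
    by (rule smooth_on_if_Cinf[OF Cinf_on_from_S3]) (auto simp: fst_to_S3_nonzero fst_c)
  have smooth_to: "smooth_on A to_S3" for A by (rule smooth_on_if_Cinf[OF Cinf_on_to_S3]) simp
  have cG: "Cinf_on UNIV (\<lambda>x. c (fst x) (snd x))"
    unfolding c_def by (intro Cinf_on_Pair Cinf_on_cis Cinf_on_intros Cinf_on_compose[OF G]) auto
  define K where "K = to_S3 ` range (c 0)"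
  have "smooth_on ({0..1} \<times> range (c 0)) (\<lambda>x. W 0 (fst x) (snd x))"
    using braid_curve.smooth_on_braid[OF b[of 0] cG, of "{0..1}" "\<lambda>x. W 0 (fst x) (snd x)"] curve[of 0] W
    by simp
  moreover have "smooth_on ({0..1::real} \<times> K) (\<lambda>x. (fst x, from_S3 (snd x)))"
  proof (rule smooth_on_Pair)
    show "smooth_on ({0..1} \<times> K) (fst :: real \<times> _ \<Rightarrow> real)"
      by (rule smooth_on_if_Cinf[OF Cinf_on_linear[OF bounded_linear_fst open_UNIV]]) simp
    show "smooth_on ({0..1::real} \<times> K) (\<lambda>x. from_S3 (snd x))"
      by (rule smooth_on_compose[OF smooth_from[of 0]
            smooth_on_if_Cinf[OF Cinf_on_linear[OF bounded_linear_snd open_UNIV]]])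
        (auto simp: K_def)
  qed
  ultimately have "smooth_on ({0..1} \<times> K) (\<lambda>x. W 0 (fst (fst x, from_S3 (snd x))) (snd (fst x, from_S3 (snd x))))"
    by (rule smooth_on_compose) (auto simp: K_def from_S3_to_S3 fst_c)
  then have 1: "smooth_on ({0..1} \<times> K) (\<lambda>(t, x). \<Phi> t x)"
    unfolding \<Phi>_def case_prod_beta using smooth_on_compose[OF smooth_to[of UNIV]] by simp
  have img: "\<Phi> t ` K = to_S3 ` range (c t)" if "t \<in> {0..1}" for t
    using \<Phi>[OF that] by (force simp: K_def image_iff)
  have smooth_W: "smooth_on (range (c t)) (\<lambda>x. W t s x)" if st: "t \<in> {0..1}" "s \<in> {0..1}" for s t
  proof -
    have "Cinf_on UNIV (\<lambda>x::real \<times> real. c s (snd x))"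
      unfolding c_def by (intro Cinf_on_Pair Cinf_on_cis Cinf_on_intros Cinf_on_compose[OF G]) auto
    then have "smooth_on ({0::real} \<times> range (c t)) (\<lambda>x. W t s (snd x))"
      using braid_curve.smooth_on_braid[OF b[OF st(1)], of "\<lambda>x::real\<times>real. c s (snd x)" "{0}" "\<lambda>x. W t s (snd x)"]
        curve[OF st(1)] W[OF st(2) st(1)] by simp
    moreover have "smooth_on (range (c t)) (\<lambda>x. (0::real, x))"
      by (rule smooth_on_if_Cinf[of UNIV]) (auto intro!: Cinf_on_intros)
    ultimately have "smooth_on (range (c t)) (\<lambda>x. W t s (snd (0::real, x)))"
      by (rule smooth_on_compose) auto
    then show ?thesis by simp
  qed
  have 2: "diffeomorphism_betw (\<Phi> t) K (\<Phi> t ` K)" if t: "t \<in> {0..1}" for t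
  proof (rule diffeomorphism_betwI[where g = "\<lambda>x. to_S3 (W t 0 (from_S3 x))"])
    show "smooth_on K (\<Phi> t)" unfolding \<Phi>_def K_def
      by (rule smooth_on_compose[OF smooth_to[of UNIV] smooth_on_compose[OF smooth_W[of 0 t] smooth_from[of 0]]])
        (use t in \<open>auto simp: from_S3_to_S3 fst_c\<close>)
    show "smooth_on (\<Phi> t ` K) (\<lambda>x. to_S3 (W t 0 (from_S3 x)))" unfolding img[OF t]
      by (rule smooth_on_compose[OF smooth_to[of UNIV] smooth_on_compose[OF smooth_W[of t 0] smooth_from[of t]]])
        (use t in \<open>auto simp: from_S3_to_S3 fst_c\<close>)
  qed (use t in \<open>auto simp: K_def \<Phi> from_S3_to_S3 fst_c W\<close>)
  have 3: "is_S3_braid N (\<Phi> t ` K)" if "t \<in> {0..1}" for t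
    unfolding is_S3_braid_def img[OF that]
    using braid_curve.is_braid[OF b[OF that]] Bo by auto
  have "\<forall>x\<in>K. \<Phi> 0 x = x" by (auto simp: K_def \<Phi>)
  then show ?thesis
    unfolding S3_braid_isotopic_def isotopic_through_def Bo
    using 1 2 3 img[of 1] by (intro exI[of _ \<Phi>]) (auto simp: K_def)
qed

section \<open>Lagrangian planes from closed forms\<close>

text \<open>The surface is built in the coordinates \<open>(a\<^sub>1, a\<^sub>2)\<close> and
  carried back by this inverse of \<open>rotated_coords\<close>, since the notions of the theorem
  are stated in \<open>(z\<^sub>1, z\<^sub>2)\<close>.\<close>

definition from_rotated :: "complex \<times> complex \<Rightarrow> complex \<times> complex" where
  "from_rotated = (\<lambda>(a1, a2). ((a1 + cnj a2) / sqrt 2, (a2 - cnj a1) / sqrt 2))"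

lemma sqrt2_sq: "complex_of_real (sqrt 2) * complex_of_real (sqrt 2) = 2"
  by (metis abs_numeral of_real_mult of_real_numeral real_sqrt_mult_self)

lemma rotated_from_rotated: "rotated_coords (from_rotated x) = x"
  using sqrt2_sq by (cases x) (simp add: rotated_coords_def from_rotated_def divide_simps)

lemma from_rotated_minus: "from_rotated (- x) = - from_rotated x"
  by (cases x) (simp add: from_rotated_def divide_simps)

lemma bounded_linear_from_rotated: "bounded_linear from_rotated"
proof -
  have "bounded_linear (\<lambda>x::complex\<times>complex. ((fst x + cnj (snd x)) / sqrt 2, (snd x - cnj (fst x)) / sqrt 2))"
    by (intro bounded_linear_Pair bounded_linear_divide[THEN bounded_linear_compose]
        bounded_linear_add bounded_linear_sub bounded_linear_fst bounded_linear_snd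
        bounded_linear_cnj[THEN bounded_linear_compose])
  then show ?thesis by (simp add: from_rotated_def split_beta')
qed

lemma norm_from_rotated: "norm (from_rotated x) = norm x"
proof -
  have "(norm (from_rotated x))\<^sup>2 = (norm x)\<^sup>2"
    by (cases x)
      (simp add: from_rotated_def norm_Pair norm_divide power_divide cmod_power2,
        simp add: power2_eq_square field_simps)
  then show ?thesis by (simp add: power2_eq_iff_nonneg)
qed

lemma symplectic_form_from_rotated:
  "symplectic_form (from_rotated u) (from_rotated v)
    = complex_of_real (- Im (fst u * snd v - fst v * snd u))"
proof -
  obtain a b c d where uv: "u = (a, b)" "v = (c, d)" by (metis prod.exhaust)
  define s where "s = complex_of_real (sqrt 2)"
  have s: "s * s = 2" "cnj s = s" "s \<noteq> 0" using sqrt2_sq by (auto simp: s_def)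
  have "symplectic_form (from_rotated u) (from_rotated v) =
      \<i> / 2 * ((((a + cnj b) * (cnj c + d) - (c + cnj d) * (cnj a + b))
       + ((b - cnj a) * (cnj d - c) - (d - cnj c) * (cnj b - a))) / (s * s))"
    using s(3) by (simp add: symplectic_form_def from_rotated_def uv s(2) flip: s_def) (simp add: divide_simps)
  also have "\<dots> = complex_of_real (- Im (a * d - c * b))"
    unfolding s(1) by (simp add: complex_eq_iff field_simps)
  finally show ?thesis by (simp add: uv)
qed

text \<open>\<open>K\<close> stands for \<open>S\<^sub>\<theta> + \<i> S\<^sub>t\<close>. Then
  \<open>K_closed\<close> is the equality of the mixed partials of \<open>S\<close>, and
  \<open>K_inner\<close> says that \<open>exp (- \<zeta>) * K \<zeta>\<close> is
  \<open>exp (\<zeta> / N)\<close>, the coordinate \<open>w\<close> on the \<open>N\<close>-fold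
  cover. The period \<open>pi * N\<close> both makes the surface well defined in \<open>w\<close>
  and yields the symmetry under -1.\<close>

locale closed_end =
  fixes N :: nat and K :: "complex \<Rightarrow> complex"
  assumes N: "N \<ge> 1" "odd N"
    and K_smooth: "Cinf_on UNIV K"
    and K_periodic: "K (\<zeta> + of_real (pi * real N) * \<i>) = K \<zeta>"
    and K_closed: "(K has_derivative D) (at \<zeta>) \<Longrightarrow> Im (D \<i>) = Re (D 1)"
    and K_inner: "Re \<zeta> < 0 \<Longrightarrow> K \<zeta> = exp (\<zeta> + \<zeta> / of_nat N)"
begin

definition log_surface :: "complex \<Rightarrow> complex \<times> complex" where
  "log_surface \<zeta> = from_rotated (exp \<zeta>, exp (- \<zeta>) * K \<zeta>)"

definition surface :: "complex \<Rightarrow> complex \<times> complex" where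
  "surface w = (if w = 0 then 0 else log_surface (of_nat N * Ln w))"

lemma K_periodic_int: "K (\<zeta> + of_int m * (of_real (pi * real N) * \<i>)) = K \<zeta>"
  by (rule periodic_of_int) (rule K_periodic)

text \<open>The branch of \<open>Ln\<close> does not matter: changing it by \<open>n\<close> turns
  shifts the argument of \<open>K\<close> by \<open>2 * n\<close> of its periods.\<close>

lemma surface_exp: "surface (exp u) = log_surface (of_nat N * u)"
proof -
  obtain n :: int where n: "Ln (exp u) = u + (of_int (2 * n) * pi) * \<i>"
    using exp_eq[of "Ln (exp u)" u] by auto
  have "of_nat N * Ln (exp u) = of_nat N * u + of_int (2 * n) * (of_real (pi * real N) * \<i>)"
    by (simp add: n algebra_simps)
  then have "K (of_nat N * Ln (exp u)) = K (of_nat N * u)" by (simp only: K_periodic_int)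
  moreover have "exp (of_nat N * Ln (exp u)) = exp (of_nat N * u)"
    by (simp add: exp_of_nat_mult)
  ultimately show ?thesis by (simp add: surface_def log_surface_def exp_minus)
qed

lemma surface_inner: "cmod w < 1 \<Longrightarrow> surface w = from_rotated (w ^ N, w)"
proof (cases "w = 0")
  case False
  assume w: "cmod w < 1"
  define \<zeta> where "\<zeta> = of_nat N * Ln w"
  have "ln (cmod w) < 0" using w False by simp
  then have "Re \<zeta> < 0" using N(1) False by (simp add: \<zeta>_def mult_pos_neg)
  then have "exp (- \<zeta>) * K \<zeta> = exp (\<zeta> / of_nat N)"
    by (simp add: K_inner exp_add exp_minus)
  also have "\<zeta> / of_nat N = Ln w" using N(1) by (simp add: \<zeta>_def)
  finally have "exp (- \<zeta>) * K \<zeta> = w" using False by simp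
  moreover have "exp \<zeta> = w ^ N" using False by (simp add: \<zeta>_def exp_of_nat_mult)
  ultimately show ?thesis using False by (simp add: surface_def log_surface_def \<zeta>_def)
qed (use N in \<open>simp add: surface_def from_rotated_def zero_prod_def\<close>)

lemma log_surface_smooth: "Cinf_on UNIV log_surface"
  unfolding log_surface_def[abs_def]
  by (intro Cinf_on_linear_compose[OF bounded_linear_from_rotated] Cinf_on_intros
      Cinf_on_exp_compose K_smooth) auto

text \<open>\<open>Ln\<close> jumps across the negative axis. Rebasing it at \<open>w0\<close> gives
  a holomorphic logarithm on the half plane around \<open>w0\<close>, which represents the surface
  there by \<open>surface_exp\<close>.\<close>

lemma local_log:
  assumes "w0 \<noteq> 0"
  obtains V l where "w0 \<in> V" "open V" "Cinf_on V l" "\<And>w. w \<in> V \<Longrightarrow> surface w = log_surface (l w)"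
    "\<And>w. w \<in> V \<Longrightarrow> (l has_field_derivative of_nat N / w) (at w)" "0 \<notin> V"
proof
  define V where "V = {w. Re (w * inverse w0) > 0}"
  define l where "l w = of_nat N * (Ln w0 + Ln (w * inverse w0))" for w
  show o: "open V" unfolding V_def by (intro open_Collect_less continuous_intros)
  show "w0 \<in> V" "0 \<notin> V" using assms by (auto simp: V_def simp del: times_complex.sel)
  have np: "w * inverse w0 \<in> - \<real>\<^sub>\<le>\<^sub>0" if "w \<in> V" for w
    using that by (auto simp: V_def complex_nonpos_Reals_iff simp del: times_complex.sel)
  show "Cinf_on V l" unfolding l_def[abs_def]
    by (intro Cinf_on_intros Cinf_on_compose[OF Cinf_on_Ln] o np)
  show "surface w = log_surface (l w)" if "w \<in> V" for w
  proof -
    have "w \<noteq> 0" using that by (auto simp: V_def)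
    then have "w = exp (Ln w0 + Ln (w * inverse w0))" using assms by (simp add: exp_add)
    then show ?thesis using surface_exp l_def by metis
  qed
  show "(l has_field_derivative of_nat N / w) (at w)" if "w \<in> V" for w
  proof -
    have "w \<noteq> 0" using that by (auto simp: V_def)
    then show ?thesis using np[OF that] assms unfolding l_def
      by (auto intro!: derivative_eq_intros simp: field_simps)
  qed
qed

lemma surface_smooth: "Cinf_on UNIV surface"
proof (rule Cinf_on_local)
  fix w0 :: complex
  show "\<exists>U. w0 \<in> U \<and> U \<subseteq> UNIV \<and> Cinf_on U surface"
  proof (cases "cmod w0 < 1")
    case True
    have "Cinf_on (ball 0 1) (\<lambda>w. from_rotated (w ^ N, w))"
      by (intro Cinf_on_linear_compose[OF bounded_linear_from_rotated] Cinf_on_intros) auto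
    then have "Cinf_on (ball 0 1) surface" by (rule Cinf_on_cong) (simp add: surface_inner)
    then show ?thesis using True by (intro exI[of _ "ball 0 1"]) simp
  next
    case False
    then have "w0 \<noteq> 0" by auto
    then obtain V l where V: "w0 \<in> V" "open V" "Cinf_on V l" "\<And>w. w \<in> V \<Longrightarrow> surface w = log_surface (l w)"
      using local_log by metis
    have "Cinf_on V (\<lambda>w. log_surface (l w))" by (rule Cinf_on_compose[OF log_surface_smooth V(3)]) simp
    then have "Cinf_on V surface" by (rule Cinf_on_cong) (simp add: V(4))
    then show ?thesis using V(1) by (intro exI[of _ V]) simp
  qed
qed

lemma from_rotated_has_derivative:
  "(f has_derivative f') F \<Longrightarrow> ((\<lambda>x. from_rotated (f x)) has_derivative (\<lambda>h. from_rotated (f' h))) F"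
  by (rule bounded_linear.has_derivative[OF bounded_linear_from_rotated])

lemma inj_from_rotated: "inj (\<lambda>h. from_rotated (g h)) \<longleftrightarrow> inj g"
  unfolding inj_def by (metis rotated_from_rotated)

text \<open>The first component \<open>exp \<zeta> * h\<close> is already injective in
  \<open>h\<close>. In the bracket of two tangent vectors the terms with \<open>K \<zeta>\<close>
  cancel, leaving a real determinant times \<open>D \<i> - \<i> * D 1\<close>. The imaginary part of
  this factor is \<open>Im (D \<i>) - Re (D 1)\<close>, which is zero by closedness.
  \<open>D\<close> is only real linear, hence the expansion \<open>D_eq\<close>.\<close>

lemma log_surface_derivative:
  obtains D where "(log_surface has_derivative D) (at \<zeta>)" "inj D"
    "\<And>u v. symplectic_form (D u) (D v) = 0"
proof -
  define D where "D = frechet_derivative K (at \<zeta>)"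
  have D: "(K has_derivative D) (at \<zeta>)"
    using Cinf_on_has_derivative[OF K_smooth] by (simp add: D_def)
  have lin: "linear D" using D has_derivative_linear by blast
  have D_eq: "D h = of_real (Re h) * D 1 + of_real (Im h) * D \<i>" for h
  proof -
    have "h = Re h *\<^sub>R 1 + Im h *\<^sub>R \<i>" by (simp add: complex_eq_iff)
    then have "D h = D (Re h *\<^sub>R 1 + Im h *\<^sub>R \<i>)" by metis
    also have "\<dots> = Re h *\<^sub>R D 1 + Im h *\<^sub>R D \<i>"
      by (simp only: linear_add[OF lin] linear_scale[OF lin])
    finally show ?thesis by (simp add: scaleR_conv_of_real)
  qed
  define E where "E h = (exp \<zeta> * h, exp (- \<zeta>) * (D h - h * K \<zeta>))" for h
  have "((\<lambda>\<zeta>. (exp \<zeta>, exp (- \<zeta>) * K \<zeta>)) has_derivative E) (at \<zeta>)"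
  proof -
    have e1: "(exp has_derivative (\<lambda>h. exp \<zeta> * h)) (at \<zeta>)"
      using DERIV_exp[of \<zeta>] by (simp add: has_field_derivative_def)
    have "((\<lambda>\<zeta>. exp (- \<zeta>)) has_field_derivative - exp (- \<zeta>)) (at \<zeta>)"
      by (auto intro!: derivative_eq_intros)
    then have e2: "((\<lambda>\<zeta>. exp (- \<zeta>)) has_derivative (*) (- exp (- \<zeta>))) (at \<zeta>)"
      by (simp only: has_field_derivative_def)
    show ?thesis
      by (rule has_derivative_eq_rhs[OF has_derivative_Pair[OF e1 has_derivative_mult[OF e2 D]]])
        (auto simp: E_def algebra_simps)
  qed
  then have 1: "(log_surface has_derivative (\<lambda>h. from_rotated (E h))) (at \<zeta>)"
    unfolding log_surface_def[abs_def] by (rule from_rotated_has_derivative)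
  have 2: "inj (\<lambda>h. from_rotated (E h))"
    unfolding inj_from_rotated by (auto simp: inj_def E_def)
  have 3: "symplectic_form (from_rotated (E u)) (from_rotated (E v)) = 0" for u v
  proof -
    have e: "exp \<zeta> * exp (- \<zeta>) = 1" by (simp add: exp_minus)
    have "fst (E u) * snd (E v) - fst (E v) * snd (E u)
        = (exp \<zeta> * exp (- \<zeta>)) * (u * D v - v * D u)"
      by (simp add: E_def algebra_simps)
    also have "\<dots> = of_real (Re u * Im v - Im u * Re v) * (D \<i> - \<i> * D 1)"
      unfolding e D_eq[of u] D_eq[of v] by (simp add: complex_eq_iff algebra_simps)
    finally show ?thesis using K_closed[OF D] by (simp add: symplectic_form_from_rotated)
  qed
  show ?thesis using that[OF 1 2 3] .
qed

lemma surface_derivative: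
  obtains D where "(surface has_derivative D) (at w)" "inj D"
    "\<And>u v. symplectic_form (D u) (D v) = 0"
proof (cases "cmod w < 1")
  case True
  \<comment> \<open>Here the tangent map is complex linear, so the complex bracket vanishes
    altogether; the second component keeps it injective even at 0, where the derivative of
    \<open>w ^ N\<close> may vanish.\<close>
  define E where "E h = (of_nat N * h * w ^ (N - 1), h)" for h
  have "((\<lambda>w. (w ^ N, w)) has_derivative E) (at w)"
    unfolding E_def by (auto intro!: derivative_eq_intros)
  then have "((\<lambda>w. from_rotated (w ^ N, w)) has_derivative (\<lambda>h. from_rotated (E h))) (at w)"
    by (rule from_rotated_has_derivative)
  then have 1: "(surface has_derivative (\<lambda>h. from_rotated (E h))) (at w)"
    by (rule has_derivative_transform_within_open[where s = "ball 0 1"])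
      (use True in \<open>auto simp: surface_inner\<close>)
  have 2: "inj (\<lambda>h. from_rotated (E h))"
    unfolding inj_from_rotated by (auto simp: inj_def E_def)
  have 3: "symplectic_form (from_rotated (E u)) (from_rotated (E v)) = 0" for u v
    by (simp add: symplectic_form_from_rotated E_def algebra_simps)
  show ?thesis using that[OF 1 2 3] .
next
  case False
  then have "w \<noteq> 0" by auto
  then obtain V l where V: "w \<in> V" "open V" "Cinf_on V l" "\<And>w. w \<in> V \<Longrightarrow> surface w = log_surface (l w)"
      "(l has_field_derivative of_nat N / w) (at w)"
    using local_log by metis
  obtain D where D: "(log_surface has_derivative D) (at (l w))" "inj D"
    "\<And>u v. symplectic_form (D u) (D v) = 0" using log_surface_derivative by blast
  have "((\<lambda>w. log_surface (l w)) has_derivative (\<lambda>h. D (of_nat N / w * h))) (at w)"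
    using has_derivative_compose[OF V(5)[unfolded has_field_derivative_def] D(1)] by simp
  then have 1: "(surface has_derivative (\<lambda>h. D (of_nat N / w * h))) (at w)"
    by (rule has_derivative_transform_within_open[OF _ V(2) V(1)]) (simp add: V(4))
  have "of_nat N / w \<noteq> 0" using \<open>w \<noteq> 0\<close> N(1) by simp
  then have 2: "inj (\<lambda>h. D (of_nat N / w * h))"
    using injD[OF D(2)] by (intro injI) (metis mult_cancel_left)
  show ?thesis using that[OF 1 2 D(3)] .
qed

text \<open>For odd \<open>N\<close> the shift negates \<open>exp \<zeta>\<close> and its reciprocal
  and leaves \<open>K\<close> alone, so both components change sign.\<close>

lemma log_surface_shift: "log_surface (\<zeta> + of_real (pi * real N) * \<i>) = - log_surface \<zeta>"
proof -
  have "exp (of_real (pi * real N) * \<i>) = (exp (of_real pi * \<i>)) ^ N"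
    by (subst exp_of_nat_mult[symmetric]) (simp add: mult_ac)
  also have "\<dots> = -1" using N(2) by simp
  finally have e: "exp (of_real (pi * real N) * \<i>) = -1" .
  define p where "p = of_real (pi * real N) * \<i>"
  have p: "exp p = -1" "K (\<zeta> + p) = K \<zeta>" using e K_periodic by (simp_all only: p_def)
  have "(exp (\<zeta> + p), exp (- (\<zeta> + p)) * K (\<zeta> + p)) = - (exp \<zeta>, exp (- \<zeta>) * K \<zeta>)"
    unfolding exp_minus[of "\<zeta> + p"] exp_minus[of \<zeta>] exp_add p by simp
  then show ?thesis
    unfolding log_surface_def from_rotated_minus[symmetric] p_def[symmetric] by simp
qed

lemma surface_odd: "surface (- w) = - surface w"
proof (cases "w = 0")
  case False
  have "- w = exp (Ln w + of_real pi * \<i>)" using False by (simp add: exp_add)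
  then have "surface (- w) = log_surface (of_nat N * (Ln w + of_real pi * \<i>))"
    using surface_exp by metis
  also have "of_nat N * (Ln w + of_real pi * \<i>) = of_nat N * Ln w + of_real (pi * real N) * \<i>"
    by (simp add: algebra_simps)
  also have "log_surface \<dots> = - surface w" using False log_surface_shift by (simp add: surface_def)
  finally show ?thesis .
qed (simp add: surface_def)

lemma norm_log_surface: "(norm (log_surface \<zeta>))\<^sup>2 = (exp (Re \<zeta>))\<^sup>2 + (exp (- Re \<zeta>) * cmod (K \<zeta>))\<^sup>2"
  by (simp add: log_surface_def norm_from_rotated norm_Pair norm_mult)

text \<open>The first coordinate alone has modulus \<open>cmod w ^ N\<close>; this growth is what
  makes the surface proper.\<close>

lemma norm_surface_ge: "cmod w ^ N \<le> norm (surface w)"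
proof (cases "w = 0")
  case False
  define \<zeta> where "\<zeta> = of_nat N * Ln w"
  have "norm (exp \<zeta>) \<le> norm (exp \<zeta>, exp (- \<zeta>) * K \<zeta>)" by (metis norm_fst_le fst_conv)
  also have "\<dots> = norm (surface w)"
    using False by (simp add: surface_def log_surface_def norm_from_rotated \<zeta>_def)
  finally show ?thesis using False by (simp add: \<zeta>_def exp_of_nat_mult norm_power)
qed (use N in \<open>simp add: surface_def power_0_left\<close>)

end

section \<open>The disk and the plane\<close>

text \<open>The surface is parametrised by the plane, whereas the disk of the theorem is the open
  unit ball. This radial diffeomorphism is odd, so it carries the symmetry along, and writing it
  with the inner product makes it visibly smooth at 0.\<close>

definition to_plane :: "complex \<Rightarrow> complex" where
  "to_plane x = (1 / sqrt (1 - x \<bullet> x)) *\<^sub>R x"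

definition to_disk :: "complex \<Rightarrow> complex" where
  "to_disk y = (1 / sqrt (1 + y \<bullet> y)) *\<^sub>R y"

lemma one_minus_inner_pos: "x \<in> disk \<Longrightarrow> 1 - x \<bullet> x > 0"
  by (simp add: dot_square_norm abs_square_less_1)

lemma one_plus_inner_pos: "1 + (y::complex) \<bullet> y > 0"
  by (simp add: add_pos_nonneg)

lemma inner_scaleR_self: "(a *\<^sub>R x) \<bullet> (a *\<^sub>R x) = a\<^sup>2 * (x \<bullet> x)"
  by (simp add: power2_eq_square)

lemma to_disk_to_plane: "x \<in> disk \<Longrightarrow> to_disk (to_plane x) = x"
proof -
  assume "x \<in> disk"
  then have p: "1 - x \<bullet> x > 0" by (rule one_minus_inner_pos)
  have "to_plane x \<bullet> to_plane x = (x \<bullet> x) / (1 - x \<bullet> x)"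
    unfolding to_plane_def inner_scaleR_self using p by (simp add: power_divide)
  then have "1 + to_plane x \<bullet> to_plane x = 1 / (1 - x \<bullet> x)"
    using p by (simp add: field_simps)
  then show ?thesis
    using p by (simp add: to_disk_def real_sqrt_divide) (simp add: to_plane_def)
qed

lemma to_disk_in_disk: "to_disk y \<in> disk"
proof -
  have "to_disk y \<bullet> to_disk y = (y \<bullet> y) / (1 + y \<bullet> y)"
    unfolding to_disk_def inner_scaleR_self using one_plus_inner_pos[of y] by (simp add: power_divide)
  also have "\<dots> < 1" using one_plus_inner_pos[of y] by simp
  finally show ?thesis by (simp add: dot_square_norm abs_square_less_1)
qed

lemma to_plane_to_disk: "to_plane (to_disk y) = y"
proof -
  note p = one_plus_inner_pos[of y]
  have "to_disk y \<bullet> to_disk y = (y \<bullet> y) / (1 + y \<bullet> y)"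
    unfolding to_disk_def inner_scaleR_self using p by (simp add: power_divide)
  then have "1 - to_disk y \<bullet> to_disk y = 1 / (1 + y \<bullet> y)"
    using p by (simp add: field_simps)
  then show ?thesis
    using p by (simp add: to_plane_def real_sqrt_divide) (simp add: to_disk_def)
qed

lemma to_plane_minus: "to_plane (- x) = - to_plane x"
  by (simp add: to_plane_def)

lemma Cinf_on_to_plane: "Cinf_on disk to_plane"
  unfolding to_plane_def[abs_def]
  by (intro Cinf_on_intros Cinf_on_divide Cinf_on_compose[OF Cinf_on_sqrt])
    (use one_minus_inner_pos in \<open>auto simp: less_imp_neq[symmetric] simp del: mem_ball\<close>)

lemma Cinf_on_to_disk: "Cinf_on UNIV to_disk"
  unfolding to_disk_def[abs_def]
  by (intro Cinf_on_intros Cinf_on_divide Cinf_on_compose[OF Cinf_on_sqrt])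
    (use one_plus_inner_pos in \<open>auto simp: less_imp_neq[symmetric]\<close>)

lemma to_plane_derivative:
  assumes "x \<in> disk"
  obtains D where "(to_plane has_derivative D) (at x)" "bij D"
proof
  define D where "D = frechet_derivative to_plane (at x)"
  define E where "E = frechet_derivative to_disk (at (to_plane x))"
  show D: "(to_plane has_derivative D) (at x)"
    using Cinf_on_has_derivative[OF Cinf_on_to_plane assms] by (simp add: D_def)
  have E: "(to_disk has_derivative E) (at (to_plane x))"
    using Cinf_on_has_derivative[OF Cinf_on_to_disk] by (simp add: E_def)
  have "((\<lambda>x. to_disk (to_plane x)) has_derivative (\<lambda>h. E (D h))) (at x)"
    by (rule has_derivative_compose[OF D E])
  then have "((\<lambda>x. x) has_derivative (\<lambda>h. E (D h))) (at x)"
    by (rule has_derivative_transform_within_open[where s = disk])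
      (use assms to_disk_to_plane in auto)
  then have "(\<lambda>h. E (D h)) = (\<lambda>h. h)" using has_derivative_ident has_derivative_unique by blast
  then have "inj D" by (metis injI)
  moreover have "linear D" using D has_derivative_linear by blast
  ultimately show "bij D" using linear_injective_imp_surjective by (auto simp: bij_def)
qed

section \<open>The immersed Lagrangian disk\<close>

context closed_end
begin

definition disk_map :: "complex \<Rightarrow> complex \<times> complex" where
  "disk_map x = surface (to_plane x)"

lemma disk_map_smooth: "Cinf_on disk disk_map"
  unfolding disk_map_def[abs_def] by (rule Cinf_on_compose[OF surface_smooth Cinf_on_to_plane]) simp

lemma disk_map_derivative:
  assumes "x \<in> disk"
  obtains D L where "frechet_derivative disk_map (at x) = (\<lambda>h. D (L h))"
    "(surface has_derivative D) (at (to_plane x))" "bij L" "inj D"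
    "\<forall>u v. symplectic_form (D u) (D v) = 0"
proof -
  obtain D where D: "(surface has_derivative D) (at (to_plane x))" "inj D"
    "\<And>u v. symplectic_form (D u) (D v) = 0" using surface_derivative by blast
  obtain L where L: "(to_plane has_derivative L) (at x)" "bij L"
    using to_plane_derivative[OF assms] by blast
  have "(disk_map has_derivative (\<lambda>h. D (L h))) (at x)"
    unfolding disk_map_def[abs_def] by (rule has_derivative_compose[OF L(1) D(1)])
  then have "frechet_derivative disk_map (at x) = (\<lambda>h. D (L h))"
    by (rule frechet_derivative_at[symmetric])
  then show ?thesis using that D L by blast
qed

lemma immersion_disk_map: "immersion_on disk disk_map"
  unfolding immersion_on_def
proof (intro conjI ballI)
  show "smooth_on disk disk_map" by (rule smooth_on_if_Cinf[OF disk_map_smooth]) simp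
  fix x :: complex assume "x \<in> disk"
  then obtain D L where DL: "frechet_derivative disk_map (at x) = (\<lambda>h. D (L h))"
    "(surface has_derivative D) (at (to_plane x))" "bij L" "inj D"
    "\<forall>u v. symplectic_form (D u) (D v) = 0"
    by (rule disk_map_derivative)
  show "inj (frechet_derivative disk_map (at x))"
    using inj_compose[OF DL(4) bij_is_inj[OF DL(3)]] by (simp add: DL(1) comp_def)
qed

lemma lagrangian_disk_map: "lagrangian_on disk disk_map"
  unfolding lagrangian_on_def
proof (intro ballI allI)
  fix x u v :: complex assume "x \<in> disk"
  then obtain D L where DL: "frechet_derivative disk_map (at x) = (\<lambda>h. D (L h))"
    "(surface has_derivative D) (at (to_plane x))" "bij L" "inj D"
    "\<forall>u v. symplectic_form (D u) (D v) = 0"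
    by (rule disk_map_derivative)
  show "symplectic_form (frechet_derivative disk_map (at x) u) (frechet_derivative disk_map (at x) v) = 0"
    by (simp only: DL(1,5))
qed

text \<open>For a continuous map into a Hausdorff k-space it suffices that preimages of compact sets
  are compact. In the plane such a preimage is closed by continuity and bounded by
  \<open>norm_surface_ge\<close>; \<open>to_disk\<close> then moves it into the disk.\<close>

lemma proper_disk_map: "proper_map (top_of_set disk) euclidean disk_map"
proof (rule compact_imp_proper_map)
  show "k_space (euclidean :: (complex \<times> complex) topology)"
    by (simp add: metrizable_imp_k_space metrizable_space_euclidean)
  show "kc_space (euclidean :: (complex \<times> complex) topology)"
    by (simp add: Hausdorff_imp_kc_space Hausdorff_space_euclidean)
  show "continuous_map (top_of_set disk) euclidean disk_map \<or> kc_space (top_of_set disk)"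
    using Cinf_on_continuous[OF disk_map_smooth] by simp
  fix C :: "(complex \<times> complex) set" assume "compactin euclidean C"
  then have C: "compact C" by simp
  have cs: "continuous_on UNIV surface" by (rule Cinf_on_continuous[OF surface_smooth])
  have "compact (surface -` C)"
  proof (subst compact_eq_bounded_closed, intro conjI)
    show "closed (surface -` C)"
      using cs C by (simp add: compact_imp_closed continuous_closed_vimage continuous_on_eq_continuous_at)
    obtain B where B: "\<And>y. y \<in> C \<Longrightarrow> norm y \<le> B" using C compact_imp_bounded bounded_iff by metis
    have "cmod w \<le> max 1 B" if "surface w \<in> C" for w
    proof (cases "cmod w \<le> 1")
      case False
      then have "cmod w ^ 1 \<le> cmod w ^ N" using N(1) by (intro power_increasing) auto
      also have "\<dots> \<le> norm (surface w)" by (rule norm_surface_ge)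
      also have "\<dots> \<le> B" by (rule B[OF that])
      finally show ?thesis by simp
    qed simp
    then show "bounded (surface -` C)" unfolding bounded_iff by (intro exI[of _ "max 1 B"]) auto
  qed
  then have "compact (to_disk ` (surface -` C))"
    by (intro compact_continuous_image continuous_on_subset[OF Cinf_on_continuous[OF Cinf_on_to_disk]]) auto
  moreover have "{x \<in> topspace (top_of_set disk). disk_map x \<in> C} = to_disk ` (surface -` C)"
  proof (intro set_eqI iffI)
    fix x assume "x \<in> {x \<in> topspace (top_of_set disk). disk_map x \<in> C}"
    then have "x = to_disk (to_plane x)" "to_plane x \<in> surface -` C"
      using to_disk_to_plane by (auto simp: disk_map_def)
    then show "x \<in> to_disk ` (surface -` C)" by blast
  next
    fix x assume "x \<in> to_disk ` (surface -` C)"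
    then show "x \<in> {x \<in> topspace (top_of_set disk). disk_map x \<in> C}"
      using to_disk_in_disk by (auto simp: disk_map_def to_plane_to_disk simp del: mem_ball)
  qed
  ultimately show "compactin (top_of_set disk) {x \<in> topspace (top_of_set disk). disk_map x \<in> C}"
    using to_disk_in_disk by (auto simp: compactin_subtopology simp del: mem_ball)
qed simp

lemma properly_immersed_disk_map: "properly_immersed_lagrangian_disk disk_map"
  by (simp add: properly_immersed_lagrangian_disk_def immersion_disk_map lagrangian_disk_map proper_disk_map)

lemma minus_invariant_disk_map: "minus_invariant_disk disk_map"
  unfolding minus_invariant_disk_def
proof (intro exI conjI ballI)
  show "diffeomorphism_betw uminus disk disk"
    by (rule diffeomorphism_betwI[where g = uminus])
      (auto intro!: smooth_on_if_Cinf[of disk] Cinf_on_minus Cinf_on_ident)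
  show "disk_map (- x) = - disk_map x" for x
    by (simp add: disk_map_def to_plane_minus surface_odd)
qed

lemma disk_map_image: "disk_map ` disk = range surface"
proof
  have "surface w = disk_map (to_disk w)" for w by (simp add: disk_map_def to_plane_to_disk)
  then show "range surface \<subseteq> disk_map ` disk" using to_disk_in_disk by blast
qed (auto simp: disk_map_def)

text \<open>The radial direction \<open>\<zeta> \<mapsto> \<zeta> + t\<close> is the one that crosses the sphere.\<close>

lemma transverse_disk_map:
  assumes "\<And>\<zeta>. norm (log_surface \<zeta>) = R \<Longrightarrow>
      \<exists>d. d \<noteq> 0 \<and> ((\<lambda>t. (norm (log_surface (Complex t (Im \<zeta>))))\<^sup>2) has_real_derivative d) (at (Re \<zeta>))"
    and "R \<noteq> norm (surface 0)"
  shows "transverse_to_sphere disk disk_map R"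
  unfolding transverse_to_sphere_def
proof (intro ballI impI)
  fix x :: complex assume x: "x \<in> disk" "disk_map x \<in> sphere 0 R"
  define w where "w = to_plane x"
  have Rw: "norm (surface w) = R" using x by (simp add: disk_map_def w_def)
  then have w0: "w \<noteq> 0" using assms(2) by auto
  obtain D L where DL: "frechet_derivative disk_map (at x) = (\<lambda>h. D (L h))"
    "(surface has_derivative D) (at w)" "bij L" "inj D"
    "\<forall>u v. symplectic_form (D u) (D v) = 0"
    unfolding w_def by (rule disk_map_derivative[OF x(1)])
  define \<zeta> where "\<zeta> = of_nat N * Ln w"
  have N0: "of_nat N \<noteq> (0 :: complex)" using N(1) by simp
  have sl: "surface (exp (Complex t (Im \<zeta>) / of_nat N)) = log_surface (Complex t (Im \<zeta>))" for t
    using surface_exp[of "Complex t (Im \<zeta>) / of_nat N"] N0 by simp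
  have "Complex (Re \<zeta>) (Im \<zeta>) / of_nat N = Ln w"
    using N0 by (simp only: complex_surj) (simp add: \<zeta>_def)
  then have ew: "exp (Complex (Re \<zeta>) (Im \<zeta>) / of_nat N) = w" using w0 by simp
  obtain d where d: "d \<noteq> 0"
      "((\<lambda>t. (norm (log_surface (Complex t (Im \<zeta>))))\<^sup>2) has_real_derivative d) (at (Re \<zeta>))"
    using assms(1)[of \<zeta>] Rw w0 by (auto simp: surface_def \<zeta>_def)
  define u where "u = w / of_nat N"
  have "((\<lambda>t. exp (Complex t (Im \<zeta>) / of_nat N)) has_derivative (\<lambda>h. h *\<^sub>R u)) (at (Re \<zeta>))"
  proof -
    have "((\<lambda>z. exp ((z + \<i> * of_real (Im \<zeta>)) / of_nat N)) has_field_derivative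
        exp ((of_real (Re \<zeta>) + \<i> * of_real (Im \<zeta>)) / of_nat N) / of_nat N) (at (of_real (Re \<zeta>)))"
      using N0 by (auto intro!: derivative_eq_intros)
    from has_derivative_compose[OF bounded_linear_imp_has_derivative[OF bounded_linear_of_real]
        this[unfolded has_field_derivative_def]]
    have "((\<lambda>t. exp ((of_real t + \<i> * of_real (Im \<zeta>)) / of_nat N)) has_derivative
        (\<lambda>h. exp ((of_real (Re \<zeta>) + \<i> * of_real (Im \<zeta>)) / of_nat N) / of_nat N * of_real h)) (at (Re \<zeta>))" .
    then show ?thesis using ew by (simp add: Complex_eq u_def scaleR_conv_of_real mult_ac)
  qed
  from has_derivative_compose[OF this, of surface D]
  have "((\<lambda>t. log_surface (Complex t (Im \<zeta>))) has_derivative (\<lambda>h. D (h *\<^sub>R u))) (at (Re \<zeta>))"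
    using DL(2) ew sl by simp
  then have "((\<lambda>t. log_surface (Complex t (Im \<zeta>)) \<bullet> log_surface (Complex t (Im \<zeta>))) has_derivative
      (\<lambda>h. surface w \<bullet> D (h *\<^sub>R u) + D (h *\<^sub>R u) \<bullet> surface w)) (at (Re \<zeta>))"
    using has_derivative_inner[of "\<lambda>t. log_surface (Complex t (Im \<zeta>))" _ "Re \<zeta>" UNIV
        "\<lambda>t. log_surface (Complex t (Im \<zeta>))"] sl[of "Re \<zeta>"] ew by simp
  then have "(\<lambda>h. surface w \<bullet> D (h *\<^sub>R u) + D (h *\<^sub>R u) \<bullet> surface w) = (\<lambda>h. d * h)"
    using d(2) has_derivative_unique unfolding has_field_derivative_def
    by (simp add: dot_square_norm) blast
  from fun_cong[OF this, of 1] have "2 * (surface w \<bullet> D u) = d" by (simp add: inner_commute)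
  then have nz: "surface w \<bullet> D u \<noteq> 0" using d(1) by auto
  obtain u' where u': "L u' = u" using DL(3) by (metis bij_pointE)
  define Df where "Df = frechet_derivative disk_map (at x)"
  have lin: "linear Df"
    using Cinf_on_has_derivative[OF disk_map_smooth x(1)] has_derivative_linear by (simp add: Df_def)
  have Df: "disk_map x \<bullet> Df u' \<noteq> 0"
    using nz by (simp add: Df_def DL(1) u' disk_map_def flip: w_def)
  have "y \<in> {Df u + w |u w. disk_map x \<bullet> w = 0}" for y
  proof -
    define c where "c = (disk_map x \<bullet> y) / (disk_map x \<bullet> Df u')"
    have "disk_map x \<bullet> (y - Df (c *\<^sub>R u')) = 0"
      using Df by (simp add: linear_scale[OF lin] inner_diff_right c_def)
    then show ?thesis by (intro CollectI exI[of _ "c *\<^sub>R u'"] exI[of _ "y - Df (c *\<^sub>R u')"]) simp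
  qed
  then show "{frechet_derivative disk_map (at x) u + w |u w. disk_map x \<bullet> w = 0} = UNIV"
    unfolding Df_def by blast
qed

end

section \<open>The Lagrangian end of a braid\<close>

abbreviation der :: "(real \<Rightarrow> real) \<Rightarrow> real \<Rightarrow> real" where
  "der q x \<equiv> vector_derivative q (at x)"

lemma der_eqI: "(q has_real_derivative d) (at x) \<Longrightarrow> der q x = d"
  by (simp add: has_real_derivative_iff_has_vector_derivative vector_derivative_at)

lemma has_der: "Cinf_on UNIV q \<Longrightarrow> (q has_real_derivative der q x) (at x)"
  using Cinf_on_vector_derivative(2)[of UNIV q x]
  by (simp add: has_real_derivative_iff_has_vector_derivative)

lemma Cinf_on_der: "Cinf_on UNIV q \<Longrightarrow> Cinf_on UNIV (der q)"
  by (rule Cinf_on_vector_derivative)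

lemma der_periodic:
  assumes "Cinf_on UNIV q" "\<And>x. q (x + c) = q x"
  shows "der q (x + c) = der q x"
proof -
  have "((\<lambda>y. q (y + c)) has_real_derivative der q (x + c)) (at x)"
    using DERIV_shift[of q "der q (x + c)" x c] has_der[OF assms(1)] by simp
  then show ?thesis using der_eqI[of q "der q (x + c)" x] assms(2) by simp
qed

text \<open>For the summand \<open>S = p(t) q(\<theta>)\<close> of a generating function this is \<open>S\<^sub>\<theta> + \<i> S\<^sub>t\<close>.\<close>

definition exact_term :: "(real \<Rightarrow> real) \<Rightarrow> (real \<Rightarrow> real) \<Rightarrow> complex \<Rightarrow> complex" where
  "exact_term p q \<zeta> = Complex (p (Re \<zeta>) * der q (Im \<zeta>)) (der p (Re \<zeta>) * q (Im \<zeta>))"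

lemma Cinf_on_exact_term:
  assumes "Cinf_on UNIV p" "Cinf_on UNIV q"
  shows "Cinf_on UNIV (exact_term p q)"
  unfolding exact_term_def[abs_def]
  by (intro Cinf_on_intros Cinf_on_compose[OF assms(1)] Cinf_on_compose[OF assms(2)]
      Cinf_on_compose[OF Cinf_on_der[OF assms(1)]] Cinf_on_compose[OF Cinf_on_der[OF assms(2)]]) auto

text \<open>Both sides are the mixed partial \<open>p' q'\<close> of the generating
  function.\<close>

lemma exact_term_closed:
  assumes "Cinf_on UNIV p" "Cinf_on UNIV q"
  obtains D where "(exact_term p q has_derivative D) (at \<zeta>)" "Im (D \<i>) = Re (D 1)"
proof -
  have re: "((\<lambda>\<zeta>. g (Re \<zeta>)) has_derivative (\<lambda>h. der g (Re \<zeta>) * Re h)) (at \<zeta>)"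
    if "Cinf_on UNIV g" for g
    using has_derivative_compose[OF bounded_linear_imp_has_derivative[OF bounded_linear_Re]
        has_der[OF that, unfolded has_field_derivative_def]] by simp
  have im: "((\<lambda>\<zeta>. g (Im \<zeta>)) has_derivative (\<lambda>h. der g (Im \<zeta>) * Im h)) (at \<zeta>)"
    if "Cinf_on UNIV g" for g
    using has_derivative_compose[OF bounded_linear_imp_has_derivative[OF bounded_linear_Im]
        has_der[OF that, unfolded has_field_derivative_def]] by simp
  define D1 where "D1 h = p (Re \<zeta>) * (der (der q) (Im \<zeta>) * Im h) + der p (Re \<zeta>) * Re h * der q (Im \<zeta>)" for h
  define D2 where "D2 h = der p (Re \<zeta>) * (der q (Im \<zeta>) * Im h) + der (der p) (Re \<zeta>) * Re h * q (Im \<zeta>)" for h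
  have "((\<lambda>\<zeta>. p (Re \<zeta>) * der q (Im \<zeta>)) has_derivative D1) (at \<zeta>)"
    unfolding D1_def by (intro has_derivative_mult re im Cinf_on_der assms)
  moreover have "((\<lambda>\<zeta>. der p (Re \<zeta>) * q (Im \<zeta>)) has_derivative D2) (at \<zeta>)"
    unfolding D2_def by (intro has_derivative_mult re im Cinf_on_der assms)
  ultimately have "((\<lambda>\<zeta>. of_real (p (Re \<zeta>) * der q (Im \<zeta>)) + \<i> * of_real (der p (Re \<zeta>) * q (Im \<zeta>)))
      has_derivative (\<lambda>h. of_real (D1 h) + \<i> * of_real (D2 h))) (at \<zeta>)"
    by (intro has_derivative_add has_derivative_mult_right has_derivative_of_real)
  then have "(exact_term p q has_derivative (\<lambda>h. Complex (D1 h) (D2 h))) (at \<zeta>)"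
    by (simp add: exact_term_def[abs_def] Complex_eq)
  then show ?thesis using that by (simp add: D1_def D2_def)
qed

text \<open>\<open>exact_term\<close> sees \<open>p\<close> only through its germ at
  \<open>Re \<zeta>\<close>, so on either side of the transition region the cutoff may be replaced
  by the constant it equals there.\<close>

lemma exact_term_cong:
  assumes "open S" "Re \<zeta> \<in> S" "\<And>t. t \<in> S \<Longrightarrow> p t = p' t" "Cinf_on UNIV p'"
  shows "exact_term p q \<zeta> = exact_term p' q \<zeta>"
proof -
  have "(p has_real_derivative der p' (Re \<zeta>)) (at (Re \<zeta>))"
    by (rule has_field_derivative_transform_within_open[OF has_der[OF assms(4)] assms(1,2)])
      (simp add: assms(3))
  then show ?thesis using der_eqI assms by (simp add: exact_term_def)
qed

text \<open>\<open>A\<close> and \<open>B\<close> carry the two components of the link at infinity.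
  \<open>M\<close> bounds precisely the functions that \<open>K\<close> involves for
  \<open>Re \<zeta> > 1\<close>, so the estimates there depend on \<open>M\<close> alone.\<close>

locale front =
  fixes N :: nat and A B :: "real \<Rightarrow> real" and M :: real
  assumes N: "N \<ge> 1" "odd N"
    and A: "Cinf_on UNIV A" and B: "Cinf_on UNIV B"
    and A_periodic: "A (\<theta> + pi * real N) = A \<theta>" and B_periodic: "B (\<theta> + pi * real N) = B \<theta>"
    and bound: "\<bar>der A \<theta>\<bar> \<le> M" "\<bar>der B \<theta>\<bar> \<le> M" "\<bar>B \<theta>\<bar> \<le> M"
begin

definition c :: real where "c = 1 + 1 / real N"

definition inner_factor :: "real \<Rightarrow> real" where "inner_factor t = cutoff t * (exp (c * t) / c)"
definition outer_factor :: "real \<Rightarrow> real" where "outer_factor t = 1 - cutoff t"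
text \<open>The sign is chosen so that beyond the transition region the derivative in
  \<open>t\<close> is \<open>+ exp (- t)\<close>, which puts \<open>+ exp (- t) * B\<close> into the
  imaginary part of \<open>K\<close>.\<close>

definition decay_factor :: "real \<Rightarrow> real" where "decay_factor t = - (1 - cutoff t) * exp (- t)"

definition K :: "complex \<Rightarrow> complex" where
  "K \<zeta> = exact_term inner_factor (\<lambda>\<theta>. sin (c * \<theta>)) \<zeta> + exact_term outer_factor A \<zeta>
    + exact_term decay_factor B \<zeta>"

lemma c_pos: "c > 0"
  by (simp add: c_def add_pos_nonneg)

lemma Cinf_on_factors:
  "Cinf_on UNIV inner_factor" "Cinf_on UNIV outer_factor" "Cinf_on UNIV decay_factor"
  "Cinf_on UNIV (\<lambda>\<theta>. sin (c * \<theta>))"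
  unfolding inner_factor_def[abs_def] outer_factor_def[abs_def] decay_factor_def[abs_def]
  using c_pos by (auto intro!: Cinf_on_intros Cinf_on_divide Cinf_on_cutoff Cinf_on_exp_compose Cinf_on_sin)

lemma exact_term_0: "exact_term (\<lambda>t. 0) q \<zeta> = 0"
  by (simp add: exact_term_def zero_complex.code)

lemma K_inner: "Re \<zeta> < 0 \<Longrightarrow> K \<zeta> = exp (\<zeta> + \<zeta> / of_nat N)"
proof -
  assume neg: "Re \<zeta> < 0"
  have "exact_term inner_factor (\<lambda>\<theta>. sin (c * \<theta>)) \<zeta> = exact_term (\<lambda>t. exp (c * t) / c) (\<lambda>\<theta>. sin (c * \<theta>)) \<zeta>"
    by (rule exact_term_cong[of "{..<0}"])
      (use neg c_pos in \<open>auto simp: inner_factor_def cutoff_eq_1 intro!: Cinf_on_intros Cinf_on_divide Cinf_on_exp_compose\<close>)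
  moreover have "exact_term outer_factor A \<zeta> = exact_term (\<lambda>t. 0) A \<zeta>"
    by (rule exact_term_cong[of "{..<0}"])
      (use neg in \<open>auto simp: outer_factor_def cutoff_eq_1 intro!: Cinf_on_intros\<close>)
  moreover have "exact_term decay_factor B \<zeta> = exact_term (\<lambda>t. 0) B \<zeta>"
    by (rule exact_term_cong[of "{..<0}"])
      (use neg in \<open>auto simp: decay_factor_def cutoff_eq_1 intro!: Cinf_on_intros\<close>)
  moreover have "der (\<lambda>t. exp (c * t) / c) x = exp (c * x)" for x
    by (rule der_eqI) (use c_pos in \<open>auto intro!: derivative_eq_intros\<close>)
  moreover have "der (\<lambda>\<theta>. sin (c * \<theta>)) x = c * cos (c * x)" for x
    by (rule der_eqI) (auto intro!: derivative_eq_intros)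
  ultimately have "K \<zeta> = Complex (exp (c * Re \<zeta>) * cos (c * Im \<zeta>)) (exp (c * Re \<zeta>) * sin (c * Im \<zeta>))"
    using c_pos by (simp add: K_def exact_term_0) (simp add: exact_term_def)
  also have "\<dots> = exp (of_real c * \<zeta>)"
    by (simp add: exp_eq_polar complex_eq_iff)
  also have "of_real c * \<zeta> = \<zeta> + \<zeta> / of_nat N"
    by (simp add: c_def distrib_right)
  finally show ?thesis .
qed

lemma K_outer:
  "Re \<zeta> > 1 \<Longrightarrow> K \<zeta> = Complex (der A (Im \<zeta>) - exp (- Re \<zeta>) * der B (Im \<zeta>)) (exp (- Re \<zeta>) * B (Im \<zeta>))"
proof -
  assume large: "Re \<zeta> > 1"
  have "exact_term inner_factor (\<lambda>\<theta>. sin (c * \<theta>)) \<zeta> = exact_term (\<lambda>t. 0) (\<lambda>\<theta>. sin (c * \<theta>)) \<zeta>"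
    by (rule exact_term_cong[of "{1<..}"])
      (use large in \<open>auto simp: inner_factor_def cutoff_eq_0 intro!: Cinf_on_intros\<close>)
  moreover have "exact_term outer_factor A \<zeta> = exact_term (\<lambda>t. 1) A \<zeta>"
    by (rule exact_term_cong[of "{1<..}"])
      (use large in \<open>auto simp: outer_factor_def cutoff_eq_0 intro!: Cinf_on_intros\<close>)
  moreover have "exact_term decay_factor B \<zeta> = exact_term (\<lambda>t. - exp (- t)) B \<zeta>"
    by (rule exact_term_cong[of "{1<..}"])
      (use large in \<open>auto simp: decay_factor_def cutoff_eq_0 intro!: Cinf_on_intros Cinf_on_exp_compose\<close>)
  moreover have "der (\<lambda>t. - exp (- t)) x = exp (- x)" for x
    by (rule der_eqI) (auto intro!: derivative_eq_intros)
  ultimately show ?thesis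
    by (simp add: K_def exact_term_0) (simp add: exact_term_def complex_eq_iff)
qed

text \<open>\<open>c * pi * N\<close> equals \<open>pi * (N + 1)\<close>, and \<open>N + 1\<close>
  is even. So the holomorphic core has the same half period as the end.\<close>

lemma sin_periodic: "sin (c * (\<theta> + pi * real N)) = sin (c * \<theta>)"
proof -
  have "c * (\<theta> + pi * real N) = c * \<theta> + pi * real (N + 1)"
    using N(1) by (simp add: c_def field_simps)
  also have "\<dots> = c * \<theta> + 2 * pi * of_int (int ((N + 1) div 2))"
    using N(2) by (auto elim!: oddE simp: algebra_simps)
  finally show ?thesis using sin_cos_eq_iff by metis
qed

sublocale closed_end N K
proof
  show "N \<ge> 1" "odd N" by (rule N)+
  show "Cinf_on UNIV K" unfolding K_def[abs_def]
    by (intro Cinf_on_add Cinf_on_exact_term Cinf_on_factors A B)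
  show "K (\<zeta> + of_real (pi * real N) * \<i>) = K \<zeta>" for \<zeta>
    using der_periodic[OF A A_periodic] der_periodic[OF B B_periodic]
      der_periodic[OF Cinf_on_factors(4) sin_periodic]
    by (simp add: K_def exact_term_def A_periodic B_periodic sin_periodic)
  show "Re \<zeta> < 0 \<Longrightarrow> K \<zeta> = exp (\<zeta> + \<zeta> / of_nat N)" for \<zeta> by (rule K_inner)
  fix D \<zeta> assume D: "(K has_derivative D) (at \<zeta>)"
  obtain D1 where 1: "(exact_term inner_factor (\<lambda>\<theta>. sin (c * \<theta>)) has_derivative D1) (at \<zeta>)" "Im (D1 \<i>) = Re (D1 1)"
    by (rule exact_term_closed[OF Cinf_on_factors(1,4)])
  obtain D2 where 2: "(exact_term outer_factor A has_derivative D2) (at \<zeta>)" "Im (D2 \<i>) = Re (D2 1)"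
    by (rule exact_term_closed[OF Cinf_on_factors(2) A])
  obtain D3 where 3: "(exact_term decay_factor B has_derivative D3) (at \<zeta>)" "Im (D3 \<i>) = Re (D3 1)"
    by (rule exact_term_closed[OF Cinf_on_factors(3) B])
  have "(K has_derivative (\<lambda>h. D1 h + D2 h + D3 h)) (at \<zeta>)"
    unfolding K_def[abs_def] by (intro has_derivative_add 1 2 3)
  then have "D = (\<lambda>h. D1 h + D2 h + D3 h)" using D has_derivative_unique by blast
  then show "Im (D \<i>) = Re (D 1)" using 1 2 3 by simp
qed

text \<open>The squared distance from the origin, written by the formula valid for
  \<open>t > 1\<close> but used for all \<open>t\<close>, so that it is smooth on the whole plane as
  the implicit function argument requires.\<close>

definition F :: "real \<times> real \<Rightarrow> real" where
  "F x = (exp (fst x))\<^sup>2 + (exp (- fst x))\<^sup>2 *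
    ((der A (snd x) - exp (- fst x) * der B (snd x))\<^sup>2 + (exp (- fst x) * B (snd x))\<^sup>2)"

lemma F_smooth: "Cinf_on UNIV F"
  unfolding F_def[abs_def]
  by (intro Cinf_on_intros Cinf_on_exp_compose Cinf_on_compose[OF Cinf_on_der[OF A]]
      Cinf_on_compose[OF Cinf_on_der[OF B]] Cinf_on_compose[OF B]) auto

lemma norm_log_surface_outer: "Re \<zeta> > 1 \<Longrightarrow> (norm (log_surface \<zeta>))\<^sup>2 = F (Re \<zeta>, Im \<zeta>)"
  by (simp add: norm_log_surface K_outer F_def power_mult_distrib cmod_power2)

lemma M_nonneg: "M \<ge> 0"
  using bound(1)[of 0] by linarith

lemma K_bounds:
  assumes "t \<ge> 0"
  shows "\<bar>der A \<theta> - exp (- t) * der B \<theta>\<bar> \<le> 2 * M" "\<bar>exp (- t) * B \<theta>\<bar> \<le> M"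
    "\<bar>exp (- t) * der B \<theta>\<bar> \<le> M"
proof -
  have e: "exp (- t) \<le> 1" using assms by simp
  show 3: "\<bar>exp (- t) * der B \<theta>\<bar> \<le> M"
    using mult_mono[OF e bound(2)[of \<theta>]] by (simp add: abs_mult)
  show "\<bar>exp (- t) * B \<theta>\<bar> \<le> M"
    using mult_mono[OF e bound(3)[of \<theta>]] by (simp add: abs_mult)
  show "\<bar>der A \<theta> - exp (- t) * der B \<theta>\<bar> \<le> 2 * M"
    using 3 bound(1)[of \<theta>] by linarith
qed

text \<open>The bound 2 places \<open>t0\<close> in the region of the outer formula. The bound
  \<open>4 * M\<^sup>2\<close> gives
  \<open>2 * (exp t)\<^sup>2 \<ge> 2 + 4 * t > 16 * M\<^sup>2\<close>, which beats the error term in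
  the derivative of \<open>F\<close>.\<close>

definition t0 :: real where "t0 = max 2 (4 * M\<^sup>2)"

lemma F_increasing:
  assumes "t \<ge> t0"
  obtains d where "d > 0" "((\<lambda>t. F (t, \<theta>)) has_real_derivative d) (at t)"
proof
  define X where "X = der A \<theta> - exp (- t) * der B \<theta>"
  define Y where "Y = exp (- t) * B \<theta>"
  define W where "W = exp (- t) * der B \<theta>"
  \<comment> \<open>In \<open>t\<close> the derivatives of \<open>X\<close> and \<open>Y\<close> are
    \<open>W\<close> and \<open>- Y\<close>.\<close>
  define d where "d = 2 * (exp t)\<^sup>2 + (exp (- t))\<^sup>2 * (2 * X * W - 2 * X\<^sup>2 - 4 * Y\<^sup>2)"
  show "((\<lambda>t. F (t, \<theta>)) has_real_derivative d) (at t)"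
    unfolding F_def d_def X_def Y_def W_def
    by (auto intro!: derivative_eq_intros simp: power2_eq_square algebra_simps)
  have t: "t \<ge> 0" "t \<ge> 4 * M\<^sup>2" using assms by (auto simp: t0_def)
  have XYW: "\<bar>X\<bar> \<le> 2 * M" "\<bar>Y\<bar> \<le> M" "\<bar>W\<bar> \<le> M"
    using K_bounds[OF t(1)] by (auto simp: X_def Y_def W_def)
  have "X\<^sup>2 \<le> (2 * M)\<^sup>2" "Y\<^sup>2 \<le> M\<^sup>2"
    using XYW M_nonneg abs_le_square_iff[of X "2 * M"] abs_le_square_iff[of Y M] by simp_all
  moreover have "\<bar>X * W\<bar> \<le> (2 * M) * M"
    unfolding abs_mult using XYW M_nonneg by (intro mult_mono) auto
  moreover have "X\<^sup>2 \<ge> 0" "Y\<^sup>2 \<ge> 0" "2 * X * W = 2 * (X * W)" "(2 * M)\<^sup>2 = 4 * M\<^sup>2" "(2 * M) * M = 2 * M\<^sup>2"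
    by (simp_all add: power2_eq_square)
  \<comment> \<open>The three terms contribute at most \<open>4 * M\<^sup>2\<close>,
    \<open>8 * M\<^sup>2\<close> and \<open>4 * M\<^sup>2\<close>.\<close>
  ultimately have "\<bar>2 * X * W - 2 * X\<^sup>2 - 4 * Y\<^sup>2\<bar> \<le> 16 * M\<^sup>2"
    by linarith
  moreover have "(exp (- t))\<^sup>2 \<le> 1" using t(1) by (simp add: power_le_one)
  ultimately have "\<bar>(exp (- t))\<^sup>2 * (2 * X * W - 2 * X\<^sup>2 - 4 * Y\<^sup>2)\<bar> \<le> 1 * (16 * M\<^sup>2)"
    unfolding abs_mult by (intro mult_mono) auto
  moreover have "(exp t)\<^sup>2 \<ge> 1 + 2 * t"
    using exp_ge_add_one_self[of "2 * t"] by (simp add: exp_double)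
  ultimately show "d > 0" using t unfolding d_def by linarith
qed

lemma F_strict_mono: "t0 \<le> s \<Longrightarrow> s < t \<Longrightarrow> F (s, \<theta>) < F (t, \<theta>)"
proof (rule DERIV_pos_imp_increasing[where f = "\<lambda>t. F (t, \<theta>)"])
  fix x assume "t0 \<le> s" "s \<le> x"
  then show "\<exists>y. ((\<lambda>t. F (t, \<theta>)) has_real_derivative y) (at x) \<and> 0 < y"
    using F_increasing[of x \<theta>] by (metis order_trans)
qed

lemma F_periodic: "F (t, \<theta> + pi * real N) = F (t, \<theta>)"
  by (simp add: F_def der_periodic[OF A A_periodic] der_periodic[OF B B_periodic] B_periodic)

text \<open>For such radii the core and the transition region lie strictly inside the ball, so the
  sphere meets the surface only where the outer formula and the monotonicity of \<open>F\<close>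
  apply.\<close>

definition large :: "real \<Rightarrow> bool" where
  "large R \<longleftrightarrow> R > 0 \<and> (\<forall>\<zeta>. Re \<zeta> \<le> t0 \<longrightarrow> norm (log_surface \<zeta>) < R)"

text \<open>The part with \<open>Re \<zeta> \<le> t0\<close> is the image of a punctured disk of
  radius \<open>exp (t0 / N)\<close> in the \<open>w\<close>-plane. Filling in the origin makes the
  disk compact, hence its image bounded.\<close>

lemma eventually_large: "\<forall>\<^sub>F R in at_top. large R"
proof -
  have "compact (surface ` cball 0 (exp (t0 / real N)))"
    by (intro compact_continuous_image continuous_on_subset[OF Cinf_on_continuous[OF surface_smooth]]) auto
  then obtain R0 where "\<forall>x\<in>surface ` cball 0 (exp (t0 / real N)). norm x \<le> R0"
    using compact_imp_bounded bounded_iff by blast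
  then have R0: "norm (surface w) \<le> R0" if "cmod w \<le> exp (t0 / real N)" for w
    using that by simp
  have "norm (log_surface \<zeta>) \<le> R0" if "Re \<zeta> \<le> t0" for \<zeta>
  proof -
    have "log_surface \<zeta> = surface (exp (\<zeta> / of_nat N))"
      using surface_exp[of "\<zeta> / of_nat N"] N(1) by simp
    then show ?thesis using R0[of "exp (\<zeta> / of_nat N)"] that by (simp add: divide_right_mono)
  qed
  then have "large R" if "R > max 0 R0" for R using that by (force simp: large_def)
  then show ?thesis by (intro eventually_mono[OF eventually_gt_at_top[of "max 0 R0"]])
qed

section \<open>The link on a large sphere\<close>

definition \<sigma> :: "real \<Rightarrow> real \<Rightarrow> real" where
  "\<sigma> R \<theta> = (SOME t. t > t0 \<and> F (t, \<theta>) = R\<^sup>2)"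

context
  fixes R :: real
  assumes R: "large R"
begin

lemma R_pos: "R > 0"
  using R by (simp add: large_def)

lemma sphere_imp_outer: "norm (log_surface \<zeta>) = R \<Longrightarrow> Re \<zeta> > t0"
  using R by (force simp: large_def)

lemma outer_if_t0: "t \<ge> t0 \<Longrightarrow> t > 1"
  by (simp add: t0_def)

lemma \<sigma>: "\<sigma> R \<theta> > t0" "F (\<sigma> R \<theta>, \<theta>) = R\<^sup>2"
proof -
  have "F (t0, \<theta>) = (norm (log_surface (Complex t0 \<theta>)))\<^sup>2"
    using norm_log_surface_outer[of "Complex t0 \<theta>"] outer_if_t0 by simp
  also have "\<dots> < R\<^sup>2" using R by (intro power_strict_mono) (auto simp: large_def)
  finally have lo: "F (t0, \<theta>) < R\<^sup>2" .
  \<comment> \<open>At height \<open>ln R\<close> the summand \<open>(exp t)\<^sup>2\<close> of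
    \<open>F\<close> alone reaches \<open>R\<^sup>2\<close>.\<close>
  have hi: "R\<^sup>2 \<le> F (max t0 (ln R), \<theta>)"
  proof -
    have "R = exp (ln R)" using R_pos by simp
    also have "\<dots> \<le> exp (max t0 (ln R))" by simp
    finally have "R\<^sup>2 \<le> (exp (max t0 (ln R)))\<^sup>2" using R_pos by (intro power_mono) auto
    then show ?thesis by (simp add: F_def add_increasing2)
  qed
  have "\<exists>t\<ge>t0. t \<le> max t0 (ln R) \<and> F (t, \<theta>) = R\<^sup>2"
  proof (rule IVT')
    show "continuous_on {t0..max t0 (ln R)} (\<lambda>t. F (t, \<theta>))"
      by (rule continuous_on_compose2[OF Cinf_on_continuous[OF F_smooth]]) (auto intro!: continuous_intros)
  qed (use lo hi in auto)
  then obtain t where "t \<ge> t0" "F (t, \<theta>) = R\<^sup>2" by blast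
  moreover have "t \<noteq> t0" using lo calculation by auto
  ultimately have "\<exists>t. t > t0 \<and> F (t, \<theta>) = R\<^sup>2" by (intro exI[of _ t]) auto
  then show "\<sigma> R \<theta> > t0" "F (\<sigma> R \<theta>, \<theta>) = R\<^sup>2" unfolding \<sigma>_def by (metis (mono_tags, lifting) someI_ex)+
qed

lemma \<sigma>_unique: "t > t0 \<Longrightarrow> F (t, \<theta>) = R\<^sup>2 \<Longrightarrow> t = \<sigma> R \<theta>"
  using F_strict_mono[of t "\<sigma> R \<theta>" \<theta>] F_strict_mono[of "\<sigma> R \<theta>" t \<theta>] \<sigma>[of \<theta>]
  by (cases t "\<sigma> R \<theta>" rule: linorder_cases) auto

lemma \<sigma>_smooth: "Cinf_on UNIV (\<sigma> R)"
proof (rule Cinf_on_implicit[OF F_smooth _ \<sigma>])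
  fix t x assume "t \<ge> t0"
  then obtain d where d: "d > 0" "((\<lambda>t. F (t, x)) has_real_derivative d) (at t)" by (rule F_increasing)
  have "((\<lambda>t. F (t, x)) has_derivative (\<lambda>h. frechet_derivative F (at (t, x)) (h, 0))) (at t)"
    by (rule has_derivative_compose[OF _ Cinf_on_has_derivative[OF F_smooth], of "\<lambda>t. (t, x)", simplified])
      (auto intro!: derivative_eq_intros)
  then have "(\<lambda>h. frechet_derivative F (at (t, x)) (h, 0)) = (*) d"
    using d(2) has_derivative_unique unfolding has_field_derivative_def by blast
  from fun_cong[OF this, of 1] show "frechet_derivative F (at (t, x)) (1, 0) > 0" using d(1) by simp
qed

lemma \<sigma>_periodic: "\<sigma> R (\<theta> + pi * real N) = \<sigma> R \<theta>"
  using \<sigma>_unique[of "\<sigma> R (\<theta> + pi * real N)" \<theta>] \<sigma>[of "\<theta> + pi * real N"] F_periodic by simp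

lemma sphere_iff: "norm (log_surface \<zeta>) = R \<longleftrightarrow> Re \<zeta> = \<sigma> R (Im \<zeta>)"
proof
  assume n: "norm (log_surface \<zeta>) = R"
  then have t: "Re \<zeta> > t0" by (rule sphere_imp_outer)
  then show "Re \<zeta> = \<sigma> R (Im \<zeta>)"
    using norm_log_surface_outer[of \<zeta>] outer_if_t0[of "Re \<zeta>"] n by (intro \<sigma>_unique) auto
next
  assume "Re \<zeta> = \<sigma> R (Im \<zeta>)"
  then have "(norm (log_surface \<zeta>))\<^sup>2 = R\<^sup>2"
    using norm_log_surface_outer[of \<zeta>] outer_if_t0[of "Re \<zeta>"] \<sigma>[of "Im \<zeta>"] by auto
  then show "norm (log_surface \<zeta>) = R" using R_pos by (simp add: power2_eq_iff_nonneg)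
qed

text \<open>This is \<open>a\<^sub>2 / cmod a\<^sub>1\<close> at the point of the sphere with angle
  \<open>\<theta>\<close>, namely \<open>exp (- 2 * t) * cis (- \<theta>) * K\<close> with
  \<open>t = \<sigma> R \<theta>\<close>.\<close>

definition z :: "real \<Rightarrow> complex" where
  "z \<theta> = cis (- \<theta>) * Complex ((exp (- \<sigma> R \<theta>))\<^sup>2 * (der A \<theta> - exp (- \<sigma> R \<theta>) * der B \<theta>))
    ((exp (- \<sigma> R \<theta>))\<^sup>2 * (exp (- \<sigma> R \<theta>) * B \<theta>))"

text \<open>On the sphere \<open>R = cmod a\<^sub>1 * sqrt (1 + (cmod z)\<^sup>2)\<close>, and this
  square root is exactly the normalising factor in \<open>to_S3\<close>.\<close>

lemma log_surface_on_sphere: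
  "log_surface (Complex (\<sigma> R \<theta>) \<theta>) = from_rotated (R *\<^sub>R to_S3 (cis \<theta>, z \<theta>))"
proof -
  define s where "s = \<sigma> R \<theta>"
  define \<zeta> where "\<zeta> = Complex s \<theta>"
  have K: "K \<zeta> = Complex (der A \<theta> - exp (- s) * der B \<theta>) (exp (- s) * B \<theta>)"
    using K_outer[of \<zeta>] \<sigma>(1)[of \<theta>] outer_if_t0[of s] by (simp add: \<zeta>_def s_def)
  have z: "z \<theta> = of_real ((exp (- s))\<^sup>2) * (cis (- \<theta>) * K \<zeta>)"
    unfolding K z_def s_def[symmetric] by (simp add: complex_eq_iff algebra_simps)
  have e: "exp \<zeta> = of_real (exp s) * cis \<theta>" "exp (- \<zeta>) = of_real (exp (- s)) * cis (- \<theta>)"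
    by (simp_all add: exp_eq_polar \<zeta>_def)
  have es: "exp s * exp (- s) = 1" by (simp add: exp_minus)
  have "R\<^sup>2 = (norm (log_surface \<zeta>))\<^sup>2" using sphere_iff[of \<zeta>] by (simp add: \<zeta>_def s_def)
  also have "\<dots> = (exp s)\<^sup>2 + (exp (- s) * cmod (K \<zeta>))\<^sup>2" by (simp add: norm_log_surface \<zeta>_def)
  also have "exp (- s) * cmod (K \<zeta>) = exp s * cmod (z \<theta>)"
    using es by (simp add: z norm_mult power2_eq_square mult.assoc[symmetric])
  also have "(exp s)\<^sup>2 + (exp s * cmod (z \<theta>))\<^sup>2 = (exp s * sqrt (1 + (cmod (z \<theta>))\<^sup>2))\<^sup>2"
    by (simp add: power_mult_distrib algebra_simps add_nonneg_nonneg)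
  finally have "R = exp s * sqrt (1 + (cmod (z \<theta>))\<^sup>2)"
    using R_pos by (subst (asm) power2_eq_iff_nonneg) auto
  moreover have "sqrt (1 + (cmod (z \<theta>))\<^sup>2) > 0" by (simp add: add_pos_nonneg)
  ultimately have "R / sqrt (1 + (cmod (z \<theta>))\<^sup>2) = exp s"
    by (metis less_irrefl nonzero_mult_div_cancel_right)
  then have "R *\<^sub>R to_S3 (cis \<theta>, z \<theta>) = exp s *\<^sub>R (cis \<theta>, z \<theta>)"
    by (simp add: to_S3_def)
  also have "exp s *\<^sub>R z \<theta> = exp (- \<zeta>) * K \<zeta>"
  proof -
    have "exp s *\<^sub>R z \<theta> = of_real (exp s * exp (- s) * exp (- s)) * (cis (- \<theta>) * K \<zeta>)"
      by (simp add: z scaleR_conv_of_real power2_eq_square mult.assoc)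
    then show ?thesis by (simp only: es) (simp add: e)
  qed
  then have "exp s *\<^sub>R (cis \<theta>, z \<theta>) = (exp \<zeta>, exp (- \<zeta>) * K \<zeta>)"
    by (simp add: e(1) scaleR_conv_of_real)
  finally show ?thesis by (simp add: log_surface_def \<zeta>_def s_def)
qed

lemma surface_eq_log: "w \<noteq> 0 \<Longrightarrow> surface w = log_surface (of_nat N * Ln w)"
  by (simp add: surface_def)

lemma surface_0: "surface 0 = 0"
  by (simp add: surface_def)

lemma sphere_image: "disk_map ` disk \<inter> sphere 0 R = range (\<lambda>\<theta>. log_surface (Complex (\<sigma> R \<theta>) \<theta>))"
proof (intro set_eqI iffI)
  fix y assume "y \<in> disk_map ` disk \<inter> sphere 0 R"
  then obtain w where w: "y = surface w" "norm (surface w) = R" by (auto simp: disk_map_image)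
  then have "w \<noteq> 0" using R_pos surface_0 by auto
  define \<zeta> where "\<zeta> = of_nat N * Ln w"
  have "surface w = log_surface \<zeta>" using \<open>w \<noteq> 0\<close> surface_eq_log by (simp add: \<zeta>_def)
  then have "Complex (\<sigma> R (Im \<zeta>)) (Im \<zeta>) = \<zeta>" using w sphere_iff[of \<zeta>] by (simp add: complex_eq_iff)
  then have "y = log_surface (Complex (\<sigma> R (Im \<zeta>)) (Im \<zeta>))"
    using w(1) \<open>surface w = log_surface \<zeta>\<close> by simp
  then show "y \<in> range (\<lambda>\<theta>. log_surface (Complex (\<sigma> R \<theta>) \<theta>))" by blast
next
  fix y assume "y \<in> range (\<lambda>\<theta>. log_surface (Complex (\<sigma> R \<theta>) \<theta>))"
  then obtain \<theta> where y: "y = log_surface (Complex (\<sigma> R \<theta>) \<theta>)" by auto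
  have "y = surface (exp (Complex (\<sigma> R \<theta>) \<theta> / of_nat N))"
    using surface_exp[of "Complex (\<sigma> R \<theta>) \<theta> / of_nat N"] N(1) by (simp add: y)
  moreover have "norm y = R" using sphere_iff[of "Complex (\<sigma> R \<theta>) \<theta>"] y by simp
  ultimately show "y \<in> disk_map ` disk \<inter> sphere 0 R" by (auto simp: disk_map_image)
qed

lemma rotated_coords_scaleR: "a *\<^sub>R rotated_coords (from_rotated (b *\<^sub>R x)) = (a * b) *\<^sub>R x"
  by (simp add: rotated_from_rotated)

lemma rescaled_link_eq: "rescaled_link disk_map R = to_S3 ` braid_of z"
  unfolding rescaled_link_def sphere_image braid_of_def log_surface_on_sphere image_image
  using R_pos by (simp add: rotated_coords_scaleR)

lemma transverse: "transverse_to_sphere disk disk_map R"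
proof (rule transverse_disk_map)
  fix \<zeta> assume "norm (log_surface \<zeta>) = R"
  then have t: "Re \<zeta> > t0" by (rule sphere_imp_outer)
  obtain d where d: "d > 0" "((\<lambda>t. F (t, Im \<zeta>)) has_real_derivative d) (at (Re \<zeta>))"
    by (rule F_increasing[OF less_imp_le[OF t]])
  have "((\<lambda>t. (norm (log_surface (Complex t (Im \<zeta>))))\<^sup>2) has_real_derivative d) (at (Re \<zeta>))"
    by (rule has_field_derivative_transform_within_open[OF d(2), of "{1<..}"])
      (use t outer_if_t0[of "Re \<zeta>"] norm_log_surface_outer in auto)
  then show "\<exists>d. d \<noteq> 0 \<and> ((\<lambda>t. (norm (log_surface (Complex t (Im \<zeta>))))\<^sup>2) has_real_derivative d) (at (Re \<zeta>))"
    using d(1) by (intro exI[of _ d]) simp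
qed (use R_pos surface_0 in auto)

text \<open>Two parameters of one point of the link differ by a multiple of
  \<open>2 * pi * N\<close>. As \<open>\<sigma>\<close> has this period, the two logarithms, divided
  by \<open>N\<close>, differ by whole turns and give the same \<open>w\<close>. The braid property
  is a hypothesis here because it comes from comparison with the target braid.\<close>

lemma injective_on_sphere:
  assumes "braid_curve N z"
  shows "inj_on disk_map {x \<in> disk. disk_map x \<in> sphere 0 R}"
proof (rule inj_onI)
  fix x y assume xy: "x \<in> {x \<in> disk. disk_map x \<in> sphere 0 R}" "y \<in> {x \<in> disk. disk_map x \<in> sphere 0 R}"
    "disk_map x = disk_map y"
  interpret z: braid_curve N z by fact
  have 1: "\<exists>\<theta>. to_plane v = exp (Complex (\<sigma> R \<theta>) \<theta> / of_nat N) \<and> disk_map v = from_rotated (R *\<^sub>R to_S3 (z.curve \<theta>))"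
    if "v \<in> {x \<in> disk. disk_map x \<in> sphere 0 R}" for v
  proof -
    define w where "w = to_plane v"
    have w: "norm (surface w) = R" "disk_map v = surface w" using that by (auto simp: w_def disk_map_def)
    then have "w \<noteq> 0" using R_pos surface_0 by auto
    define \<zeta> where "\<zeta> = of_nat N * Ln w"
    have sl: "surface w = log_surface \<zeta>" using \<open>w \<noteq> 0\<close> surface_eq_log by (simp add: \<zeta>_def)
    then have \<zeta>: "\<zeta> = Complex (\<sigma> R (Im \<zeta>)) (Im \<zeta>)" using w sphere_iff[of \<zeta>] by (simp add: complex_eq_iff)
    have "w = exp (\<zeta> / of_nat N)" using \<open>w \<noteq> 0\<close> N(1) by (simp add: \<zeta>_def)
    then show ?thesis using \<zeta> sl w(2) log_surface_on_sphere[of "Im \<zeta>"] unfolding z.curve_def w_def by metis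
  qed
  obtain a where a: "to_plane x = exp (Complex (\<sigma> R a) a / of_nat N)" "disk_map x = from_rotated (R *\<^sub>R to_S3 (z.curve a))"
    using 1[OF xy(1)] by blast
  obtain b where b: "to_plane y = exp (Complex (\<sigma> R b) b / of_nat N)" "disk_map y = from_rotated (R *\<^sub>R to_S3 (z.curve b))"
    using 1[OF xy(2)] by blast
  have "R *\<^sub>R to_S3 (z.curve a) = R *\<^sub>R to_S3 (z.curve b)"
    using xy(3) a(2) b(2) by (metis rotated_from_rotated)
  then have "to_S3 (z.curve a) = to_S3 (z.curve b)" using R_pos by simp
  then have "z.curve a = z.curve b" by (metis from_S3_to_S3 z.fst_curve norm_cis)
  then obtain m :: int where m: "a = b + 2 * pi * real N * of_int m" using z.curve_eq_iff by blast
  have "\<sigma> R a = \<sigma> R b"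
    using periodic_of_int[of "\<sigma> R" "pi * real N" b "2 * m"] \<sigma>_periodic by (simp add: m mult_ac)
  then have "Complex (\<sigma> R a) a / of_nat N = Complex (\<sigma> R b) b / of_nat N + of_int (2 * m) * pi * \<i>"
    using N(1) by (simp add: m Complex_eq field_simps)
  then have "to_plane x = to_plane y" using a(1) b(1) exp_eq by metis
  then show "x = y" using xy(1,2) to_disk_to_plane by (metis (no_types, lifting) mem_Collect_eq)
qed

lemma meets_sphere:
  assumes "braid_curve N z"
  shows "meets_sphere_in_braid N disk_map R"
  unfolding meets_sphere_in_braid_def is_S3_braid_def rescaled_link_eq
  using transverse injective_on_sphere[OF assms] braid_curve.is_braid[OF assms] by blast

text \<open>Undoing the two scales recovers \<open>A'\<close> and \<open>B\<close> up to order
  \<open>1 / R\<close>, with constants independent of \<open>R\<close> and \<open>\<theta>\<close>.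
  The quantity \<open>5 * M\<^sup>2\<close> bounds the squared modulus \<open>k\<close> of
  \<open>K\<close>, as its components are at most \<open>2 * M\<close> and \<open>M\<close>; the
  added 1 lets \<open>L\<close> also bound \<open>\<rho>\<^sup>2\<close>.\<close>

lemma normalised_end_close:
  fixes L :: real
  defines "L \<equiv> 1 + 5 * M\<^sup>2"
  shows "\<bar>R\<^sup>2 * ((exp (- \<sigma> R \<theta>))\<^sup>2 * (der A \<theta> - exp (- \<sigma> R \<theta>) * der B \<theta>)) - der A \<theta>\<bar> \<le> 2 * L * M * L / R" (is ?X)
    and "\<bar>R ^ 3 * ((exp (- \<sigma> R \<theta>))\<^sup>2 * (exp (- \<sigma> R \<theta>) * B \<theta>)) - B \<theta>\<bar> \<le> L * (L + 1) * M * L / R" (is ?Y)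
proof -
  define s where "s = exp (- \<sigma> R \<theta>)"
  define k where "k = (der A \<theta> - s * der B \<theta>)\<^sup>2 + (s * B \<theta>)\<^sup>2"
  \<comment> \<open>\<open>\<rho>\<close> compares the radius with
    \<open>cmod a\<^sub>1 = exp (\<sigma> R \<theta>)\<close>; the sphere equation becomes
    \<open>\<rho>\<^sup>2 = 1 + s ^ 4 * k\<close>.\<close>
  define \<rho> where "\<rho> = R * s"
  have t: "\<sigma> R \<theta> \<ge> 0" using \<sigma>(1)[of \<theta>] by (simp add: t0_def)
  have s: "0 < s" "s \<le> 1" using t by (auto simp: s_def)
  have Kb: "\<bar>der A \<theta> - s * der B \<theta>\<bar> \<le> 2 * M" "\<bar>s * B \<theta>\<bar> \<le> M" using K_bounds[OF t] by (auto simp: s_def)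
  have "(der A \<theta> - s * der B \<theta>)\<^sup>2 \<le> (2 * M)\<^sup>2" "(s * B \<theta>)\<^sup>2 \<le> M\<^sup>2"
    using Kb M_nonneg abs_le_square_iff[of "der A \<theta> - s * der B \<theta>" "2 * M"]
      abs_le_square_iff[of "s * B \<theta>" M] by simp_all
  then have k: "0 \<le> k" "k \<le> L" by (auto simp: k_def L_def power2_eq_square)
  have L: "L \<ge> 1" by (simp add: L_def)
  have es: "exp (\<sigma> R \<theta>) * s = 1" by (simp add: s_def exp_minus)
  have "\<rho>\<^sup>2 = F (\<sigma> R \<theta>, \<theta>) * s\<^sup>2" using \<sigma>(2)[of \<theta>] by (simp add: \<rho>_def power_mult_distrib)
  also have "\<dots> = (exp (\<sigma> R \<theta>) * s)\<^sup>2 + s ^ 4 * k"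
    by (simp add: F_def k_def flip: s_def) (simp add: algebra_simps power2_eq_square power4_eq_xxxx)
  finally have \<rho>2: "\<rho>\<^sup>2 = 1 + s ^ 4 * k" by (simp add: es)
  \<comment> \<open>A first-order bound suffices: all errors are measured by \<open>s\<close>, which
    is at most \<open>L / R\<close>, and the term with \<open>B'\<close> is only of first order
    anyway.\<close>
  have "s ^ 4 \<le> s ^ 1" using s by (intro power_decreasing) auto
  then have d1: "s ^ 4 * k \<le> s * L" using k s by (intro mult_mono) auto
  have d0: "0 \<le> s ^ 4 * k" using k s by simp
  have "s ^ 4 * k \<le> 1 * (5 * M\<^sup>2)"
  proof (rule mult_mono)
    show "k \<le> 5 * M\<^sup>2"
      using \<open>(der A \<theta> - s * der B \<theta>)\<^sup>2 \<le> (2 * M)\<^sup>2\<close> \<open>(s * B \<theta>)\<^sup>2 \<le> M\<^sup>2\<close> by (simp add: k_def power2_eq_square)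
  qed (use s k in \<open>auto simp: power_le_one\<close>)
  then have \<rho>L: "1 \<le> \<rho>\<^sup>2" "\<rho>\<^sup>2 \<le> L" using \<rho>2 d0 by (auto simp: L_def)
  have \<rho>pos: "\<rho> > 0" using R_pos s by (simp add: \<rho>_def)
  have \<rho>1: "\<rho> \<ge> 1" using power2_le_imp_le[of 1 \<rho>] \<rho>L(1) \<rho>pos by simp
  have "\<rho> \<le> \<rho>\<^sup>2" using \<rho>1 by (simp add: power2_eq_square)
  then have "R * s \<le> L" using \<rho>L by (simp add: \<rho>_def)
  then have sR: "s \<le> L / R" using R_pos by (simp add: field_simps)
  have A: "R\<^sup>2 * (s\<^sup>2 * (der A \<theta> - s * der B \<theta>)) - der A \<theta> = (s ^ 4 * k) * der A \<theta> - \<rho>\<^sup>2 * (s * der B \<theta>)"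
    using \<rho>2 by (simp add: \<rho>_def power_mult_distrib algebra_simps)
  have "\<bar>(s ^ 4 * k) * der A \<theta>\<bar> \<le> (s * L) * M"
    unfolding abs_mult[of "s ^ 4 * k"] using d1 d0 bound(1)[of \<theta>] L s by (intro mult_mono) auto
  moreover have "\<bar>\<rho>\<^sup>2 * (s * der B \<theta>)\<bar> \<le> L * (s * M)"
    unfolding abs_mult using \<rho>L bound(2)[of \<theta>] L s by (intro mult_mono) auto
  ultimately have "\<bar>R\<^sup>2 * (s\<^sup>2 * (der A \<theta> - s * der B \<theta>)) - der A \<theta>\<bar> \<le> 2 * L * M * s"
    unfolding A by (simp add: algebra_simps)
  also have "\<dots> \<le> 2 * L * M * (L / R)" using sR L M_nonneg by (intro mult_left_mono) auto
  finally show ?X by (simp add: s_def)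
  have B: "R ^ 3 * (s\<^sup>2 * (s * B \<theta>)) - B \<theta> = (\<rho> ^ 3 - 1) * B \<theta>"
    by (simp add: \<rho>_def power_mult_distrib power2_eq_square power3_eq_cube algebra_simps)
  \<comment> \<open>Passing to the fourth power leaves an expression in
    \<open>\<rho>\<^sup>2\<close>, the only power that the sphere equation controls
    directly.\<close>
  have "\<rho> ^ 3 \<le> \<rho> ^ 4" using \<rho>1 by (intro power_increasing) auto
  moreover have "\<rho> ^ 4 - 1 = (s ^ 4 * k) * (\<rho>\<^sup>2 + 1)"
  proof -
    have "\<rho> ^ 4 - 1 = (\<rho>\<^sup>2 - 1) * (\<rho>\<^sup>2 + 1)" by (simp add: algebra_simps power2_eq_square power4_eq_xxxx)
    then show ?thesis by (simp add: \<rho>2)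
  qed
  moreover have "(s ^ 4 * k) * (\<rho>\<^sup>2 + 1) \<le> (s * L) * (L + 1)"
    by (rule mult_mono) (use d1 d0 \<rho>L L s in auto)
  ultimately have "\<rho> ^ 3 - 1 \<le> (s * L) * (L + 1)" by linarith
  moreover have "\<rho> ^ 3 \<ge> 1" using \<rho>1 by simp
  ultimately have "\<bar>(\<rho> ^ 3 - 1) * B \<theta>\<bar> \<le> ((s * L) * (L + 1)) * M"
    unfolding abs_mult using bound(3)[of \<theta>] L s by (intro mult_mono) auto
  then have "\<bar>R ^ 3 * (s\<^sup>2 * (s * B \<theta>)) - B \<theta>\<bar> \<le> L * (L + 1) * M * s"
    unfolding B by (simp add: mult_ac)
  also have "\<dots> \<le> L * (L + 1) * M * (L / R)" using sR L M_nonneg by (intro mult_left_mono) auto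
  finally show ?Y by (simp add: s_def)
qed

end

end

section \<open>Perturbing and rescaling braids\<close>

lemma periodic_bounded:
  fixes f :: "real \<Rightarrow> real"
  assumes "continuous_on UNIV f" "\<And>x. f (x + c) = f x" "c > 0"
  obtains M where "\<And>x. \<bar>f x\<bar> \<le> M"
proof -
  have "compact (f ` {0..c})"
    by (intro compact_continuous_image continuous_on_subset[OF assms(1)]) auto
  then obtain M where "\<forall>y\<in>f ` {0..c}. norm y \<le> M" using compact_imp_bounded bounded_iff by blast
  then have "\<bar>f x\<bar> \<le> M" for x using periodic_range[of f c x] assms(2,3) by auto
  then show ?thesis by (rule that)
qed

lemma periodic_bounded_below:
  fixes f :: "real \<Rightarrow> real"
  assumes "continuous_on UNIV f" "\<And>x. f (x + c) = f x" "c > 0" "\<And>x. f x > 0"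
  obtains e where "e > 0" "\<And>x. e \<le> f x"
proof -
  have "\<exists>x\<in>{0..c}. \<forall>y\<in>{0..c}. f x \<le> f y"
    by (rule continuous_attains_inf) (use assms(3) continuous_on_subset[OF assms(1)] in auto)
  then obtain x0 where "\<forall>y\<in>{0..c}. f x0 \<le> f y" by blast
  then have "f x0 \<le> f x" for x using periodic_range[of f c x] assms(2,3) by auto
  then show ?thesis using that assms(4) by blast
qed

context braid_curve
begin

text \<open>Each distance between two sheets is a positive continuous periodic function, hence
  bounded away from 0, and there are finitely many pairs.\<close>

lemma sheets_separated:
  obtains \<delta> where "\<delta> > 0"
    "\<And>\<theta> i j. i < N \<Longrightarrow> j < N \<Longrightarrow> i \<noteq> j \<Longrightarrow> \<delta> \<le> cmod (z (\<theta> + 2 * pi * real i) - z (\<theta> + 2 * pi * real j))"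
proof -
  define d where "d p \<theta> = cmod (z (\<theta> + 2 * pi * real (fst p)) - z (\<theta> + 2 * pi * real (snd p)))" for p \<theta>
  define P where "P = {p. fst p < N \<and> snd p < N \<and> fst p \<noteq> snd p}"
  have 1: "\<exists>e>0. \<forall>\<theta>. e \<le> d p \<theta>" if "p \<in> P" for p
  proof -
    have zc: "continuous_on UNIV (\<lambda>\<theta>. z (\<theta> + a))" for a
      by (rule continuous_on_compose2[OF Cinf_on_continuous[OF smooth]]) (auto intro!: continuous_intros)
    have per: "d p (\<theta> + 2 * pi * real N) = d p \<theta>" for \<theta>
      using periodic[of "\<theta> + 2 * pi * real (fst p)"] periodic[of "\<theta> + 2 * pi * real (snd p)"]
      by (simp add: d_def add_ac)
    have pos: "d p \<theta> > 0" for \<theta>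
      using that inj_onD[OF separated[of \<theta>], of "fst p" "snd p"] by (auto simp: d_def P_def)
    have c: "continuous_on UNIV (d p)" unfolding d_def by (intro continuous_intros zc)
    have "2 * pi * real N > 0" using N by simp
    then obtain e where "e > 0" "\<And>\<theta>. e \<le> d p \<theta>"
      using periodic_bounded_below[OF c per _ pos] by blast
    then show ?thesis by blast
  qed
  have "finite P" by (rule finite_subset[of _ "{..<N} \<times> {..<N}"]) (auto simp: P_def)
  have "\<exists>e>0. \<forall>p\<in>Q. \<forall>\<theta>. e \<le> d p \<theta>" if "finite Q" "Q \<subseteq> P" for Q
    using that
  proof (induction Q rule: finite_induct)
    case (insert q Q)
    obtain e1 where "e1 > 0" "\<forall>p\<in>Q. \<forall>\<theta>. e1 \<le> d p \<theta>" using insert by auto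
    moreover obtain e2 where "e2 > 0" "\<forall>\<theta>. e2 \<le> d q \<theta>" using 1[of q] insert by auto
    ultimately show ?case by (intro exI[of _ "min e1 e2"]) (auto simp: min_le_iff_disj)
  qed (auto intro: exI[of _ 1])
  from this[OF \<open>finite P\<close> order_refl] obtain e where e: "e > 0" "\<forall>p\<in>P. \<forall>\<theta>. e \<le> d p \<theta>" by blast
  show ?thesis
  proof (rule that[OF e(1)])
    fix \<theta> i j assume "i < N" "j < N" "i \<noteq> j"
    then have "(i, j) \<in> P" by (simp add: P_def)
    from bspec[OF e(2) this] show "e \<le> cmod (z (\<theta> + 2 * pi * real i) - z (\<theta> + 2 * pi * real j))"
      by (simp add: d_def)
  qed
qed

text \<open>In the frame rotating with \<open>\<theta>\<close> the two components may be scaled separately, and a common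
  translation by \<open>m\<close> does not affect the differences of the sheets.\<close>

lemma perturbed_braid:
  fixes X Y :: "real \<Rightarrow> real"
  defines "h \<equiv> \<lambda>\<theta>. cis \<theta> * z \<theta>"
  assumes sep: "\<And>\<theta> i j. i < N \<Longrightarrow> j < N \<Longrightarrow> i \<noteq> j \<Longrightarrow>
      \<delta> \<le> cmod (z (\<theta> + 2 * pi * real i) - z (\<theta> + 2 * pi * real j))"
    and XY: "Cinf_on UNIV X" "Cinf_on UNIV Y"
      "\<And>\<theta>. X (\<theta> + 2 * pi * real N) = X \<theta>" "\<And>\<theta>. Y (\<theta> + 2 * pi * real N) = Y \<theta>"
    and X: "\<And>\<theta>. \<bar>X \<theta> - (Re (h \<theta>) - m)\<bar> \<le> \<epsilon>" and Y: "\<And>\<theta>. \<bar>Y \<theta> - Im (h \<theta>)\<bar> \<le> \<epsilon>"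
    and \<epsilon>: "4 * \<epsilon> < \<delta>" and ab: "a > 0" "b > 0" and t: "t \<in> {0..1}"
  shows "braid_curve N (\<lambda>\<theta>. cis (- \<theta>) *
      Complex (a * ((1 - t) * X \<theta> + t * Re (h \<theta>))) (b * ((1 - t) * Y \<theta> + t * Im (h \<theta>))))"
    (is "braid_curve N ?z")
proof
  show "N \<ge> 1" by (rule N)
  show "Cinf_on UNIV ?z" unfolding h_def
    by (intro Cinf_on_intros Cinf_on_cis smooth XY) auto
  have cisN: "cis (\<theta> + 2 * pi * real j) = cis \<theta>" for \<theta> j
    by (subst cis_eq_iff) (auto intro!: exI[of _ "int j"])
  have cisN': "cis (- \<theta> - 2 * pi * real j) = cis (- \<theta>)" for \<theta> j
    by (subst cis_eq_iff) (auto intro!: exI[of _ "- int j"])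
  show "?z (\<theta> + 2 * pi * real N) = ?z \<theta>" for \<theta>
    using cisN'[of \<theta> N] by (simp add: h_def cisN XY periodic)
  show "inj_on (\<lambda>k. ?z (\<theta> + 2 * pi * real k)) {0..<N}" for \<theta>
  proof (rule inj_onI, rule ccontr)
    fix i j assume ij: "i \<in> {0..<N}" "j \<in> {0..<N}" "i \<noteq> j"
      and eq: "?z (\<theta> + 2 * pi * real i) = ?z (\<theta> + 2 * pi * real j)"
    define p where "p = \<theta> + 2 * pi * real i"
    define q where "q = \<theta> + 2 * pi * real j"
    have "cis (- p) = cis (- \<theta>)" "cis (- q) = cis (- \<theta>)"
      using cisN'[of \<theta> i] cisN'[of \<theta> j] by (simp_all add: p_def q_def)
    with eq have 1: "(1 - t) * X p + t * Re (h p) = (1 - t) * X q + t * Re (h q)"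
      "(1 - t) * Y p + t * Im (h p) = (1 - t) * Y q + t * Im (h q)"
      using ab unfolding p_def[symmetric] q_def[symmetric] by simp_all
    have small: "\<bar>u\<bar> \<le> 2 * \<epsilon>" if "u = (1 - t) * v" "\<bar>v\<bar> \<le> 2 * \<epsilon>" for u v
      using that t mult_mono[of "1 - t" 1 "\<bar>v\<bar>" "2 * \<epsilon>"] by (simp add: abs_mult)
    have "Re (h p) - Re (h q) = (1 - t) * ((X q - (Re (h q) - m)) - (X p - (Re (h p) - m)))"
      using 1(1) by (simp add: algebra_simps)
    then have re: "\<bar>Re (h p) - Re (h q)\<bar> \<le> 2 * \<epsilon>" by (rule small) (use X[of p] X[of q] in linarith)
    have "Im (h p) - Im (h q) = (1 - t) * ((Y q - Im (h q)) - (Y p - Im (h p)))"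
      using 1(2) by (simp add: algebra_simps)
    then have im: "\<bar>Im (h p) - Im (h q)\<bar> \<le> 2 * \<epsilon>" by (rule small) (use Y[of p] Y[of q] in linarith)
    have "h p - h q = cis \<theta> * (z p - z q)"
      using cisN[of \<theta> i] cisN[of \<theta> j] by (simp add: h_def p_def q_def algebra_simps)
    then have "cmod (z p - z q) = cmod (h p - h q)" by (simp add: norm_mult)
    \<comment> \<open>Each real component contributes at most \<open>2 * \<epsilon>\<close>, whence
      the factor 4 in the hypothesis on \<open>\<delta>\<close>.\<close>
    also have "\<dots> \<le> 4 * \<epsilon>" using cmod_le[of "h p - h q"] re im by simp
    finally show False using sep[of i j \<theta>] ij \<epsilon> by (simp add: p_def q_def)
  qed
qed

end

text \<open>An antiderivative of \<open>f\<close> gains the same amount over every period.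
  Subtracting the linear function with that average slope, the mean \<open>m\<close> of
  \<open>f\<close>, makes it periodic.\<close>

lemma periodic_antiderivative:
  fixes f :: "real \<Rightarrow> real"
  assumes f: "Cinf_on UNIV f" and per: "\<And>x. f (x + c) = f x" and c: "c > 0"
  obtains A m where "Cinf_on UNIV A" "\<And>x. A (x + c) = A x" "\<And>x. der A x = f x - m"
proof -
  have "\<exists>F. \<forall>x::real. -\<infinity> < ereal x \<longrightarrow> ereal x < \<infinity> \<longrightarrow> (F has_vector_derivative f x) (at x)"
    by (rule einterval_antiderivative)
      (use Cinf_on_continuous[OF f] in \<open>auto simp: continuous_on_eq_continuous_at\<close>)
  then obtain F where F: "(F has_real_derivative f x) (at x)" for x
    by (auto simp: has_real_derivative_iff_has_vector_derivative)
  define m where "m = (F c - F 0) / c"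
  define A where "A x = F x - m * x" for x
  have A: "(A has_real_derivative (f x - m)) (at x)" for x
    unfolding A_def by (auto intro!: derivative_eq_intros F)
  have "((\<lambda>x. A (x + c) - A x) has_real_derivative 0) (at x)" for x
    using DERIV_diff[OF DERIV_shift[THEN iffD1, OF A[of "x + c"]] A[of x]] by (simp add: per)
  then have "A (x + c) - A x = A (0 + c) - A 0" for x
    by (rule DERIV_isconst_all[rule_format])
  moreover have "A (0 + c) - A 0 = 0" using c by (simp add: A_def m_def)
  ultimately have 2: "A (x + c) = A x" for x by simp
  have "Cinf_on UNIV A"
    by (rule Cinf_on_vector_antiderivative[of _ _ "\<lambda>x. f x - m"])
      (use A f in \<open>auto simp: has_real_derivative_iff_has_vector_derivative intro!: Cinf_on_intros\<close>)
  then show ?thesis using that 2 der_eqI[OF A] by blast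
qed

text \<open>Applied twice, the symmetry returns \<open>\<gamma>\<close> to its value after
  \<open>2 * k + 1\<close> full turns. By \<open>curve_eq_iff\<close>, \<open>N\<close> divides
  \<open>2 * k + 1\<close>, which is positive and less than \<open>2 * N\<close>; so it equals
  \<open>N\<close>.\<close>

lemma half_turn:
  assumes "braid_curve N \<gamma>" "k < N" "\<And>\<theta>. \<gamma> (\<theta> + 2 * pi * (real k + 1 / 2)) = - \<gamma> \<theta>"
  shows "\<gamma> (\<theta> + pi * real N) = - \<gamma> \<theta>"
proof -
  interpret braid_curve N \<gamma> by fact
  have turn2: "\<gamma> (0 + 2 * pi * (real k + 1 / 2) + 2 * pi * (real k + 1 / 2)) = \<gamma> 0"
    by (simp only: assms(3) minus_minus)
  have angle: "0 + 2 * pi * (real k + 1 / 2) + 2 * pi * (real k + 1 / 2) = 2 * pi * real (2 * k + 1)"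
    by (simp add: algebra_simps)
  have "\<gamma> (2 * pi * real (2 * k + 1)) = \<gamma> 0" using turn2 unfolding angle .
  moreover have "cis (2 * pi * real (2 * k + 1)) = cis 0"
    by (subst cis_eq_iff) (auto intro!: exI[of _ "int (2 * k + 1)"])
  ultimately have "curve (2 * pi * real (2 * k + 1)) = curve 0" by (simp add: curve_def)
  then obtain m :: int where "2 * pi * real (2 * k + 1) = 0 + 2 * pi * real N * of_int m"
    using curve_eq_iff by blast
  then have "real (2 * k + 1) = real N * of_int m" by simp
  then have "real_of_int (int (2 * k + 1)) = real_of_int (int N * m)" by simp
  then have m: "int (2 * k + 1) = int N * m" by (simp only: of_int_eq_iff)
  have "m > 0" using m N by (smt (verit) mult_nonneg_nonpos of_nat_0_le_iff of_nat_0_less_iff zero_less_Suc add.commute plus_1_eq_Suc)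
  moreover have "m < 2"
  proof (rule ccontr)
    assume "\<not> m < 2"
    then have "int N * 2 \<le> int N * m" by (intro mult_left_mono) auto
    then show False using m assms(2) by linarith
  qed
  ultimately have "m = 1" by simp
  then have "2 * k + 1 = N" using m by simp
  then have turn: "2 * pi * (real k + 1 / 2) = pi * real N" by (auto simp: algebra_simps)
  show ?thesis using assms(3)[of \<theta>] unfolding turn .
qed

theorem mainTheorem4:
  fixes N :: nat and \<gamma> :: "real \<Rightarrow> complex"
  assumes "N \<ge> 1" and "odd N"
    and "smooth_on UNIV \<gamma>"
    and "\<And>\<theta>. \<gamma> (\<theta> + 2 * pi * real N) = \<gamma> \<theta>"
    and "\<And>\<theta>. inj_on (\<lambda>k'. \<gamma> (\<theta> + 2 * pi * real k')) {0..<N}"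
    and "\<exists>k\<in>{0..<N}. \<forall>\<theta>. \<gamma> (\<theta> + 2 * pi * (real k + 1 / 2)) = - \<gamma> \<theta>"
  shows "\<exists>f :: complex \<Rightarrow> complex \<times> complex.
           properly_immersed_lagrangian_disk f \<and>
           minus_invariant_disk f \<and>
           (\<forall>\<^sub>F R in at_top. meets_sphere_in_braid N f R \<and>
              S3_braid_isotopic N (rescaled_link f R) (to_S3 ` braid_of \<gamma>))"
proof -
  have \<gamma>: "Cinf_on UNIV \<gamma>" using assms(3) by (simp add: smooth_on_open_iff)
  interpret \<gamma>: braid_curve N \<gamma> by unfold_locales (use assms \<gamma> in auto)
  have half: "\<gamma> (\<theta> + pi * real N) = - \<gamma> \<theta>" for \<theta>
    using assms(6) half_turn[OF \<gamma>.braid_curve_axioms] by auto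
  define h where "h \<theta> = cis \<theta> * \<gamma> \<theta>" for \<theta>
  have h: "Cinf_on UNIV h" unfolding h_def[abs_def] by (intro Cinf_on_intros Cinf_on_cis \<gamma>) auto
  \<comment> \<open>As \<open>N\<close> is odd, a shift by \<open>pi * N\<close> negates
    \<open>cis\<close>, and it negates \<open>\<gamma>\<close> by \<open>half\<close>; the signs
    cancel in \<open>h\<close>.\<close>
  have "cis (pi * real N) = (cis pi) ^ N"
    using Complex.DeMoivre[of pi N] by (simp only: mult.commute[of pi])
  then have "cis (\<theta> + pi * real N) = - cis \<theta>" for \<theta>
    using assms(2) by (simp flip: cis_mult)
  then have h_periodic: "h (\<theta> + pi * real N) = h \<theta>" for \<theta> by (simp add: h_def half)
  have cN: "pi * real N > 0" using assms(1) by simp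
  define B where "B \<theta> = Im (h \<theta>)" for \<theta>
  have B: "Cinf_on UNIV B" unfolding B_def[abs_def] by (intro Cinf_on_intros h)
  have B_periodic: "B (\<theta> + pi * real N) = B \<theta>" for \<theta> by (simp add: B_def h_periodic)
  obtain A m where A: "Cinf_on UNIV A" "\<And>\<theta>. A (\<theta> + pi * real N) = A \<theta>" "\<And>\<theta>. der A \<theta> = Re (h \<theta>) - m"
    using periodic_antiderivative[OF Cinf_on_Re[OF h] _ cN] h_periodic by (metis (mono_tags))
  obtain M1 where M1: "\<And>\<theta>. \<bar>der A \<theta>\<bar> \<le> M1"
    using periodic_bounded[OF Cinf_on_continuous[OF Cinf_on_der[OF A(1)]] der_periodic[OF A(1,2)] cN] by blast
  obtain M2 where M2: "\<And>\<theta>. \<bar>der B \<theta>\<bar> \<le> M2"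
    using periodic_bounded[OF Cinf_on_continuous[OF Cinf_on_der[OF B]] der_periodic[OF B B_periodic] cN] by blast
  obtain M3 where M3: "\<And>\<theta>. \<bar>B \<theta>\<bar> \<le> M3"
    using periodic_bounded[OF Cinf_on_continuous[OF B] B_periodic cN] by blast
  define M where "M = max M1 (max M2 M3)"
  interpret L: front N A B M
    by unfold_locales (use assms A B B_periodic M1 M2 M3 in \<open>auto simp: M_def le_max_iff_disj\<close>)
  obtain \<delta> where \<delta>: "\<delta> > 0" "\<And>\<theta> i j. i < N \<Longrightarrow> j < N \<Longrightarrow> i \<noteq> j \<Longrightarrow>
      \<delta> \<le> cmod (\<gamma> (\<theta> + 2 * pi * real i) - \<gamma> (\<theta> + 2 * pi * real j))"
    using \<gamma>.sheets_separated by blast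
  \<comment> \<open>\<open>l\<close> and \<open>C\<close> are the constants of
    \<open>normalised_end_close\<close>. They do not depend on \<open>R\<close>, so the error
    \<open>C / R\<close> drops below \<open>\<delta> / 4\<close> for large \<open>R\<close>.\<close>
  define l where "l = 1 + 5 * M\<^sup>2"
  define C where "C = max (2 * l * M * l) (l * (l + 1) * M * l)"
  have final: "meets_sphere_in_braid N L.disk_map R \<and>
      S3_braid_isotopic N (rescaled_link L.disk_map R) (to_S3 ` braid_of \<gamma>)"
    if R: "L.large R" "4 * C / \<delta> < R" for R
  proof -
    have Rp: "R > 0" using R(1) by (rule L.R_pos)
    define \<epsilon> where "\<epsilon> = C / R"
    have \<epsilon>: "4 * \<epsilon> < \<delta>" using R(2) Rp \<delta>(1) by (simp add: \<epsilon>_def field_simps)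
    define X where "X \<theta> = R\<^sup>2 * ((exp (- L.\<sigma> R \<theta>))\<^sup>2 * (der A \<theta> - exp (- L.\<sigma> R \<theta>) * der B \<theta>))" for \<theta>
    define Y where "Y \<theta> = R ^ 3 * ((exp (- L.\<sigma> R \<theta>))\<^sup>2 * (exp (- L.\<sigma> R \<theta>) * B \<theta>))" for \<theta>
    have \<sigma>: "Cinf_on UNIV (L.\<sigma> R)" by (rule L.\<sigma>_smooth[OF R(1)])
    have X: "Cinf_on UNIV X" unfolding X_def[abs_def]
      by (intro Cinf_on_intros Cinf_on_exp_compose Cinf_on_der A(1) B \<sigma>) auto
    have Y: "Cinf_on UNIV Y" unfolding Y_def[abs_def]
      by (intro Cinf_on_intros Cinf_on_exp_compose B \<sigma>) auto
    have "X (\<theta> + pi * real N) = X \<theta>" "Y (\<theta> + pi * real N) = Y \<theta>" for \<theta>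
      by (simp_all add: X_def Y_def L.\<sigma>_periodic[OF R(1)] der_periodic[OF A(1,2)]
          der_periodic[OF B B_periodic] B_periodic)
    then have per: "X (\<theta> + 2 * pi * real N) = X \<theta>" "Y (\<theta> + 2 * pi * real N) = Y \<theta>" for \<theta>
      using periodic_of_int[of X "pi * real N" \<theta> 2] periodic_of_int[of Y "pi * real N" \<theta> 2]
      by (simp_all add: mult_ac)
    have C: "c / R \<le> \<epsilon>" if "c \<le> C" for c using that Rp by (simp add: \<epsilon>_def divide_right_mono)
    have Xc: "\<bar>X \<theta> - (Re (h \<theta>) - m)\<bar> \<le> \<epsilon>" for \<theta>
      using L.normalised_end_close(1)[OF R(1), of \<theta>] C[of "2 * l * M * l"]
      by (simp add: X_def A(3) C_def l_def)
    have Yc: "\<bar>Y \<theta> - Im (h \<theta>)\<bar> \<le> \<epsilon>" for \<theta>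
      using L.normalised_end_close(2)[OF R(1), of \<theta>] C[of "l * (l + 1) * M * l"]
      by (simp add: Y_def B_def C_def l_def)
    \<comment> \<open>The positive weights run from the actual scales \<open>1 / R\<^sup>2\<close>
      and \<open>1 / R ^ 3\<close> of the link to 1, so that the family joins the link at time 0 to
      \<open>\<gamma>\<close> at time 1.\<close>
    define a where "a t = (1 - t) / R\<^sup>2 + t" for t
    define b where "b t = (1 - t) / R ^ 3 + t" for t
    define G where "G x = cis (- snd x) * Complex
        (a (fst x) * ((1 - fst x) * X (snd x) + fst x * Re (h (snd x))))
        (b (fst x) * ((1 - fst x) * Y (snd x) + fst x * Im (h (snd x))))" for x :: "real \<times> real"
    have G: "Cinf_on UNIV G"
      unfolding G_def[abs_def] a_def b_def
      by (intro Cinf_on_intros Cinf_on_cis Cinf_on_divide Cinf_on_compose[OF X] Cinf_on_compose[OF Y]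
          Cinf_on_compose[OF h]) (use Rp in auto)
    have braid: "braid_curve N (\<lambda>\<theta>. G (t, \<theta>))" if t: "t \<in> {0..1}" for t
    proof -
      have ab: "a t > 0" "b t > 0"
        using t Rp unfolding a_def b_def
        by (cases "t = 0"; auto intro!: add_nonneg_pos divide_nonneg_pos)+
      show ?thesis unfolding G_def fst_conv snd_conv h_def
        by (rule \<gamma>.perturbed_braid[OF \<delta>(2) X Y per _ _ \<epsilon> ab t])
          (use Xc Yc in \<open>auto simp: h_def\<close>)
    qed
    have G0: "(\<lambda>\<theta>. G (0, \<theta>)) = L.z R"
      using Rp by (simp add: G_def L.z_def[OF R(1)] a_def b_def X_def Y_def fun_eq_iff)
    have "cis (- \<theta>) * (cis \<theta> * \<gamma> \<theta>) = \<gamma> \<theta>" for \<theta> by (simp add: cis_mult flip: mult.assoc)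
    then have G1: "(\<lambda>\<theta>. G (1, \<theta>)) = \<gamma>"
      by (simp add: G_def a_def b_def h_def fun_eq_iff del: times_complex.sel)
    \<comment> \<open>The time 0 member of the same family shows that the link is itself a braid,
      the hypothesis left open in \<open>meets_sphere\<close>.\<close>
    have "braid_curve N (L.z R)" using braid[of 0] G0 by simp
    then have "meets_sphere_in_braid N L.disk_map R" by (rule L.meets_sphere[OF R(1)])
    moreover have "S3_braid_isotopic N (to_S3 ` braid_of (L.z R)) (to_S3 ` braid_of \<gamma>)"
      using S3_braid_isotopicI[OF G braid] by (simp add: G0 G1)
    ultimately show ?thesis by (simp add: L.rescaled_link_eq[OF R(1)])
  qed
  have "\<forall>\<^sub>F R in at_top. meets_sphere_in_braid N L.disk_map R \<and>
      S3_braid_isotopic N (rescaled_link L.disk_map R) (to_S3 ` braid_of \<gamma>)"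
    using L.eventually_large eventually_gt_at_top[of "4 * C / \<delta>"]
    by eventually_elim (rule final)
  then show ?thesis
    using L.properly_immersed_disk_map L.minus_invariant_disk_map by blast
qed

end
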